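(* Let $G=(V,E)$ be a directed graph with $n$ vertices and $\mathcal{P}\subseteq V\times V$ a set of demand pairs. Then $G$ can be preprocessed in polynomial time to construct an oracle of size $O(n+|\mathcal{P}|\sqrt{n})$ that, given any failing edge $f\in E$ (or any failing vertex $x\in V$) and any pair $(s,t)\in\mathcal{P}$, reports whether there is an $s$ to $t$ path in $G\setminus\{f\}$ (respectively in $G-x$) in $O(1)$ time.
   Context: $G\setminus\{f\}$ denotes $G$ with edge $f$ deleted; $G-x$ denotes $G$ with vertex $x$ and all its incident edges deleted. Size is measured in machine words. *)

theory Defs
  imports Complex_Main "Graph_Theory.Graph_Theory"
begin

section \<open>A word RAM with unit-cost instructions\<close>

text \<open>
  A machine word of \<open>w\<close> bits is a natural number below \<open>2 ^ w\<close>. A program is a fixed piece of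
  syntax, so it has a fixed finite set of registers and of numeric constants; all other data live
  in one random access memory, whose addresses are words as well.
\<close>

datatype binop = Plus | Minus | Times | Div | Mod | Less | Equal

datatype expr =
    Const nat
  | Reg nat
  | Load expr
  | Bin binop expr expr

datatype com =
    Skip
  | Assign nat expr
  | Store expr expr
  | Seq com com
  | If expr com com
  | While expr com

record state =
  regs :: "nat \<Rightarrow> nat"
  mem :: "nat \<Rightarrow> nat"

text \<open>
  Addition and multiplication wrap around, subtraction is truncated at \<open>0\<close>, and division follows
  the HOL conventions \<open>a div 0 = 0\<close> and \<open>a mod 0 = a\<close>.
\<close>

primrec binop_val :: "nat \<Rightarrow> binop \<Rightarrow> nat \<Rightarrow> nat \<Rightarrow> nat" where
  "binop_val w Plus a b = (a + b) mod 2 ^ w"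
| "binop_val w Minus a b = a - b"
| "binop_val w Times a b = (a * b) mod 2 ^ w"
| "binop_val w Div a b = a div b"
| "binop_val w Mod a b = a mod b"
| "binop_val w Less a b = (if a < b then 1 else 0)"
| "binop_val w Equal a b = (if a = b then 1 else 0)"

primrec expr_val :: "nat \<Rightarrow> expr \<Rightarrow> state \<Rightarrow> nat" where
  "expr_val w (Const a) \<sigma> = a mod 2 ^ w"
| "expr_val w (Reg r) \<sigma> = regs \<sigma> r"
| "expr_val w (Load e) \<sigma> = mem \<sigma> (expr_val w e \<sigma>)"
| "expr_val w (Bin f e1 e2) \<sigma> = binop_val w f (expr_val w e1 \<sigma>) (expr_val w e2 \<sigma>)"

primrec expr_cost :: "expr \<Rightarrow> nat" where
  "expr_cost (Const a) = 1"
| "expr_cost (Reg r) = 1"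
| "expr_cost (Load e) = 1 + expr_cost e"
| "expr_cost (Bin f e1 e2) = 1 + expr_cost e1 + expr_cost e2"

text \<open>
  \<open>exec w c \<sigma> T \<tau>\<close>: on a machine with \<open>w\<close>-bit words, the program \<open>c\<close> started in \<open>\<sigma>\<close> halts in \<open>\<tau>\<close>
  after exactly \<open>T\<close> steps.
\<close>

inductive exec :: "nat \<Rightarrow> com \<Rightarrow> state \<Rightarrow> nat \<Rightarrow> state \<Rightarrow> bool" for w :: nat where
  Skip: "exec w Skip \<sigma> 1 \<sigma>"
| Assign: "exec w (Assign r e) \<sigma> (1 + expr_cost e)
    (\<sigma>\<lparr>regs := (regs \<sigma>)(r := expr_val w e \<sigma>)\<rparr>)"
| Store: "exec w (Store a e) \<sigma> (1 + expr_cost a + expr_cost e)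
    (\<sigma>\<lparr>mem := (mem \<sigma>)(expr_val w a \<sigma> := expr_val w e \<sigma>)\<rparr>)"
| Seq: "exec w c1 \<sigma> T1 \<sigma>' \<Longrightarrow> exec w c2 \<sigma>' T2 \<tau> \<Longrightarrow> exec w (Seq c1 c2) \<sigma> (T1 + T2) \<tau>"
| IfTrue: "expr_val w b \<sigma> \<noteq> 0 \<Longrightarrow> exec w c1 \<sigma> T \<tau> \<Longrightarrow>
    exec w (If b c1 c2) \<sigma> (1 + expr_cost b + T) \<tau>"
| IfFalse: "expr_val w b \<sigma> = 0 \<Longrightarrow> exec w c2 \<sigma> T \<tau> \<Longrightarrow>
    exec w (If b c1 c2) \<sigma> (1 + expr_cost b + T) \<tau>"
| WhileFalse: "expr_val w b \<sigma> = 0 \<Longrightarrow> exec w (While b c) \<sigma> (1 + expr_cost b) \<sigma>"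
| WhileTrue: "expr_val w b \<sigma> \<noteq> 0 \<Longrightarrow> exec w c \<sigma> T1 \<sigma>' \<Longrightarrow> exec w (While b c) \<sigma>' T2 \<tau> \<Longrightarrow>
    exec w (While b c) \<sigma> (1 + expr_cost b + T1 + T2) \<tau>"

inductive_cases SkipE: "exec w Skip \<sigma> T \<tau>"
inductive_cases AssignE: "exec w (Assign r e) \<sigma> T \<tau>"
inductive_cases StoreE: "exec w (Store a e) \<sigma> T \<tau>"
inductive_cases SeqE: "exec w (Seq c1 c2) \<sigma> T \<tau>"
inductive_cases IfE: "exec w (If b c1 c2) \<sigma> T \<tau>"
inductive_cases WhileE: "exec w (While b c) \<sigma> T \<tau>"

lemma exec_deterministic:
  "exec w c \<sigma> T \<tau> \<Longrightarrow> exec w c \<sigma> T' \<tau>' \<Longrightarrow> T = T' \<and> \<tau> = \<tau>'"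
proof (induction arbitrary: T' \<tau>' rule: exec.induct)
  case Skip
  then show ?case by (elim SkipE) simp
next
  case Assign
  then show ?case by (elim AssignE) simp
next
  case Store
  then show ?case by (elim StoreE) simp
next
  case Seq
  from Seq.prems show ?case by (rule SeqE) (auto dest!: Seq.IH)
next
  case IfTrue
  from IfTrue.prems show ?case by (rule IfE) (use IfTrue.hyps(1) in \<open>auto dest: IfTrue.IH\<close>)
next
  case IfFalse
  from IfFalse.prems show ?case by (rule IfE) (use IfFalse.hyps(1) in \<open>auto dest: IfFalse.IH\<close>)
next
  case WhileFalse
  from WhileFalse.prems show ?case by (rule WhileE) (use WhileFalse.hyps in simp_all)
next
  case WhileTrue
  from WhileTrue.prems show ?case
    by (rule WhileE) (use WhileTrue.hyps(1) in \<open>auto dest!: WhileTrue.IH\<close>)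
qed

section \<open>Preprocessing and queries\<close>

text \<open>A list placed from position \<open>0\<close> on, with zeros everywhere after it.\<close>

definition layout :: "nat list \<Rightarrow> nat \<Rightarrow> nat" where
  "layout xs i = (if i < length xs then xs ! i else 0)"

text \<open>
  The program halts with the address of a memory block in register \<open>0\<close> and the number of words of
  that block in register \<open>1\<close>. Only this block \<open>D\<close> survives preprocessing: it is the stored oracle,
  and its size is \<open>length D\<close>.
\<close>

definition constructs :: "nat \<Rightarrow> com \<Rightarrow> nat list \<Rightarrow> nat \<Rightarrow> nat list \<Rightarrow> bool" where
  "constructs w prep inp T D \<longleftrightarrow>
     (\<exists>\<tau>. exec w prep \<lparr>regs = (\<lambda>_. 0), mem = layout inp\<rparr> T \<tau> \<and>
          D = map (mem \<tau>) [regs \<tau> 0 ..< regs \<tau> 0 + regs \<tau> 1])"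

text \<open>
  A query program sees nothing but the oracle \<open>D\<close> (in memory) and the query \<open>args\<close> (in registers);
  it leaves its answer, \<open>1\<close> for yes and \<open>0\<close> for no, in register \<open>0\<close>.
\<close>

definition reports :: "nat \<Rightarrow> com \<Rightarrow> nat list \<Rightarrow> nat list \<Rightarrow> nat \<Rightarrow> bool \<Rightarrow> bool" where
  "reports w query D args T ans \<longleftrightarrow>
     (\<exists>\<tau>. exec w query \<lparr>regs = layout args, mem = layout D\<rparr> T \<tau> \<and>
          regs \<tau> 0 = (if ans then 1 else 0))"

text \<open>
  The vertices are presented to the machine through a numbering \<open>\<nu>\<close> by \<open>0, \<dots>, n - 1\<close>; edges and
  demand pairs are listed without repetition in arbitrary order.
\<close>

definition numbering :: "('a \<Rightarrow> nat) \<Rightarrow> 'a pair_pre_digraph \<Rightarrow> bool" where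
  "numbering \<nu> G \<longleftrightarrow> bij_betw \<nu> (pverts G) {..<card (pverts G)}"

definition flatten_pairs :: "('a \<Rightarrow> nat) \<Rightarrow> ('a \<times> 'a) list \<Rightarrow> nat list" where
  "flatten_pairs \<nu> ps = concat (map (\<lambda>(a, b). [\<nu> a, \<nu> b]) ps)"

definition encodes ::
    "('a \<Rightarrow> nat) \<Rightarrow> 'a pair_pre_digraph \<Rightarrow> ('a \<times> 'a) set \<Rightarrow> nat list \<Rightarrow> bool" where
  "encodes \<nu> G P inp \<longleftrightarrow>
     (\<exists>es ps. distinct es \<and> set es = parcs G \<and> distinct ps \<and> set ps = P \<and>
        inp = [card (pverts G), length es, length ps] @ flatten_pairs \<nu> es @ flatten_pairs \<nu> ps)"

definition has_path :: "('a, 'b) pre_digraph \<Rightarrow> 'a \<Rightarrow> 'a \<Rightarrow> bool" where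
  "has_path H s t \<longleftrightarrow> (\<exists>p. pre_digraph.apath H s p t)"

end

theory Submission
  imports Defs
begin

text \<open>
  A vertex is critical for a pair \<open>(s, t)\<close> if it lies on every path from \<open>s\<close> to \<open>t\<close>; the critical
  vertices are linearly ordered by the order in which paths visit them. A critical \<open>x\<close> separates
  \<open>s\<close> from the representative of its strong component, or that representative from \<open>t\<close>. Within
  either class, the critical vertices that two pairs have in common form an interval of the class of
  each of them, and both pairs leave a common vertex that is not the last one through the same edges.

  Scan the pairs and make a pair an owner of its class if at least \<open>q = \<lceil>\<surd>n\<rceil>\<close> vertices of the class
  have no owner yet. There are at most \<open>q\<close> owners per class, so a pair can afford to store its
  interval in each of them, while a vertex stores its owner and its rank there. Fewer than \<open>2q\<close>
  critical vertices of a pair remain without an owner; a displacement hash table with \<open>O(q)\<close> words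
  holds them. An edge \<open>(u, v)\<close> is critical iff \<open>u\<close> is critical and \<open>v\<close> is its only exit, that is the
  only successor from which \<open>t\<close> can be reached without returning to \<open>u\<close>.

  Preprocessing fills a sequence of arrays, each given by a term over earlier entries; one compiler
  from terms to machine programs, with generic time and overflow bounds, serves the preprocessing
  and the queries.
\<close>

section \<open>A term language compiled to the word RAM\<close>

text \<open>Two pairs may pass the same two vertices of a strong component in opposite orders; their
  common critical vertices then need not form an interval. This is the reason for the two classes:
  if both vertices cut the source of either pair off from the representative, opposite orders are
  impossible, since a path to the representative, cut at its last visit to the two vertices,
  completes a path from one of the sources that avoids a vertex it cannot avoid. The sink class is
  the same statement in the reversed graph. The exits of a common vertex are decided by reaching any
  later common vertex, a condition that no longer mentions \<open>t\<close>; only the last one lacks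
  such a witness. A query must also find its pair: the sink is written with two digits to base
  \<open>q\<close>, and pointers for each digit, \<open>q\<close> words apiece, are stored with the
  pairs. Worst-case constant time rules out random hashing, so all displacements come from
  exhaustive search, and counting shows that the search succeeds.\<close>

text \<open>
  \<open>Vr i\<close> refers to position \<open>i\<close> of the environment (de Bruijn levels); \<open>Lt\<close>, \<open>Sm\<close> and \<open>Mu\<close> bind
  the next free position: the value of a let, the index of a sum, the index of a bounded search.
\<close>

datatype tm =
    Cn nat
  | Vr nat
  | Ld tm
  | Op binop tm tm
  | Ite tm tm tm
  | Lt tm tm
  | Sm tm tm
  | Mu tm tm

primrec opv :: "binop \<Rightarrow> nat \<Rightarrow> nat \<Rightarrow> nat" where
  "opv Plus a b = a + b"
| "opv Minus a b = a - b"
| "opv Times a b = a * b"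
| "opv Div a b = a div b"
| "opv Mod a b = a mod b"
| "opv Less a b = (if a < b then 1 else 0)"
| "opv Equal a b = (if a = b then 1 else 0)"

text \<open>The least \<open>i < b\<close> with \<open>P i\<close>, or \<open>b\<close> if there is none.\<close>

primrec mu :: "nat \<Rightarrow> (nat \<Rightarrow> bool) \<Rightarrow> nat" where
  "mu 0 P = 0"
| "mu (Suc j) P = (if mu j P = j \<and> \<not> P j then Suc j else mu j P)"

lemma mu_le: "mu b P \<le> b"
  by (induction b) (auto simp: le_SucI)

lemma mu_holds: "mu b P < b \<Longrightarrow> P (mu b P)"
proof (induction b)
  case (Suc b)
  then show ?case using mu_le[of b P] by (cases "mu b P = b") (auto split: if_splits)
qed simp

lemma mu_least: "i < mu b P \<Longrightarrow> \<not> P i"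
proof (induction b)
  case (Suc b)
  then show ?case by (cases "mu b P = b \<and> \<not> P b") (auto simp: less_Suc_eq)
qed simp

lemma mu_less: "i < b \<Longrightarrow> P i \<Longrightarrow> mu b P < b"
  using mu_le[of b P] mu_least[of i b P] by (cases "mu b P = b") auto

lemma mu_less_iff: "mu b P < b \<longleftrightarrow> (\<exists>i<b. P i)"
  using mu_holds mu_less by blast

lemma mu_le_wit: "i < b \<Longrightarrow> P i \<Longrightarrow> mu b P \<le> i"
  using mu_least[of i b P] by (meson not_le_imp_less)

lemma mu_cong: "(\<And>i. i < b \<Longrightarrow> P i = Q i) \<Longrightarrow> mu b P = mu b Q"
  by (induction b) auto

primrec ev :: "(nat \<Rightarrow> nat) \<Rightarrow> nat list \<Rightarrow> tm \<Rightarrow> nat" where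
  "ev M e (Cn c) = c"
| "ev M e (Vr i) = e ! i"
| "ev M e (Ld t) = M (ev M e t)"
| "ev M e (Op f t u) = opv f (ev M e t) (ev M e u)"
| "ev M e (Ite c t u) = (if ev M e c \<noteq> 0 then ev M e t else ev M e u)"
| "ev M e (Lt t u) = ev M (e @ [ev M e t]) u"
| "ev M e (Sm b t) = (\<Sum>i<ev M e b. ev M (e @ [i]) t)"
| "ev M e (Mu b t) = mu (ev M e b) (\<lambda>i. ev M (e @ [i]) t \<noteq> 0)"

primrec wf_tm :: "nat \<Rightarrow> tm \<Rightarrow> bool" where
  "wf_tm L (Cn c) = True"
| "wf_tm L (Vr i) = (i < L)"
| "wf_tm L (Ld t) = wf_tm L t"
| "wf_tm L (Op f t u) = (wf_tm L t \<and> wf_tm L u)"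
| "wf_tm L (Ite c t u) = (wf_tm L c \<and> wf_tm L t \<and> wf_tm L u)"
| "wf_tm L (Lt t u) = (wf_tm L t \<and> wf_tm (Suc L) u)"
| "wf_tm L (Sm b t) = (wf_tm L b \<and> wf_tm (Suc L) t)"
| "wf_tm L (Mu b t) = (wf_tm L b \<and> wf_tm (Suc L) t)"

text \<open>If memory is bounded by \<open>X\<close> and the environment by \<open>X ^ D\<close>, all intermediate values are below \<open>X ^ dg D t\<close>.\<close>

primrec dg :: "nat \<Rightarrow> tm \<Rightarrow> nat" where
  "dg D (Cn c) = Suc c"
| "dg D (Vr i) = D"
| "dg D (Ld t) = Suc (dg D t)"
| "dg D (Op f t u) = dg D t + dg D u"
| "dg D (Ite c t u) = dg D c + dg D t + dg D u"
| "dg D (Lt t u) = dg D t + dg (D + dg D t) u"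
| "dg D (Sm b t) = dg D b + dg (D + dg D b) t"
| "dg D (Mu b t) = dg D b + dg (D + dg D b) t"

text \<open>The result goes to register \<open>s\<close> and registers below \<open>s\<close>
  survive, so everything above is scratch space. The loop for \<open>Mu\<close> never stops early:
  its accumulator grows exactly while it equals the index and the test fails, as in the recursion
  for \<open>mu\<close>, so the number of rounds is known beforehand.\<close>

primrec cp :: "nat \<Rightarrow> nat list \<Rightarrow> tm \<Rightarrow> com" where
  "cp s vs (Cn c) = Assign s (Const c)"
| "cp s vs (Vr i) = Assign s (Reg (vs ! i))"
| "cp s vs (Ld t) = Seq (cp s vs t) (Assign s (Load (Reg s)))"
| "cp s vs (Op f t u) =
     Seq (cp s vs t) (Seq (cp (Suc s) vs u) (Assign s (Bin f (Reg s) (Reg (Suc s)))))"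
| "cp s vs (Ite c t u) = Seq (cp s vs c) (If (Reg s) (cp s vs t) (cp s vs u))"
| "cp s vs (Lt t u) = Seq (cp s vs t) (Seq (cp (Suc s) (vs @ [s]) u) (Assign s (Reg (Suc s))))"
| "cp s vs (Sm b t) =
     Seq (cp (Suc s) vs b) (Seq (Assign s (Const 0)) (Seq (Assign (s + 2) (Const 0))
       (While (Bin Less (Reg (s + 2)) (Reg (Suc s)))
         (Seq (cp (s + 3) (vs @ [s + 2]) t)
           (Seq (Assign s (Bin Plus (Reg s) (Reg (s + 3))))
             (Assign (s + 2) (Bin Plus (Reg (s + 2)) (Const 1))))))))"
| "cp s vs (Mu b t) =
     Seq (cp (Suc s) vs b) (Seq (Assign s (Const 0)) (Seq (Assign (s + 2) (Const 0))
       (While (Bin Less (Reg (s + 2)) (Reg (Suc s)))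
         (Seq (cp (s + 3) (vs @ [s + 2]) t)
           (Seq (Assign s (Bin Plus (Reg s) (Bin Times (Bin Equal (Reg s) (Reg (s + 2)))
                                                      (Bin Equal (Reg (s + 3)) (Const 0)))))
             (Assign (s + 2) (Bin Plus (Reg (s + 2)) (Const 1))))))))"

text \<open>An upper bound: both branches of \<open>Ite\<close> are charged, which spares a case
  distinction on the condition.\<close>

primrec tim :: "(nat \<Rightarrow> nat) \<Rightarrow> nat list \<Rightarrow> tm \<Rightarrow> nat" where
  "tim M e (Cn c) = 2"
| "tim M e (Vr i) = 2"
| "tim M e (Ld t) = tim M e t + 3"
| "tim M e (Op f t u) = tim M e t + tim M e u + 4"
| "tim M e (Ite c t u) = tim M e c + tim M e t + tim M e u + 2"
| "tim M e (Lt t u) = tim M e t + tim M (e @ [ev M e t]) u + 2"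
| "tim M e (Sm b t) = tim M e b + (\<Sum>i<ev M e b. tim M (e @ [i]) t + 20) + 20"
| "tim M e (Mu b t) = tim M e b + (\<Sum>i<ev M e b. tim M (e @ [i]) t + 20) + 20"

text \<open>Serves twice: as a bound on the running time of a loop-free term, and in general as the
  coefficient of a power of the bound on memory.\<close>

primrec cst :: "tm \<Rightarrow> nat" where
  "cst (Cn c) = 2"
| "cst (Vr i) = 2"
| "cst (Ld t) = cst t + 3"
| "cst (Op f t u) = cst t + cst u + 4"
| "cst (Ite c t u) = cst c + cst t + cst u + 2"
| "cst (Lt t u) = cst t + cst u + 2"
| "cst (Sm b t) = cst b + cst t + 40"
| "cst (Mu b t) = cst b + cst t + 40"

primrec loop_free :: "tm \<Rightarrow> bool" where
  "loop_free (Cn c) = True"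
| "loop_free (Vr i) = True"
| "loop_free (Ld t) = loop_free t"
| "loop_free (Op f t u) = (loop_free t \<and> loop_free u)"
| "loop_free (Ite c t u) = (loop_free c \<and> loop_free t \<and> loop_free u)"
| "loop_free (Lt t u) = (loop_free t \<and> loop_free u)"
| "loop_free (Sm b t) = False"
| "loop_free (Mu b t) = False"

lemma tim_loop_free: "loop_free t \<Longrightarrow> tim M e t \<le> cst t"
  by (induction t arbitrary: e) (auto intro!: add_mono)

section \<open>Bounds on values and running times of terms\<close>

lemma dg_pos: "1 \<le> D \<Longrightarrow> 1 \<le> dg D t"
  by (induction t arbitrary: D) (auto simp: trans_le_add1)

lemma less_pow:
  assumes "2 \<le> (X::nat)" shows "c < X ^ Suc c"
proof -
  have "c < 2 ^ c" by (rule less_exp)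
  also have "\<dots> \<le> X ^ c" using assms by (simp add: power_mono)
  also have "\<dots> \<le> X ^ Suc c" using assms by simp
  finally show ?thesis .
qed

text \<open>One product bounds all operators, which is why \<open>dg\<close> just adds degrees. For
  the sum, (x + a + 1)(y + b + 1) exceeds x + y; the truth value 1 is covered because both factors
  are at least 2.\<close>

lemma opv_less:
  assumes "x < (A::nat)" "y < B" "2 \<le> A" "2 \<le> B"
  shows "opv f x y < A * B"
proof -
  obtain a b where ab: "A = Suc (x + a)" "B = Suc (y + b)"
    using assms by (metis less_iff_Suc_add)
  have s: "x + y < A * B" by (simp add: ab algebra_simps)
  have m: "2 * 2 \<le> A * B" using assms(3,4) by (rule mult_le_mono)
  have x: "x < A * B" using s by simp
  show ?thesis
    using s x m assms
    by (cases f) (auto simp: less_imp_diff_less mult_strict_mono' le_less_trans[OF div_le_dividend]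
        le_less_trans[OF mod_less_eq_dividend])
qed

lemma sum_bound_less:
  fixes f :: "nat \<Rightarrow> nat"
  assumes "k < A" "\<And>i. i < k \<Longrightarrow> f i < B" "0 < B"
  shows "(\<Sum>i<k. f i) < A * B"
proof -
  have "(\<Sum>i<k. f i) \<le> k * B" using sum_bounded_above[of "{..<k}" f B] assms(2) by (simp add: less_imp_le)
  also have "\<dots> < A * B" using assms by simp
  finally show ?thesis .
qed

context
  fixes X :: nat and M :: "nat \<Rightarrow> nat"
  assumes X2: "2 \<le> X" and MX: "\<And>x. M x < X"
begin

lemma pow_ge2: "1 \<le> d \<Longrightarrow> 2 \<le> X ^ d"
  using X2 power_increasing[of 1 d X] by simp

lemma pow_mono: "a \<le> b \<Longrightarrow> X ^ a \<le> X ^ b"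
  using X2 by (simp add: power_increasing)

lemma ev_less:
  "wf_tm (length e) t \<Longrightarrow> 1 \<le> D \<Longrightarrow> \<forall>v\<in>set e. v < X ^ D \<Longrightarrow> ev M e t < X ^ dg D t"
proof (induction t arbitrary: e D)
  case (Cn c)
  then show ?case using less_pow[OF X2] by simp
next
  case (Vr i)
  then show ?case by simp
next
  case (Ld t)
  have "M (ev M e t) < X" by (rule MX)
  also have "\<dots> = X ^ 1" by simp
  also have "\<dots> \<le> X ^ dg D (Ld t)" by (rule pow_mono) simp
  finally show ?case by simp
next
  case (Op f t u)
  then show ?case using opv_less pow_ge2 dg_pos by (simp add: power_add)
next
  case (Ite c t u)
  then have "ev M e t < X ^ dg D t" "ev M e u < X ^ dg D u" by simp_all
  then have "ev M e t < X ^ dg D (Ite c t u)" "ev M e u < X ^ dg D (Ite c t u)"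
    using pow_mono[of "dg D t" "dg D (Ite c t u)"] pow_mono[of "dg D u" "dg D (Ite c t u)"]
    by (auto intro: less_le_trans)
  then show ?case by simp
next
  case (Lt t u)
  \<comment> \<open>One exponent that covers both the old environment and the new entry.\<close>
  let ?d = "D + dg D t"
  have t: "ev M e t < X ^ dg D t" using Lt by simp
  have "\<forall>v\<in>set (e @ [ev M e t]). v < X ^ ?d"
    using Lt.prems t pow_mono[of D ?d] pow_mono[of "dg D t" ?d] by (auto intro: less_le_trans)
  then have "ev M (e @ [ev M e t]) u < X ^ dg ?d u" using Lt.IH(2)[of "e @ [ev M e t]" ?d] Lt.prems by simp
  then show ?case using pow_mono[of "dg ?d u" "dg D (Lt t u)"] by (simp add: less_le_trans)
next
  case (Sm b t)
  let ?d = "D + dg D b"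
  have b: "ev M e b < X ^ dg D b" using Sm by simp
  have "\<forall>v\<in>set (e @ [i]). v < X ^ ?d" if "i < ev M e b" for i
    using Sm.prems b that pow_mono[of D ?d] pow_mono[of "dg D b" ?d] by (auto intro: less_le_trans)
  then have "ev M (e @ [i]) t < X ^ dg ?d t" if "i < ev M e b" for i
    using Sm.IH(2)[of "e @ [i]" ?d] Sm.prems that by simp
  then show ?case using sum_bound_less[OF b] X2 by (simp add: power_add)
next
  case (Mu b t)
  have "ev M e b < X ^ dg D b" using Mu by simp
  then show ?case using mu_le[of "ev M e b"] pow_mono[of "dg D b" "dg D (Mu b t)"]
    by (simp) (meson le_less_trans less_le_trans)
qed

lemma le_mult_pow: "x \<le> c * X ^ a \<Longrightarrow> a \<le> b \<Longrightarrow> x \<le> c * X ^ b"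
  using pow_mono[of a b] by (meson le_trans mult_le_mono2)

text \<open>\<open>Sm\<close> and \<open>Mu\<close> have the same degree, cost and running time, so
  one computation settles both: there are fewer than \<open>X ^ dg D b\<close> rounds, each within
  the bound for the body.\<close>

lemma loop_tim:
  assumes wf: "wf_tm (length e) b" "wf_tm (Suc (length e)) t" and D: "1 \<le> D" and e: "\<forall>v\<in>set e. v < X ^ D"
    and IHb: "\<And>e D. wf_tm (length e) b \<Longrightarrow> 1 \<le> D \<Longrightarrow> \<forall>v\<in>set e. v < X ^ D \<Longrightarrow> tim M e b \<le> cst b * X ^ dg D b"
    and IHt: "\<And>e D. wf_tm (length e) t \<Longrightarrow> 1 \<le> D \<Longrightarrow> \<forall>v\<in>set e. v < X ^ D \<Longrightarrow> tim M e t \<le> cst t * X ^ dg D t"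
  shows "(\<Sum>i<ev M e b. tim M (e @ [i]) t + 20) + tim M e b + 20 \<le> (cst b + cst t + 40) * X ^ dg D (Sm b t)"
proof -
  let ?E = "D + dg D b" let ?d = "dg D b + dg ?E t" let ?B = "(cst t + 20) * X ^ dg ?E t"
  have b: "ev M e b < X ^ dg D b" using ev_less wf D e by simp
  have "\<forall>v\<in>set (e @ [i]). v < X ^ ?E" if "i < ev M e b" for i
    using e b that pow_mono[of D ?E] pow_mono[of "dg D b" ?E] by (auto intro: less_le_trans)
  then have 1: "tim M (e @ [i]) t \<le> cst t * X ^ dg ?E t" if "i < ev M e b" for i
    using IHt[of "e @ [i]" ?E] wf D that by simp
  have "1 \<le> X ^ dg ?E t" using X2 by simp
  with 1 have "tim M (e @ [i]) t + 20 \<le> ?B" if "i < ev M e b" for i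
    using 1[OF that] that unfolding add_mult_distrib by linarith
  then have "(\<Sum>i<ev M e b. tim M (e @ [i]) t + 20) \<le> ev M e b * ?B"
    using sum_bounded_above[of "{..<ev M e b}" "\<lambda>i. tim M (e @ [i]) t + 20" ?B] by simp
  also have "\<dots> \<le> X ^ dg D b * ?B" using b by (simp add: mult_le_mono1)
  also have "\<dots> = (cst t + 20) * X ^ ?d" by (simp add: power_add)
  finally have "(\<Sum>i<ev M e b. tim M (e @ [i]) t + 20) \<le> (cst t + 20) * X ^ ?d" .
  moreover have "tim M e b \<le> cst b * X ^ ?d"
    by (rule le_mult_pow[OF IHb[OF wf(1) D e]]) simp
  moreover have "1 \<le> X ^ ?d" using X2 by simp
  ultimately show ?thesis by (simp add: add_mult_distrib del: One_nat_def)
qed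

lemma tim_le:
  "wf_tm (length e) t \<Longrightarrow> 1 \<le> D \<Longrightarrow> \<forall>v\<in>set e. v < X ^ D \<Longrightarrow> tim M e t \<le> cst t * X ^ dg D t"
proof (induction t arbitrary: e D)
  case (Cn c)
  then show ?case using pow_ge2[of "Suc c"] by (simp del: power_Suc)
next
  case (Vr i)
  then show ?case using pow_ge2[of D] by simp
next
  case (Ld t)
  then have "tim M e t \<le> cst t * X ^ Suc (dg D t)" using le_mult_pow[of "tim M e t" "cst t" "dg D t" "Suc (dg D t)"] by simp
  then show ?case using pow_ge2[of "Suc (dg D t)"] by (simp add: add_mult_distrib)
next
  case (Op f t u)
  let ?d = "dg D t + dg D u"
  have "tim M e t \<le> cst t * X ^ ?d" "tim M e u \<le> cst u * X ^ ?d"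
    using Op.prems(1) le_mult_pow[OF Op.IH(1)[OF _ Op.prems(2,3)], of ?d]
      le_mult_pow[OF Op.IH(2)[OF _ Op.prems(2,3)], of ?d] by simp_all
  moreover have "1 \<le> X ^ ?d" using X2 by simp
  ultimately show ?case by (simp add: add_mult_distrib del: One_nat_def) 
next
  case (Ite c t u)
  let ?d = "dg D c + dg D t + dg D u"
  have "tim M e c \<le> cst c * X ^ ?d" "tim M e t \<le> cst t * X ^ ?d" "tim M e u \<le> cst u * X ^ ?d"
    using Ite.prems(1) le_mult_pow[OF Ite.IH(1)[OF _ Ite.prems(2,3)], of ?d]
      le_mult_pow[OF Ite.IH(2)[OF _ Ite.prems(2,3)], of ?d]
      le_mult_pow[OF Ite.IH(3)[OF _ Ite.prems(2,3)], of ?d] by simp_all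
  moreover have "1 \<le> X ^ ?d" using X2 by simp
  ultimately show ?case by (simp add: add_mult_distrib del: One_nat_def)
next
  case (Lt t u)
  let ?E = "D + dg D t" let ?d = "dg D t + dg ?E u"
  have t: "ev M e t < X ^ dg D t" using Lt ev_less by simp
  have "\<forall>v\<in>set (e @ [ev M e t]). v < X ^ ?E"
    using Lt.prems t pow_mono[of D ?E] pow_mono[of "dg D t" ?E] by (auto intro: less_le_trans)
  then have "tim M (e @ [ev M e t]) u \<le> cst u * X ^ dg ?E u"
    using Lt.IH(2)[of "e @ [ev M e t]" ?E] Lt.prems by simp
  then have "tim M e t \<le> cst t * X ^ ?d" "tim M (e @ [ev M e t]) u \<le> cst u * X ^ ?d"
    using Lt.prems(1) le_mult_pow[OF Lt.IH(1)[OF _ Lt.prems(2,3)], of ?d]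
      le_mult_pow[of "tim M (e @ [ev M e t]) u" "cst u" "dg ?E u" ?d] by simp_all
  moreover have "1 \<le> X ^ ?d" using X2 by simp
  ultimately show ?case by (simp add: add_mult_distrib del: One_nat_def)
next
  case (Sm b t)
  have "(\<Sum>i<ev M e b. tim M (e @ [i]) t + 20) + tim M e b + 20 \<le> (cst b + cst t + 40) * X ^ dg D (Sm b t)"
    using Sm by (intro loop_tim) auto
  then show ?case by simp
next
  case (Mu b t)
  have "(\<Sum>i<ev M e b. tim M (e @ [i]) t + 20) + tim M e b + 20 \<le> (cst b + cst t + 40) * X ^ dg D (Sm b t)"
    using Mu by (intro loop_tim) auto
  then show ?case by simp
qed

end

section \<open>Time-bounded triples and the correctness of the compiler\<close>

definition runs :: "nat \<Rightarrow> com \<Rightarrow> state \<Rightarrow> nat \<Rightarrow> (state \<Rightarrow> bool) \<Rightarrow> bool" where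
  "runs w c \<sigma> T Q \<longleftrightarrow> (\<exists>T' \<tau>. exec w c \<sigma> T' \<tau> \<and> T' \<le> T \<and> Q \<tau>)"

lemma runs_mono: "runs w c \<sigma> T Q \<Longrightarrow> T \<le> T' \<Longrightarrow> (\<And>\<tau>. Q \<tau> \<Longrightarrow> Q' \<tau>) \<Longrightarrow> runs w c \<sigma> T' Q'"
  unfolding runs_def by (meson le_trans)

lemma runs_assign:
  "1 + expr_cost e \<le> T \<Longrightarrow> Q (\<sigma>\<lparr>regs := (regs \<sigma>)(r := expr_val w e \<sigma>)\<rparr>) \<Longrightarrow> runs w (Assign r e) \<sigma> T Q"
  unfolding runs_def using exec.Assign by blast

lemma runs_store:
  "1 + expr_cost a + expr_cost e \<le> T \<Longrightarrow> Q (\<sigma>\<lparr>mem := (mem \<sigma>)(expr_val w a \<sigma> := expr_val w e \<sigma>)\<rparr>) \<Longrightarrow>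
    runs w (Store a e) \<sigma> T Q"
  unfolding runs_def using exec.Store by blast

lemma runs_seq:
  "runs w c1 \<sigma> T1 P \<Longrightarrow> (\<And>\<tau>. P \<tau> \<Longrightarrow> runs w c2 \<tau> T2 Q) \<Longrightarrow> T1 + T2 \<le> T \<Longrightarrow> runs w (Seq c1 c2) \<sigma> T Q"
  unfolding runs_def by (meson exec.Seq add_mono le_trans)

lemma runs_if:
  assumes "expr_val w b \<sigma> \<noteq> 0 \<Longrightarrow> runs w c1 \<sigma> T1 Q" "expr_val w b \<sigma> = 0 \<Longrightarrow> runs w c2 \<sigma> T2 Q"
    "1 + expr_cost b + T1 + T2 \<le> T"
  shows "runs w (If b c1 c2) \<sigma> T Q"
proof (cases "expr_val w b \<sigma> = 0")
  case True
  then obtain T' \<tau> where "exec w c2 \<sigma> T' \<tau>" "T' \<le> T2" "Q \<tau>" using assms(2) unfolding runs_def by blast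
  then show ?thesis using exec.IfFalse[OF True, of c2 T' \<tau> c1] assms(3) unfolding runs_def
    by (meson add_le_mono le_add1 le_trans le_refl)
next
  case False
  then obtain T' \<tau> where "exec w c1 \<sigma> T' \<tau>" "T' \<le> T1" "Q \<tau>" using assms(1) unfolding runs_def by blast
  moreover from this have "1 + expr_cost b + T' \<le> T" using assms(3) by simp
  ultimately show ?thesis using exec.IfTrue[OF False, of c1 T' \<tau> c2] unfolding runs_def by blast
qed

text \<open>Compiled loops are counting loops. The condition has to match \<open>j < B\<close>
  exactly, so that induction on the number of remaining rounds gives termination and the time bound
  together.\<close>

lemma runs_while:
  assumes body: "\<And>\<sigma> j. I j \<sigma> \<Longrightarrow> j < B \<Longrightarrow> runs w c \<sigma> (f j) (I (Suc j))"
    and cond: "\<And>\<sigma> j. I j \<sigma> \<Longrightarrow> (expr_val w b \<sigma> \<noteq> 0) = (j < B)"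
  shows "I j \<sigma> \<Longrightarrow> j \<le> B \<Longrightarrow>
    runs w (While b c) \<sigma> ((\<Sum>i\<in>{j..<B}. f i + 1 + expr_cost b) + 1 + expr_cost b) (I B)"
proof (induction "B - j" arbitrary: j \<sigma>)
  case 0
  then have "j = B" by simp
  moreover have "expr_val w b \<sigma> = 0" using cond[OF 0(2)] \<open>j = B\<close> by simp
  ultimately show ?case unfolding runs_def using 0(2)
    by (intro exI[of _ "1 + expr_cost b"] exI[of _ \<sigma>]) (simp add: exec.WhileFalse[simplified])
next
  case (Suc d)
  then have j: "j < B" and d: "d = B - Suc j" by simp_all
  obtain T \<tau> where 1: "exec w c \<sigma> T \<tau>" "T \<le> f j" "I (Suc j) \<tau>"
    using body[OF Suc(3) j] unfolding runs_def by blast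
  obtain T2 \<tau>2 where 2: "exec w (While b c) \<tau> T2 \<tau>2" "I B \<tau>2"
    "T2 \<le> (\<Sum>i\<in>{Suc j..<B}. f i + 1 + expr_cost b) + 1 + expr_cost b"
    using Suc(1)[of "Suc j" \<tau>] 1(3) d j unfolding runs_def by auto
  have "expr_val w b \<sigma> \<noteq> 0" using cond[OF Suc(3)] j by simp
  from exec.WhileTrue[OF this 1(1) 2(1)] show ?case
    unfolding runs_def using 2(2,3) 1(2) j
    by (intro exI[of _ "1 + expr_cost b + T + T2"] exI[of _ \<tau>2])
       (simp add: sum.atLeast_Suc_lessThan)
qed

definition leaves :: "nat \<Rightarrow> nat \<Rightarrow> state \<Rightarrow> state \<Rightarrow> bool" where
  "leaves s v \<sigma> \<tau> \<longleftrightarrow> mem \<tau> = mem \<sigma> \<and> regs \<tau> s = v \<and> (\<forall>r<s. regs \<tau> r = regs \<sigma> r)"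

definition stores_env :: "nat list \<Rightarrow> nat list \<Rightarrow> nat \<Rightarrow> state \<Rightarrow> bool" where
  "stores_env vs e s \<sigma> \<longleftrightarrow> length vs = length e \<and> (\<forall>i<length e. vs ! i < s \<and> regs \<sigma> (vs ! i) = e ! i)"

lemma stores_env_mono:
  "stores_env vs e s \<sigma> \<Longrightarrow> (\<forall>r<s. regs \<tau> r = regs \<sigma> r) \<Longrightarrow> s \<le> s' \<Longrightarrow> stores_env vs e s' \<tau>"
  unfolding stores_env_def by (auto intro: less_le_trans)

lemma stores_env_snoc:
  "stores_env vs e s \<sigma> \<Longrightarrow> regs \<sigma> r = v \<Longrightarrow> r < s \<Longrightarrow> stores_env (vs @ [r]) (e @ [v]) s \<sigma>"
  unfolding stores_env_def by (auto simp: nth_append less_Suc_eq)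

text \<open>The two kinds of loops differ only in the expression \<open>u\<close> that updates the
  accumulator; \<open>acc i\<close> is its value before round \<open>i\<close>.\<close>

lemma loop_runs:
  assumes body: "\<And>\<sigma> i. i < B \<Longrightarrow> mem \<sigma> = M \<Longrightarrow> stores_env (vs @ [s + 2]) (e @ [i]) (s + 3) \<sigma> \<Longrightarrow>
      runs w c \<sigma> (f i) (leaves (s + 3) (g i) \<sigma>)"
    and upd: "\<And>\<sigma> i. i < B \<Longrightarrow> regs \<sigma> s = acc i \<Longrightarrow> regs \<sigma> (s + 2) = i \<Longrightarrow> regs \<sigma> (s + 3) = g i \<Longrightarrow>
      expr_val w u \<sigma> = acc (Suc i)"
    and cost: "expr_cost u \<le> 9" and B: "B < 2 ^ w" and M: "mem \<sigma> = M" and env: "stores_env vs e s \<sigma>"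
    and regB: "regs \<sigma> (Suc s) = B" and acc0: "acc 0 = 0" and T: "(\<Sum>i<B. f i + 20) + 20 \<le> T"
  shows "runs w (Seq (Assign s (Const 0)) (Seq (Assign (s + 2) (Const 0))
       (While (Bin Less (Reg (s + 2)) (Reg (Suc s)))
         (Seq c (Seq (Assign s u) (Assign (s + 2) (Bin Plus (Reg (s + 2)) (Const 1)))))))) \<sigma> T
     (leaves s (acc B) \<sigma>)"
proof -
  define I where "I j \<tau> \<longleftrightarrow> mem \<tau> = M \<and> regs \<tau> (s + 2) = j \<and> regs \<tau> (Suc s) = B \<and>
    regs \<tau> s = acc j \<and> (\<forall>r<s. regs \<tau> r = regs \<sigma> r)" for j and \<tau> :: state
  \<comment> \<open>Numerals are reduced modulo \<open>2 ^ w\<close>, so even the literal 1 needs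
    \<open>w > 0\<close>; a loop with at least one round guarantees it.\<close>
  have one: "(1::nat) mod 2 ^ w = 1" if "i < B" for i
    using B that by (cases w) auto
  have step: "runs w (Seq c (Seq (Assign s u) (Assign (s + 2) (Bin Plus (Reg (s + 2)) (Const 1))))) \<tau> (f j + 15) (I (Suc j))"
    if I: "I j \<tau>" and j: "j < B" for j and \<tau> :: state
  proof (rule runs_seq[where ?T1.0 = "f j" and ?T2.0 = 15])
    show "runs w c \<tau> (f j) (leaves (s + 3) (g j) \<tau>)"
      using I env unfolding I_def
      by (intro body j stores_env_snoc[where s = "s + 3"] stores_env_mono[OF env]) auto
    fix \<tau>'
    assume L: "leaves (s + 3) (g j) \<tau> \<tau>'"
    then have *: "mem \<tau>' = M" "regs \<tau>' s = acc j" "regs \<tau>' (s + 2) = j" "regs \<tau>' (Suc s) = B"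
      "regs \<tau>' (s + 3) = g j" "\<forall>r<s. regs \<tau>' r = regs \<sigma> r"
      using I unfolding I_def leaves_def by auto
    show "runs w (Seq (Assign s u) (Assign (s + 2) (Bin Plus (Reg (s + 2)) (Const 1)))) \<tau>' 15 (I (Suc j))"
      by (rule runs_seq[where ?T1.0 = 10 and ?T2.0 = 5,
            OF runs_assign[where Q = "\<lambda>\<rho>. \<rho> = \<tau>'\<lparr>regs := (regs \<tau>')(s := acc (Suc j))\<rparr>"]])
         (use cost upd[OF j *(2,3,5)] * one[OF j] j B in \<open>auto intro!: runs_assign simp: I_def\<close>)
  qed simp
  have sum: "(\<Sum>i\<in>{0..<B}. f i + 15 + 1 + 3) \<le> (\<Sum>i<B. f i + 20)"
    unfolding atLeast0LessThan by (rule sum_mono) simp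
  have "runs w (While (Bin Less (Reg (s + 2)) (Reg (Suc s)))
         (Seq c (Seq (Assign s u) (Assign (s + 2) (Bin Plus (Reg (s + 2)) (Const 1)))))) \<tau>
      ((\<Sum>i<B. f i + 20) + 10) (I B)" if "I 0 \<tau>" for \<tau> :: state
    by (rule runs_mono[OF runs_while[where I = I and j = 0 and B = B and f = "\<lambda>j. f j + 15"]])
       (use that step sum in \<open>auto simp: I_def\<close>)
  then have "runs w (Seq (Assign s (Const 0)) (Seq (Assign (s + 2) (Const 0))
       (While (Bin Less (Reg (s + 2)) (Reg (Suc s)))
         (Seq c (Seq (Assign s u) (Assign (s + 2) (Bin Plus (Reg (s + 2)) (Const 1)))))))) \<sigma>
     ((\<Sum>i<B. f i + 20) + 20) (I B)"
    by (intro runs_seq[where ?T1.0 = 2 and ?T2.0 = "(\<Sum>i<B. f i + 20) + 13",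
            OF runs_assign[where Q = "\<lambda>\<rho>. \<rho> = \<sigma>\<lparr>regs := (regs \<sigma>)(s := 0)\<rparr>"]]
          runs_seq[where ?T1.0 = 2 and ?T2.0 = "(\<Sum>i<B. f i + 20) + 10" ,
            OF runs_assign[where Q = "I 0"]])
       (use M regB acc0 in \<open>auto simp: I_def\<close>)
  then show ?thesis
    by (rule runs_mono) (use T M in \<open>auto simp: I_def leaves_def\<close>)
qed

lemma pow_le_trans: "2 \<le> (X::nat) \<Longrightarrow> X ^ b \<le> K \<Longrightarrow> a \<le> b \<Longrightarrow> X ^ a \<le> K"
  by (rule le_trans[OF power_increasing]) auto

text \<open>The hypothesis on the word size makes every intermediate value fit into a word, so
  wrapped machine arithmetic agrees with \<open>opv\<close>.\<close>

lemma cp_runs: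
  assumes X2: "2 \<le> X" and MX: "\<And>x. M x < X"
  shows "wf_tm (length e) t \<Longrightarrow> 1 \<le> D \<Longrightarrow> \<forall>v\<in>set e. v < X ^ D \<Longrightarrow> X ^ dg D t \<le> 2 ^ w \<Longrightarrow>
    mem \<sigma> = M \<Longrightarrow> stores_env vs e s \<sigma> \<Longrightarrow>
    runs w (cp s vs t) \<sigma> (tim M e t) (leaves s (ev M e t) \<sigma>)"
proof (induction t arbitrary: s vs e D \<sigma>)
  case (Cn c)
  then have "c < 2 ^ w" using less_pow[OF X2, of c] by simp
  then show ?case by (auto intro!: runs_assign simp: leaves_def)
next
  case (Vr i)
  then show ?case by (auto intro!: runs_assign simp: leaves_def stores_env_def)
next
  case (Ld t)
  have d: "X ^ dg D t \<le> 2 ^ w"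
    by (rule pow_le_trans[OF X2 Ld.prems(4)]) simp
  show ?case
    unfolding cp.simps
    by (rule runs_seq[where ?T2.0 = 3, OF Ld.IH[OF _ Ld.prems(2,3) d Ld.prems(5,6)]])
       (use Ld.prems in \<open>auto intro!: runs_assign simp: leaves_def\<close>)
next
  case (Op f t u)
  have d: "X ^ dg D t \<le> 2 ^ w" "X ^ dg D u \<le> 2 ^ w"
    by (rule pow_le_trans[OF X2 Op.prems(4)], simp)+
  have "ev M e (Op f t u) < X ^ dg D (Op f t u)"
    by (rule ev_less[OF X2 MX]) (use Op.prems in auto)
  then have v: "opv f (ev M e t) (ev M e u) < 2 ^ w" using Op.prems(4) by simp
  have b: "binop_val w f (ev M e t) (ev M e u) = opv f (ev M e t) (ev M e u)"
    using v by (cases f) auto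
  show ?case
    unfolding cp.simps
  proof (rule runs_seq[where ?T2.0 = "tim M e u + 4", OF Op.IH(1)])
    fix \<tau>
    assume L: "leaves s (ev M e t) \<sigma> \<tau>"
    show "runs w (Seq (cp (Suc s) vs u) (Assign s (Bin f (Reg s) (Reg (Suc s))))) \<tau> (tim M e u + 4)
          (leaves s (ev M e (Op f t u)) \<sigma>)"
    proof (rule runs_seq[where ?T2.0 = 4, OF Op.IH(2)])
      show "stores_env vs e (Suc s) \<tau>"
        using L Op.prems(6) by (auto intro!: stores_env_mono[of vs e s \<sigma>] simp: leaves_def)
    qed (use Op.prems d L b in \<open>auto intro!: runs_assign simp: leaves_def\<close>)
  qed (use Op.prems d in auto)
next
  case (Ite c t u)
  have d: "X ^ dg D c \<le> 2 ^ w" "X ^ dg D t \<le> 2 ^ w" "X ^ dg D u \<le> 2 ^ w"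
    by (rule pow_le_trans[OF X2 Ite.prems(4)], simp)+
  show ?case
    unfolding cp.simps
  proof (rule runs_seq[where ?T2.0 = "tim M e t + tim M e u + 2", OF Ite.IH(1)])
    fix \<tau>
    assume L: "leaves s (ev M e c) \<sigma> \<tau>"
    then have m: "mem \<tau> = M" "stores_env vs e s \<tau>"
      using Ite.prems(5,6) by (auto intro!: stores_env_mono[of vs e s \<sigma>] simp: leaves_def)
    have t: "leaves s v \<tau> \<tau>' \<Longrightarrow> leaves s v \<sigma> \<tau>'" for v \<tau>'
      using L by (simp add: leaves_def)
    show "runs w (If (Reg s) (cp s vs t) (cp s vs u)) \<tau> (tim M e t + tim M e u + 2) (leaves s (ev M e (Ite c t u)) \<sigma>)"
    proof (rule runs_if[where ?T1.0 = "tim M e t" and ?T2.0 = "tim M e u"])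
      assume "expr_val w (Reg s) \<tau> \<noteq> 0"
      then show "runs w (cp s vs t) \<tau> (tim M e t) (leaves s (ev M e (Ite c t u)) \<sigma>)"
        using L by (intro runs_mono[OF Ite.IH(2)]) (use Ite.prems m d t in \<open>auto simp: leaves_def\<close>)
    next
      assume "expr_val w (Reg s) \<tau> = 0"
      then show "runs w (cp s vs u) \<tau> (tim M e u) (leaves s (ev M e (Ite c t u)) \<sigma>)"
        using L by (intro runs_mono[OF Ite.IH(3)]) (use Ite.prems m d t in \<open>auto simp: leaves_def\<close>)
    qed simp
  qed (use Ite.prems d in auto)
next
  case (Lt t u)
  let ?E = "D + dg D t" and ?v = "ev M e t"
  have d: "X ^ dg D t \<le> 2 ^ w" "X ^ dg ?E u \<le> 2 ^ w"
    by (rule pow_le_trans[OF X2 Lt.prems(4)], simp)+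
  have v: "?v < X ^ dg D t" by (rule ev_less[OF X2 MX]) (use Lt.prems in auto)
  have e: "\<forall>v\<in>set (e @ [?v]). v < X ^ ?E"
    using Lt.prems(3) v power_increasing[of D ?E X] power_increasing[of "dg D t" ?E X] X2
    by (auto intro: less_le_trans)
  show ?case
    unfolding cp.simps
  proof (rule runs_seq[where ?T2.0 = "tim M (e @ [?v]) u + 2", OF Lt.IH(1)])
    fix \<tau>
    assume L: "leaves s ?v \<sigma> \<tau>"
    show "runs w (Seq (cp (Suc s) (vs @ [s]) u) (Assign s (Reg (Suc s)))) \<tau> (tim M (e @ [?v]) u + 2)
          (leaves s (ev M e (Lt t u)) \<sigma>)"
    proof (rule runs_seq[where ?T2.0 = 2, OF Lt.IH(2)[OF _ _ e]])
      show "stores_env (vs @ [s]) (e @ [?v]) (Suc s) \<tau>"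
        using L Lt.prems(6) by (auto intro!: stores_env_snoc stores_env_mono[of vs e s \<sigma>] simp: leaves_def)
    qed (use Lt.prems d L in \<open>auto intro!: runs_assign simp: leaves_def\<close>)
  qed (use Lt.prems d in auto)
next
  case (Sm b t)
  let ?E = "D + dg D b" and ?B = "ev M e b"
  have d: "X ^ dg D b \<le> 2 ^ w" "X ^ dg ?E t \<le> 2 ^ w"
    by (rule pow_le_trans[OF X2 Sm.prems(4)], simp)+
  have v: "?B < X ^ dg D b" by (rule ev_less[OF X2 MX]) (use Sm.prems in auto)
  have e: "\<forall>v\<in>set (e @ [i]). v < X ^ ?E" if "i < ?B" for i
    using Sm.prems(3) less_trans[OF that v] power_increasing[of D ?E X] power_increasing[of "dg D b" ?E X] X2
    by (auto intro: less_le_trans)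
  have tot: "ev M e (Sm b t) < 2 ^ w"
    using ev_less[where X = X and M = M and e = e and t = "Sm b t" and D = D, OF X2 MX] Sm.prems by simp
  \<comment> \<open>Partial sums are at most the full sum, and that is bounded by
    \<open>ev_less\<close>.\<close>
  have acc: "(\<Sum>k<i. ev M (e @ [k]) t) + ev M (e @ [i]) t < 2 ^ w" if "i < ?B" for i
  proof -
    have "(\<Sum>k<Suc i. ev M (e @ [k]) t) \<le> (\<Sum>k<?B. ev M (e @ [k]) t)"
      using that by (intro sum_mono2) auto
    then show ?thesis using tot by simp
  qed
  show ?case
    unfolding cp.simps
  proof (rule runs_seq[where ?T2.0 = "(\<Sum>i<?B. tim M (e @ [i]) t + 20) + 20", OF Sm.IH(1)])
    show "stores_env vs e (Suc s) \<sigma>" using Sm.prems(6) by (rule stores_env_mono) auto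
    fix \<tau>
    assume L: "leaves (Suc s) ?B \<sigma> \<tau>"
    show "runs w (Seq (Assign s (Const 0)) (Seq (Assign (s + 2) (Const 0))
       (While (Bin Less (Reg (s + 2)) (Reg (Suc s)))
         (Seq (cp (s + 3) (vs @ [s + 2]) t)
           (Seq (Assign s (Bin Plus (Reg s) (Reg (s + 3))))
             (Assign (s + 2) (Bin Plus (Reg (s + 2)) (Const 1)))))))) \<tau>
       ((\<Sum>i<?B. tim M (e @ [i]) t + 20) + 20) (leaves s (ev M e (Sm b t)) \<sigma>)"
      by (rule runs_mono[OF loop_runs[where B = ?B and M = M and vs = vs and e = e and acc = "\<lambda>j. \<Sum>k<j. ev M (e @ [k]) t"
              and g = "\<lambda>i. ev M (e @ [i]) t" and f = "\<lambda>i. tim M (e @ [i]) t", OF Sm.IH(2)[OF _ _ e]]])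
         (use Sm.prems d L v acc in \<open>auto simp: leaves_def intro: stores_env_mono\<close>)
  qed (use Sm.prems d in auto)
next
  case (Mu b t)
  let ?E = "D + dg D b" and ?B = "ev M e b"
  have d: "X ^ dg D b \<le> 2 ^ w" "X ^ dg ?E t \<le> 2 ^ w"
    by (rule pow_le_trans[OF X2 Mu.prems(4)], simp)+
  have v: "?B < X ^ dg D b" by (rule ev_less[OF X2 MX]) (use Mu.prems in auto)
  have e: "\<forall>v\<in>set (e @ [i]). v < X ^ ?E" if "i < ?B" for i
    using Mu.prems(3) less_trans[OF that v] power_increasing[of D ?E X] power_increasing[of "dg D b" ?E X] X2
    by (auto intro: less_le_trans)
  have acc: "mu i P + 1 < 2 ^ w" "1 < (2::nat) ^ w" "mu i P mod 2 ^ w = mu i P" if "i < ?B" for i P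
    using mu_le[of i P] that v d(1) by auto
  show ?case
    unfolding cp.simps
  proof (rule runs_seq[where ?T2.0 = "(\<Sum>i<?B. tim M (e @ [i]) t + 20) + 20", OF Mu.IH(1)])
    show "stores_env vs e (Suc s) \<sigma>" using Mu.prems(6) by (rule stores_env_mono) auto
    fix \<tau>
    assume L: "leaves (Suc s) ?B \<sigma> \<tau>"
    show "runs w (Seq (Assign s (Const 0)) (Seq (Assign (s + 2) (Const 0))
       (While (Bin Less (Reg (s + 2)) (Reg (Suc s)))
         (Seq (cp (s + 3) (vs @ [s + 2]) t)
           (Seq (Assign s (Bin Plus (Reg s) (Bin Times (Bin Equal (Reg s) (Reg (s + 2)))
                                                      (Bin Equal (Reg (s + 3)) (Const 0)))))
             (Assign (s + 2) (Bin Plus (Reg (s + 2)) (Const 1)))))))) \<tau>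
       ((\<Sum>i<?B. tim M (e @ [i]) t + 20) + 20) (leaves s (ev M e (Mu b t)) \<sigma>)"
      by (rule runs_mono[OF loop_runs[where B = ?B and M = M and vs = vs and e = e and acc = "\<lambda>j. mu j (\<lambda>i. ev M (e @ [i]) t \<noteq> 0)"
              and g = "\<lambda>i. ev M (e @ [i]) t" and f = "\<lambda>i. tim M (e @ [i]) t", OF Mu.IH(2)[OF _ _ e]]])
         (use Mu.prems d L v acc in \<open>auto simp: leaves_def intro: stores_env_mono\<close>)
  qed (use Mu.prems d in auto)
qed

section \<open>Memory filled in the order of addresses\<close>

primrec fill :: "(nat \<Rightarrow> nat) \<Rightarrow> nat \<Rightarrow> tm \<Rightarrow> nat \<Rightarrow> nat \<Rightarrow> nat" where
  "fill M0 B t 0 = M0"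
| "fill M0 B t (Suc j) = (fill M0 B t j)(B + j := ev (fill M0 B t j) [j] t)"

lemma fill_stable: "j \<le> k \<Longrightarrow> x < B + j \<Longrightarrow> fill M0 B t k x = fill M0 B t j x"
  by (induction k) (auto simp: le_Suc_eq)

lemma fill_untouched: "x < B \<or> B + j \<le> x \<Longrightarrow> fill M0 B t j x = M0 x"
  by (induction j) auto

text \<open>The intermediate memory is the final one truncated at the current address, because later
  cells are still zero. The recursion for a table can thus be stated about the final memory
  alone.\<close>

lemma fill_rec:
  assumes "j < k" "\<forall>x\<ge>B. M0 x = 0"
  shows "fill M0 B t k (B + j) = ev (\<lambda>x. if x < B + j then fill M0 B t k x else 0) [j] t"
proof -
  have "fill M0 B t k (B + j) = fill M0 B t (Suc j) (B + j)" using assms(1) by (intro fill_stable) auto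
  also have "\<dots> = ev (fill M0 B t j) [j] t" by simp
  also have "fill M0 B t j = (\<lambda>x. if x < B + j then fill M0 B t k x else 0)"
    using assms fill_stable[of j k _ B M0 t] fill_untouched[of _ B j M0 t] by (intro ext) auto
  finally show ?thesis .
qed

primrec powT :: "nat \<Rightarrow> tm \<Rightarrow> tm" where
  "powT 0 t = Cn 1"
| "powT (Suc k) t = Op Times t (powT k t)"

lemma ev_powT [simp]: "ev M e (powT k t) = ev M e t ^ k"
  by (induction k) auto

lemma wf_powT [simp]: "wf_tm L t \<Longrightarrow> wf_tm L (powT k t)"
  by (induction k) auto

text \<open>The sixth power leaves room for all indices and values: the input has at most
  \<open>4 * n ^ 2 + 3\<close> words, and positions in the oracle are of order
  \<open>n ^ 3\<close>.\<close>

definition WT :: tm where "WT = powT 6 (Op Plus (Ld (Cn 0)) (Cn 2))"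

lemma ev_WT [simp]: "ev M e WT = (M 0 + 2) ^ 6"
  by (simp add: WT_def)

lemma wf_WT [simp]: "wf_tm L WT"
  by (simp add: WT_def)

text \<open>The tables are four-dimensional arrays of side \<open>W\<close>; \<open>cellT U\<close> recovers the table number and the four indices from the flat position.\<close>

definition cellT :: "tm \<Rightarrow> tm" where
  "cellT U = Op Mod (Lt WT (Lt (Op Div (Vr 0) (powT 4 (Vr 1)))
     (Lt (Op Mod (Op Div (Vr 0) (powT 3 (Vr 1))) (Vr 1))
     (Lt (Op Mod (Op Div (Vr 0) (powT 2 (Vr 1))) (Vr 1))
     (Lt (Op Mod (Op Div (Vr 0) (Vr 1)) (Vr 1))
     (Lt (Op Mod (Vr 0) (Vr 1)) U)))))) WT"

definition idx :: "nat \<Rightarrow> nat \<Rightarrow> nat \<Rightarrow> nat \<Rightarrow> nat \<Rightarrow> nat \<Rightarrow> nat" where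
  "idx W k a b c d = (((k * W + a) * W + b) * W + c) * W + d"

lemma idx_less_step: "x < x' \<Longrightarrow> y < W \<Longrightarrow> x * W + y < x' * W + (y'::nat)"
proof -
  assume "x < x'" "y < W"
  then have "x * W + y < Suc x * W" by simp
  also have "\<dots> \<le> x' * W" using \<open>x < x'\<close> by (intro mult_le_mono1) simp
  finally show ?thesis by simp
qed

text \<open>Lexicographic order of the cells is the order of addresses and hence of computation;
  this decides which cells a table may read.\<close>

lemma idx_less:
  assumes "a < W" "b < W" "c < W" "d < W"
    and "k < k' \<or> k = k' \<and> (a < a' \<or> a = a' \<and> (b < b' \<or> b = b' \<and> (c < c' \<or> c = c' \<and> d < d')))"
  shows "idx W k a b c d < idx W k' a' b' c' d'"
  using assms(5) unfolding idx_def
  by (elim disjE conjE; simp only:)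
     (rule add_strict_left_mono idx_less_step assms(1-4) | assumption)+

lemma idx_bound:
  assumes "k < K" "a < W" "b < W" "c < W" "d < W"
  shows "idx W k a b c d < K * W ^ 4"
proof -
  have "idx W k a b c d < idx W K 0 0 0 0" using assms by (intro idx_less) auto
  then show ?thesis by (simp add: idx_def power4_eq_xxxx)
qed

lemma ev_cellT:
  assumes "W = (M 0 + 2) ^ 6" "a < W" "b < W" "c < W" "d < W" "p = idx W k a b c d"
  shows "ev M [p] (cellT U) = ev M [p, W, k, a, b, c, d] U mod W"
proof -
  have 1: "p mod W = d" "p div W = ((k * W + a) * W + b) * W + c" using assms(5,6) by (auto simp: idx_def)
  have 2: "p div W mod W = c" "p div W\<^sup>2 = (k * W + a) * W + b"
    using assms(4) by (auto simp: 1(2) power2_eq_square div_mult2_eq)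
  have "p div W ^ 3 = p div W\<^sup>2 div W" "p div W ^ 4 = p div W\<^sup>2 div W div W"
    by (simp_all add: div_mult2_eq[symmetric] power2_eq_square power3_eq_cube power4_eq_xxxx mult.assoc)
  with assms(2,3) 2(2) have 3: "p div W\<^sup>2 mod W = b" "p div W ^ 3 mod W = a" "p div W ^ 4 = k"
    by simp_all
  have W: "ev M e WT = W" for e by (simp add: assms(1))
  show ?thesis using 1(1) 2(1) 3 by (simp add: cellT_def W del: ev_WT)
qed

text \<open>Register 0, initially zero, is the loop counter and also the only environment entry of
  \<open>cellT\<close>; register 1 holds the number of cells and register 2 the address
  \<open>W\<close> of the first cell, past the input. At the end, 0 and 1 are reused for address and
  length of the oracle.\<close>

definition prep_com :: "nat \<Rightarrow> tm \<Rightarrow> tm \<Rightarrow> tm \<Rightarrow> com" where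
  "prep_com K U DS DL = Seq (cp 1 [] (Op Times (Cn K) (powT 4 WT))) (Seq (cp 2 [] WT)
     (Seq (While (Bin Less (Reg 0) (Reg 1)) (Seq (cp 3 [0] (cellT U))
        (Seq (Store (Bin Plus (Reg 2) (Reg 0)) (Reg 3)) (Assign 0 (Bin Plus (Reg 0) (Const 1))))))
     (Seq (cp 0 [] DS) (cp 1 [] DL))))"

lemma log_pow_le:
  assumes "real c * log 2 (real n + 2) \<le> real w"
  shows "(n + 2) ^ c \<le> (2::nat) ^ w"
proof -
  have "real ((n + 2) ^ c) = 2 powr (real c * log 2 (real n + 2))"
    by (simp add: powr_powr[symmetric] mult.commute[of "real c"] powr_realpow add.commute)
  also have "\<dots> \<le> 2 powr real w" using assms by simp
  also have "\<dots> = real (2 ^ w)" by (simp add: powr_realpow)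
  finally show ?thesis by (simp only: of_nat_le_iff)
qed

lemma stores_env_Nil [simp]: "stores_env [] [] s \<sigma>"
  by (simp add: stores_env_def)

lemma prep_runs:
  fixes K :: nat
  assumes W: "W = (n + 2) ^ 6" and M0: "M0 0 = n" "\<And>x. M0 x < W" "\<forall>x\<ge>W. M0 x = 0"
    and wf: "wf_tm 7 U" "wf_tm 0 DS" "wf_tm 0 DL"
    and d: "d = dg 1 (Op Times (Cn K) (powT 4 WT)) + dg 1 WT + dg (K + 4) (cellT U) + dg 1 DS + dg 1 DL + K + 6"
    and w: "W ^ d \<le> 2 ^ w"
    and C: "C = cst (Op Times (Cn K) (powT 4 WT)) + cst WT + cst (cellT U) + cst DS + cst DL + 60"
    and \<sigma>: "regs \<sigma> = (\<lambda>_. 0)" "mem \<sigma> = M0"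
    and Mf: "Mf = fill M0 W (cellT U) (K * W ^ 4)"
  shows "runs w (prep_com K U DS DL) \<sigma> (C * W ^ (d + K + 4))
    (\<lambda>\<tau>. mem \<tau> = Mf \<and> regs \<tau> 0 = ev Mf [] DS \<and> regs \<tau> 1 = ev Mf [] DL)"
    and "\<And>x. Mf x < W" "\<And>x. x < W \<Longrightarrow> Mf x = M0 x"
    and "\<And>k a b c d. k < K \<Longrightarrow> a < W \<Longrightarrow> b < W \<Longrightarrow> c < W \<Longrightarrow> d < W \<Longrightarrow>
      Mf (W + idx W k a b c d) = ev (\<lambda>x. if x < W + idx W k a b c d then Mf x else 0) [idx W k a b c d, W, k, a, b, c, d] U mod W"
proof -
  let ?F = "fill M0 W (cellT U)" and ?L = "K * W ^ 4"
  let ?t1 = "Op Times (Cn K) (powT 4 WT)"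
  have W64: "64 \<le> W" unfolding W using power_mono[of 2 "n + 2" 6] by simp
  then have W2: "2 \<le> W" by simp
  have Wn0: "?F j 0 = n" for j using fill_untouched[of 0 W j M0] M0(1) W2 by simp
  \<comment> \<open>The outer reduction modulo \<open>W\<close> in \<open>cellT\<close> bounds every
    cell without looking into \<open>U\<close>.\<close>
  have cell_less: "ev M [p] (cellT U) < W" if "M 0 = n" for M p
    using W2 that by (simp add: cellT_def W)
  have F_less: "?F j x < W" for j x
    by (induction j) (use M0(2) cell_less Wn0 in auto)
  show "\<And>x. Mf x < W" unfolding Mf by (rule F_less)
  show "\<And>x. x < W \<Longrightarrow> Mf x = M0 x" unfolding Mf by (rule fill_untouched) simp
  show "Mf (W + idx W k a b c d) = ev (\<lambda>x. if x < W + idx W k a b c d then Mf x else 0) [idx W k a b c d, W, k, a, b, c, d] U mod W"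
    if "k < K" "a < W" "b < W" "c < W" "d < W" for k a b c d
    unfolding Mf
    by (subst fill_rec[OF idx_bound[OF that] M0(3)])
       (rule ev_cellT, use that W Wn0 W2 in auto)
  have wp: "W ^ i \<le> 2 ^ w" if "i \<le> d" for i
    using W2 that by (intro le_trans[OF power_increasing w]) auto
  \<comment> \<open>From \<open>K < 2 ^ K\<close> and \<open>2 \<le> W\<close>: positions are below
    \<open>W ^ (K + 4)\<close>, and \<open>K + 4\<close> is the exponent at which \<open>dg\<close>
    is taken for \<open>cellT\<close>.\<close>
  have K: "K * W ^ 4 < W ^ (K + 4)"
    using less_le_trans[OF less_exp power_mono[OF W2], of K] W2 by (simp add: power_add)
  have p_less: "p < W ^ (K + 4)" if "p < ?L" for p using that K by simp
  have W_le: "W ^ (K + 4) + W ^ (K + 4) \<le> W ^ (K + 5)"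
    using W2 mult_le_mono1[OF W2, of "W ^ (K + 4)"] by (simp add: eval_nat_numeral)
  have W1: "W \<le> W ^ (K + 4)" using W2 by (intro self_le_power) auto
  have addr: "W + p < 2 ^ w" if "p < ?L" for p
    using p_less[OF that] W_le W1 wp[of "K + 5"] d by linarith
  have bnd: "cst t * W ^ dg D t \<le> cst t * W ^ d" if "dg D t \<le> d" for t D
    using W2 that by (intro mult_le_mono2 power_increasing) auto
  have wfc: "wf_tm 1 (cellT U)" using wf(1) by (simp add: cellT_def eval_nat_numeral)
  have tcell: "tim (?F j) [p] (cellT U) \<le> cst (cellT U) * W ^ d" if "p < ?L" for p j
    by (rule le_trans[OF tim_le[OF W2, of _ _ _ "K + 4"] bnd]) (use F_less p_less[OF that] wfc d in auto)
  have tclosed: "tim (?F j) [] t \<le> cst t * W ^ d" if "dg 1 t \<le> d" "wf_tm 0 t" for t j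
    by (rule le_trans[OF tim_le[OF W2, of _ _ _ 1] bnd]) (use F_less that in auto)
  have closed: "runs w (cp s [] t) \<tau> (cst t * W ^ d) (leaves s (ev (?F j) [] t) \<tau>)"
    if "dg 1 t \<le> d" "wf_tm 0 t" "mem \<tau> = ?F j" for t s j \<tau>
    by (rule runs_mono[OF cp_runs[OF W2, of "?F j" _ _ 1] tclosed[OF that(1,2), of j]])
       (use F_less that wp in auto)
  have lp: "runs w (While (Bin Less (Reg 0) (Reg 1)) (Seq (cp 3 [0] (cellT U))
        (Seq (Store (Bin Plus (Reg 2) (Reg 0)) (Reg 3)) (Assign 0 (Bin Plus (Reg 0) (Const 1)))))) \<tau>
        ((cst (cellT U) + 20) * W ^ (d + K + 4) + 4) (\<lambda>\<tau>. mem \<tau> = Mf)"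
    if \<tau>: "mem \<tau> = M0" "regs \<tau> 0 = 0" "regs \<tau> 1 = ?L" "regs \<tau> 2 = W" for \<tau>
  proof -
    define I where "I j \<tau> \<longleftrightarrow> mem \<tau> = ?F j \<and> regs \<tau> 0 = j \<and> regs \<tau> 1 = ?L \<and> regs \<tau> 2 = W" for j and \<tau> :: state
    let ?b = "cst (cellT U) * W ^ d + 10"
    have step: "runs w (Seq (cp 3 [0] (cellT U))
        (Seq (Store (Bin Plus (Reg 2) (Reg 0)) (Reg 3)) (Assign 0 (Bin Plus (Reg 0) (Const 1))))) \<rho> ?b (I (Suc j))"
      if I: "I j \<rho>" and j: "j < ?L" for j \<rho>
    proof (rule runs_seq[where ?T2.0 = 10])
      show "runs w (cp 3 [0] (cellT U)) \<rho> (cst (cellT U) * W ^ d) (leaves 3 (ev (?F j) [j] (cellT U)) \<rho>)"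
        by (rule runs_mono[OF cp_runs[OF W2, of "?F j" _ _ "K + 4"] tcell[OF j, of j]])
           (use F_less I wp d p_less[OF j] wfc in \<open>auto simp: I_def stores_env_def\<close>)
      fix \<rho>'
      assume L: "leaves 3 (ev (?F j) [j] (cellT U)) \<rho> \<rho>'"
      have one: "Suc 0 mod 2 ^ w = Suc 0" using addr[OF j] W2 by (cases w) auto
      have *: "mem \<rho>' = ?F j" "regs \<rho>' 0 = j" "regs \<rho>' 1 = ?L" "regs \<rho>' 2 = W" "regs \<rho>' 3 = ev (?F j) [j] (cellT U)"
        using L I unfolding I_def leaves_def by auto
      have sm: "Suc j < 2 ^ w" "W + j < 2 ^ w" using addr[OF j] W2 by auto
      show "runs w (Seq (Store (Bin Plus (Reg 2) (Reg 0)) (Reg 3)) (Assign 0 (Bin Plus (Reg 0) (Const 1)))) \<rho>' 10 (I (Suc j))"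
        by (rule runs_seq[where ?T1.0 = 5 and ?T2.0 = 5, OF runs_store[where Q = "\<lambda>\<tau>. \<tau> = \<rho>'\<lparr>mem := ?F (Suc j)\<rparr>"]])
           (use * one sm in \<open>auto intro!: runs_assign simp: I_def\<close>)
    qed simp
    have "(\<Sum>i\<in>{0..<?L}. ?b + 1 + 3) = ?L * (?b + 4)" by simp
    also have "\<dots> \<le> W ^ (K + 4) * ((cst (cellT U) + 14) * W ^ d)"
      using K W2 by (intro mult_le_mono) (auto simp: add_mult_distrib)
    also have "\<dots> = (cst (cellT U) + 14) * W ^ (d + K + 4)" by (simp add: power_add)
    also have "\<dots> \<le> (cst (cellT U) + 20) * W ^ (d + K + 4)" by simp
    finally have sum: "(\<Sum>i\<in>{0..<?L}. ?b + 1 + 3) \<le> (cst (cellT U) + 20) * W ^ (d + K + 4)" .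
    have "I 0 \<tau>" using \<tau> by (simp add: I_def)
    show ?thesis
      by (rule runs_mono[OF runs_while[where I = I and j = 0 and B = ?L and f = "\<lambda>_. ?b", OF step _ \<open>I 0 \<tau>\<close>]])
         (use sum in \<open>auto simp: I_def Mf\<close>)
  qed
  let ?N = "W ^ d"
  have N: "?N \<le> W ^ (d + K + 4)" using W2 by (intro power_increasing) auto
  have evs: "ev M0 [] ?t1 = ?L" "ev M0 [] WT = W" using M0(1) W by simp_all
  have wf1: "wf_tm 0 ?t1" by simp
  have "runs w (prep_com K U DS DL) \<sigma>
    (cst ?t1 * ?N + (cst WT * ?N + (((cst (cellT U) + 20) * W ^ (d + K + 4) + 4) + (cst DS * ?N + cst DL * ?N))))
    (\<lambda>\<tau>. mem \<tau> = Mf \<and> regs \<tau> 0 = ev Mf [] DS \<and> regs \<tau> 1 = ev Mf [] DL)"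
    unfolding prep_com_def
  proof (rule runs_seq[OF closed[of ?t1 _ 0]])
    fix \<tau>1
    assume 1: "leaves 1 (ev (?F 0) [] ?t1) \<sigma> \<tau>1"
    show "runs w (Seq (cp 2 [] WT)
     (Seq (While (Bin Less (Reg 0) (Reg 1)) (Seq (cp 3 [0] (cellT U))
        (Seq (Store (Bin Plus (Reg 2) (Reg 0)) (Reg 3)) (Assign 0 (Bin Plus (Reg 0) (Const 1))))))
     (Seq (cp 0 [] DS) (cp 1 [] DL)))) \<tau>1
     (cst WT * ?N + (((cst (cellT U) + 20) * W ^ (d + K + 4) + 4) + (cst DS * ?N + cst DL * ?N)))
     (\<lambda>\<tau>. mem \<tau> = Mf \<and> regs \<tau> 0 = ev Mf [] DS \<and> regs \<tau> 1 = ev Mf [] DL)"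
    proof (rule runs_seq[OF closed[of WT _ 0]])
      fix \<tau>2
      assume 2: "leaves 2 (ev (?F 0) [] WT) \<tau>1 \<tau>2"
      show "runs w (Seq (While (Bin Less (Reg 0) (Reg 1)) (Seq (cp 3 [0] (cellT U))
        (Seq (Store (Bin Plus (Reg 2) (Reg 0)) (Reg 3)) (Assign 0 (Bin Plus (Reg 0) (Const 1))))))
       (Seq (cp 0 [] DS) (cp 1 [] DL))) \<tau>2
       (((cst (cellT U) + 20) * W ^ (d + K + 4) + 4) + (cst DS * ?N + cst DL * ?N))
       (\<lambda>\<tau>. mem \<tau> = Mf \<and> regs \<tau> 0 = ev Mf [] DS \<and> regs \<tau> 1 = ev Mf [] DL)"
      proof (rule runs_seq[OF lp])
        fix \<tau>3 :: state
        assume 3: "mem \<tau>3 = Mf"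
        show "runs w (Seq (cp 0 [] DS) (cp 1 [] DL)) \<tau>3 (cst DS * ?N + cst DL * ?N)
           (\<lambda>\<tau>. mem \<tau> = Mf \<and> regs \<tau> 0 = ev Mf [] DS \<and> regs \<tau> 1 = ev Mf [] DL)"
        proof (rule runs_seq[OF closed[of DS _ ?L]])
          fix \<tau>4
          assume 4: "leaves 0 (ev (?F ?L) [] DS) \<tau>3 \<tau>4"
          show "runs w (cp 1 [] DL) \<tau>4 (cst DL * ?N)
            (\<lambda>\<tau>. mem \<tau> = Mf \<and> regs \<tau> 0 = ev Mf [] DS \<and> regs \<tau> 1 = ev Mf [] DL)"
            by (rule runs_mono[OF closed[of DL _ ?L]]) (use 3 4 wf d in \<open>auto simp: Mf leaves_def\<close>)
        qed (use 3 wf d in \<open>auto simp: Mf\<close>)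
      next
        show "mem \<tau>2 = M0" "regs \<tau>2 0 = 0" "regs \<tau>2 1 = ?L" "regs \<tau>2 2 = W"
          using 1 2 \<sigma> evs by (auto simp: leaves_def)
      qed simp
    qed (use 1 \<sigma> d in \<open>auto simp: leaves_def\<close>)
  qed (use \<sigma> wf1 d in auto)
  then show "runs w (prep_com K U DS DL) \<sigma> (C * W ^ (d + K + 4))
    (\<lambda>\<tau>. mem \<tau> = Mf \<and> regs \<tau> 0 = ev Mf [] DS \<and> regs \<tau> 1 = ev Mf [] DL)"
  proof (rule runs_mono)
    let ?B = "W ^ (d + K + 4)"
    have m: "x * ?N \<le> x * ?B" for x using N by simp
    have "1 \<le> ?B" using W2 by simp
    then show "cst ?t1 * ?N + (cst WT * ?N + (((cst (cellT U) + 20) * ?B + 4) + (cst DS * ?N + cst DL * ?N))) \<le> C * ?B"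
      unfolding C using m[of "cst ?t1"] m[of "cst WT"] m[of "cst DS"] m[of "cst DL"]
      unfolding add_mult_distrib by linarith
  qed
qed

theorem tables_constructible:
  assumes wf: "wf_tm 7 U" "wf_tm 0 DS" "wf_tm 0 DL"
  obtains c k C where
    "\<And>inp n w W. inp \<noteq> [] \<Longrightarrow> hd inp = n \<Longrightarrow> W = (n + 2) ^ 6 \<Longrightarrow> length inp \<le> W \<Longrightarrow> \<forall>v\<in>set inp. v < W \<Longrightarrow>
      real c * log 2 (real n + 2) \<le> real w \<Longrightarrow>
      \<exists>T M. constructs w (prep_com K U DS DL) inp T (map M [ev M [] DS ..< ev M [] DS + ev M [] DL]) \<and>
        T \<le> C * (n + 1) ^ k \<and> (\<forall>x. M x < W) \<and> (\<forall>x<W. M x = layout inp x) \<and>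
        (\<forall>k a b c d. k < K \<longrightarrow> a < W \<longrightarrow> b < W \<longrightarrow> c < W \<longrightarrow> d < W \<longrightarrow>
          M (W + idx W k a b c d) = ev (\<lambda>x. if x < W + idx W k a b c d then M x else 0) [idx W k a b c d, W, k, a, b, c, d] U mod W)"
proof -
  define d where "d = dg 1 (Op Times (Cn K) (powT 4 WT)) + dg 1 WT + dg (K + 4) (cellT U) + dg 1 DS + dg 1 DL + K + 6"
  define C where "C = cst (Op Times (Cn K) (powT 4 WT)) + cst WT + cst (cellT U) + cst DS + cst DL + 60"
  define k where "k = 6 * (d + K + 4)"
  show thesis
  \<comment> \<open>\<open>W\<close> is a sixth power, hence \<open>6 * d\<close>; the factor
    \<open>2 ^ k\<close> pays for replacing \<open>n + 2\<close> by
    \<open>2 * (n + 1)\<close>.\<close>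
  proof (rule that[of "6 * d" "C * 2 ^ k" k])
    fix inp n w W
    assume inp: "inp \<noteq> []" "hd inp = n" "W = (n + 2) ^ 6" "length inp \<le> W" "\<forall>v\<in>set inp. v < W"
      and w: "real (6 * d) * log 2 (real n + 2) \<le> real w"
    let ?M0 = "layout inp" and ?\<sigma> = "\<lparr>regs = (\<lambda>_. 0), mem = layout inp\<rparr>"
    let ?Mf = "fill ?M0 W (cellT U) (K * W ^ 4)"
    have W0: "0 < W" using inp(3) by simp
    have wd: "W ^ d \<le> 2 ^ w" using log_pow_le[OF w] inp(3) by (simp add: power_mult)
    have M0: "?M0 0 = n" "\<And>x. ?M0 x < W" "\<forall>x\<ge>W. ?M0 x = 0"
      using inp W0 by (auto simp: layout_def hd_conv_nth)
    note P = prep_runs[OF inp(3) M0 wf d_def wd C_def, of ?\<sigma> ?Mf]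
    obtain T \<tau> where *: "exec w (prep_com K U DS DL) ?\<sigma> T \<tau>" "T \<le> C * W ^ (d + K + 4)" "mem \<tau> = ?Mf"
      "regs \<tau> 0 = ev ?Mf [] DS" "regs \<tau> 1 = ev ?Mf [] DL"
      using P(1) unfolding runs_def by auto
    have "W ^ (d + K + 4) = (n + 2) ^ k" unfolding k_def inp(3) by (rule power_mult[symmetric])
    also have "\<dots> \<le> (2 * (n + 1)) ^ k" by (rule power_mono) auto
    also have "\<dots> = 2 ^ k * (n + 1) ^ k" by (rule power_mult_distrib)
    finally have "C * W ^ (d + K + 4) \<le> C * 2 ^ k * (n + 1) ^ k" by simp
    then have T: "T \<le> C * 2 ^ k * (n + 1) ^ k" using *(2) by linarith
    have "constructs w (prep_com K U DS DL) inp T (map ?Mf [ev ?Mf [] DS ..< ev ?Mf [] DS + ev ?Mf [] DL])"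
      unfolding constructs_def using * by auto
    then show "\<exists>T M. constructs w (prep_com K U DS DL) inp T (map M [ev M [] DS ..< ev M [] DS + ev M [] DL]) \<and>
        T \<le> C * 2 ^ k * (n + 1) ^ k \<and> (\<forall>x. M x < W) \<and> (\<forall>x<W. M x = layout inp x) \<and>
        (\<forall>k a b c d. k < K \<longrightarrow> a < W \<longrightarrow> b < W \<longrightarrow> c < W \<longrightarrow> d < W \<longrightarrow>
          M (W + idx W k a b c d) = ev (\<lambda>x. if x < W + idx W k a b c d then M x else 0) [idx W k a b c d, W, k, a, b, c, d] U mod W)"
      using T P(2-4) by (intro exI[of _ T] exI[of _ ?Mf]) simp
  qed
qed

text \<open>The arguments occupy the registers below \<open>L\<close>, so the code starts at
  register \<open>L\<close> and the answer is copied back.\<close>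

definition query_com :: "nat \<Rightarrow> tm \<Rightarrow> com" where
  "query_com L t = Seq (cp L [0..<L] t) (Assign 0 (Reg L))"

lemma query_reports:
  assumes W: "2 \<le> W" and D: "\<forall>v\<in>set D. v < W" and args: "\<forall>v\<in>set args. v < W"
    and t: "wf_tm (length args) t" "loop_free t" "0 < length args" and w: "W ^ dg 1 t \<le> 2 ^ w"
    and ans: "ev (layout D) args t = (if ans then 1 else 0)"
  shows "\<exists>T\<le>cst t + 2. reports w (query_com (length args) t) D args T ans"
proof -
  let ?\<sigma> = "\<lparr>regs = layout args, mem = layout D\<rparr>"
  have M: "layout D x < W" for x using D W by (auto simp: layout_def)
  have "stores_env [0..<length args] args (length args) ?\<sigma>"
    by (auto simp: stores_env_def layout_def)
  then have "runs w (cp (length args) [0..<length args] t) ?\<sigma> (tim (layout D) args t)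
      (leaves (length args) (ev (layout D) args t) ?\<sigma>)"
    using t args w by (intro cp_runs[OF W M, of _ _ 1]) auto
  then have "runs w (query_com (length args) t) ?\<sigma> (cst t + 2) (\<lambda>\<tau>. regs \<tau> 0 = (if ans then 1 else 0))"
    unfolding query_com_def
    by (rule runs_seq[where ?T2.0 = 2])
       (use tim_loop_free[OF t(2), of "layout D" args] ans in \<open>auto intro!: runs_assign simp: leaves_def\<close>)
  then show ?thesis unfolding runs_def reports_def by blast
qed

section \<open>Critical vertices of a pair\<close>

definition avo :: "('v \<Rightarrow> 'v \<Rightarrow> bool) \<Rightarrow> 'v set \<Rightarrow> 'v \<Rightarrow> 'v \<Rightarrow> bool" where
  "avo E X a b \<longleftrightarrow> a \<notin> X \<and> (\<lambda>u v. E u v \<and> v \<notin> X)\<^sup>*\<^sup>* a b"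

lemma avo_refl: "a \<notin> X \<Longrightarrow> avo E X a a"
  by (simp add: avo_def)

lemma avo_step: "a \<notin> X \<Longrightarrow> E a c \<Longrightarrow> avo E X c b \<Longrightarrow> avo E X a b"
  by (auto simp: avo_def intro: converse_rtranclp_into_rtranclp[of "\<lambda>u v. E u v \<and> v \<notin> X" a c b])

lemma avo_notin: "avo E X a b \<Longrightarrow> a \<notin> X" "avo E X a b \<Longrightarrow> b \<notin> X"
proof -
  have "(\<lambda>u v. E u v \<and> v \<notin> X)\<^sup>*\<^sup>* a b \<Longrightarrow> a \<notin> X \<Longrightarrow> b \<notin> X"
    by (induction rule: rtranclp_induct) auto
  then show "avo E X a b \<Longrightarrow> a \<notin> X" "avo E X a b \<Longrightarrow> b \<notin> X" by (auto simp: avo_def)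
qed

lemma avo_induct [consumes 1, case_names refl step]:
  assumes "avo E X a b" "b \<notin> X \<Longrightarrow> P b"
    "\<And>a c. a \<notin> X \<Longrightarrow> E a c \<Longrightarrow> avo E X c b \<Longrightarrow> P c \<Longrightarrow> P a"
  shows "P a"
proof -
  have "(\<lambda>u v. E u v \<and> v \<notin> X)\<^sup>*\<^sup>* a b" "a \<notin> X" using assms(1) by (auto simp: avo_def)
  then show ?thesis
  proof (induction rule: converse_rtranclp_induct)
    case base
    then show ?case using assms(2) by simp
  next
    case (step a c)
    then show ?case using assms(3)[of a c] by (simp add: avo_def)
  qed
qed

lemma avo_trans: "avo E X a b \<Longrightarrow> avo E X b c \<Longrightarrow> avo E X a c"
  unfolding avo_def by (meson rtranclp_trans)

lemma avo_snoc: "avo E X a b \<Longrightarrow> E b c \<Longrightarrow> c \<notin> X \<Longrightarrow> avo E X a c"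
  by (auto simp: avo_def intro: rtranclp.rtrancl_into_rtrancl[of "\<lambda>u v. E u v \<and> v \<notin> X" a b c])

lemma avo_rev: "avo (conversep E) X b a \<longleftrightarrow> avo E X a b"
proof -
  have "avo F X a b \<Longrightarrow> avo (conversep F) X b a" for F a b
    by (induction rule: avo_induct) (auto intro: avo_refl avo_snoc)
  from this[of E a b] this[of "conversep E" b a] show ?thesis by auto
qed

lemma avo_mono: "avo E X a b \<Longrightarrow> Y \<subseteq> X \<Longrightarrow> avo E Y a b"
  by (induction rule: avo_induct) (auto intro: avo_refl avo_step)

text \<open>A path that avoids \<open>Y\<close> has to visit \<open>x\<close> and is cut there;
  neither half need avoid \<open>x\<close>.\<close>

lemma avo_through: "avo E Y a b \<Longrightarrow> \<not> avo E {x} a b \<Longrightarrow> avo E Y a x \<and> avo E Y x b"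
proof (induction rule: avo_induct)
  case refl
  then show ?case by (metis avo_refl singletonD)
next
  case (step a c)
  then show ?case by (metis avo_refl avo_step singletonD)
qed

text \<open>Follow the path up to the first of \<open>x\<close> and \<open>y\<close> that it
  meets.\<close>

lemma avo_first: "avo E Y a x \<Longrightarrow> x \<noteq> y \<Longrightarrow> avo E (insert y Y) a x \<or> avo E (insert x Y) a y"
proof (induction rule: avo_induct)
  case refl
  then show ?case by (simp add: avo_refl)
next
  case (step a c)
  show ?case
  proof (cases "a = x \<or> a = y")
    case True
    then show ?thesis using step by (auto intro: avo_refl)
  next
    case False
    then show ?thesis using step by (auto intro: avo_step)
  qed
qed

lemma avo_last: "avo E Y x b \<Longrightarrow> x \<noteq> y \<Longrightarrow> avo E (insert y Y) x b \<or> avo E (insert x Y) y b"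
  using avo_first[of "conversep E" Y b x y] by (simp add: avo_rev)

text \<open>A path that avoids a set has both ends outside it, so \<open>s\<close> and
  \<open>t\<close> are critical themselves as soon as \<open>t\<close> is reachable; this covers the
  failure of an end.\<close>

definition crit :: "('v \<Rightarrow> 'v \<Rightarrow> bool) \<Rightarrow> 'v \<Rightarrow> 'v \<Rightarrow> 'v \<Rightarrow> bool" where
  "crit E s t x \<longleftrightarrow> avo E {} s t \<and> \<not> avo E {x} s t"

lemma crit_rev: "crit (conversep E) t s x \<longleftrightarrow> crit E s t x"
  by (simp add: crit_def avo_rev)

lemma crit_reach:
  "crit E s t x \<Longrightarrow> avo E {} s x" "crit E s t x \<Longrightarrow> avo E {} x t"
  using avo_through[of E "{}" s t x] by (auto simp: crit_def)

text \<open>Together with \<open>crit_antisym\<close> this turns \<open>avo E {y} s x\<close> into a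
  total and asymmetric relation on the critical vertices: \<open>x\<close> precedes
  \<open>y\<close>.\<close>

lemma crit_order:
  assumes "crit E s t x" "crit E s t y" "x \<noteq> y"
  shows "avo E {y} s x \<or> avo E {x} s y"
  using avo_first[OF crit_reach(1)[OF assms(1)] assms(3)] by simp

text \<open>A path from \<open>x\<close> to \<open>t\<close> without \<open>y\<close> would continue
  the given one from \<open>s\<close> to \<open>x\<close>, against \<open>y\<close> being critical;
  so by \<open>avo_last\<close> some path leads from \<open>y\<close> to \<open>t\<close> without
  \<open>x\<close>.\<close>

lemma crit_after: "crit E s t y \<Longrightarrow> crit E s t x \<Longrightarrow> avo E {y} s x \<Longrightarrow> avo E {x} y t"
  using avo_last[OF crit_reach(2), of E s t x y] avo_trans[of E "{y}" s x t] avo_notin[of E "{y}" s x]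
  by (auto simp: crit_def)

lemma crit_antisym: "crit E s t x \<Longrightarrow> crit E s t y \<Longrightarrow> avo E {y} s x \<Longrightarrow> \<not> avo E {x} s y"
  using crit_after[of E s t y x] avo_trans[of E "{x}" s y t] by (auto simp: crit_def)

lemma crit_before_iff:
  assumes "crit E s t x" "crit E s t y"
  shows "avo E {y} s x \<longleftrightarrow> avo E {x} y t"
proof
  assume *: "avo E {x} y t"
  then have "x \<noteq> y" using avo_notin(1) by fastforce
  moreover have "\<not> avo E {x} s y" using * avo_trans[of E "{x}" s y t] assms(1) by (auto simp: crit_def)
  ultimately show "avo E {y} s x" using crit_order[OF assms] by blast
qed (rule crit_after[OF assms(2,1)])

text \<open>
  A path from \<open>s\<close> to the representative of the component of \<open>x\<close> and a path from there to \<open>t\<close> make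
  up a path from \<open>s\<close> to \<open>t\<close>, so a critical \<open>x\<close> blocks one of the two: \<open>cut_src\<close> or \<open>cut_snk\<close> holds.
\<close>

definition scc_rep :: "('v \<Rightarrow> 'v \<Rightarrow> bool) \<Rightarrow> ('v \<Rightarrow> 'v) \<Rightarrow> bool" where
  "scc_rep E r \<longleftrightarrow> (\<forall>x. avo E {} x (r x) \<and> avo E {} (r x) x) \<and>
     (\<forall>x y. avo E {} x y \<and> avo E {} y x \<longrightarrow> r x = r y)"

lemma scc_repD:
  assumes "scc_rep E r"
  shows "avo E {} x (r x)" "avo E {} (r x) x" "avo E {} x y \<Longrightarrow> avo E {} y x \<Longrightarrow> r x = r y"
  using assms unfolding scc_rep_def by blast+

lemma scc_rep_rev: "scc_rep (conversep E) r \<longleftrightarrow> scc_rep E r"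
  unfolding scc_rep_def avo_rev by blast

definition cut_src :: "('v \<Rightarrow> 'v \<Rightarrow> bool) \<Rightarrow> ('v \<Rightarrow> 'v) \<Rightarrow> 'v \<Rightarrow> 'v \<Rightarrow> 'v \<Rightarrow> bool" where
  "cut_src E r s t x \<longleftrightarrow> crit E s t x \<and> \<not> avo E {x} s (r x)"

definition cut_snk :: "('v \<Rightarrow> 'v \<Rightarrow> bool) \<Rightarrow> ('v \<Rightarrow> 'v) \<Rightarrow> 'v \<Rightarrow> 'v \<Rightarrow> 'v \<Rightarrow> bool" where
  "cut_snk E r s t x \<longleftrightarrow> crit E s t x \<and> \<not> avo E {x} (r x) t"

lemma cut_snk_rev: "cut_snk E r s t x \<longleftrightarrow> cut_src (conversep E) r t s x"
  by (simp add: cut_snk_def cut_src_def crit_rev avo_rev)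

lemma crit_cut: "crit E s t x \<longleftrightarrow> cut_src E r s t x \<or> cut_snk E r s t x"
  unfolding cut_src_def cut_snk_def crit_def using avo_trans[of E "{x}" s "r x" t] by blast

text \<open>Opposite orders make \<open>x\<close> and \<open>z\<close> mutually reachable, so they
  share the representative. On a path from \<open>x\<close> to it, the part after the last visit to
  the two vertices continues either the path from \<open>s'\<close> to \<open>x\<close> without
  \<open>z\<close> or the path from \<open>s\<close> to \<open>z\<close> without \<open>x\<close>;
  each contradicts that the avoided vertex cuts off the representative.\<close>

lemma cut_src_agree:
  assumes r: "scc_rep E r" and i: "cut_src E r s t x" "cut_src E r s t z"
    and j: "cut_src E r s' t' x" "cut_src E r s' t' z" and o: "avo E {z} s' x"
  shows "avo E {z} s x"
proof (rule ccontr)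
  assume n: "\<not> avo E {z} s x"
  have xz: "x \<noteq> z" using avo_notin(2)[OF o] by auto
  have sz: "avo E {x} s z" using crit_order[of E s t x z] i xz n by (auto simp: cut_src_def)
  have "avo E {} x z"
    using avo_through[OF crit_reach(1), of E s' t' z x] crit_antisym[OF _ _ o] j by (auto simp: cut_src_def)
  moreover have "avo E {} z x"
    using avo_through[OF crit_reach(1), of E s t x z] n i by (auto simp: cut_src_def)
  ultimately have rx: "r x = r z" by (rule scc_repD(3)[OF r])
  have "avo E {} x (r x)" by (rule scc_repD(1)[OF r])
  from avo_last[OF this xz] show False
  proof
    assume "avo E {z} x (r x)"
    then show False using avo_trans[OF o, of "r z"] j(2) rx by (simp add: cut_src_def)
  next
    assume "avo E {x} z (r x)"
    then show False using avo_trans[OF sz, of "r x"] i(1) by (simp add: cut_src_def)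
  qed
qed

lemma cut_src_interval:
  assumes r: "scc_rep E r" and i: "cut_src E r s t x" "cut_src E r s t z"
    and j: "cut_src E r s' t' x" "cut_src E r s' t' y" "cut_src E r s' t' z"
    and o: "avo E {y} s' x" "avo E {z} s' y" "avo E {z} s' x"
  shows "cut_src E r s t y"
proof -
  have c: "crit E s t x" "crit E s t z" "crit E s' t' x" "crit E s' t' y" "crit E s' t' z"
    using i j by (auto simp: cut_src_def)
  have sx: "avo E {z} s x" by (rule cut_src_agree[OF r i j(1,3) o(3)])
  have zt': "avo E {y} z t'" by (rule crit_after[OF c(5,4) o(2)])
  \<comment> \<open>Otherwise the pieces from \<open>s'\<close> to \<open>x\<close>, from
    \<open>x\<close> to \<open>z\<close> and from \<open>z\<close> to \<open>t'\<close> would join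
    to a path without \<open>y\<close>.\<close>
  have sep: "\<not> avo E {y} x z" using avo_trans[OF o(1), of z] avo_trans[OF _ zt', of s'] c(4) by (auto simp: crit_def)
  \<comment> \<open>As \<open>x\<close> precedes \<open>z\<close> for \<open>(s, t)\<close> as well,
    every path from \<open>x\<close> to \<open>t\<close> runs through \<open>z\<close>.\<close>
  have nz: "\<not> avo E {z} x t" using avo_trans[OF sx, of t] c(2) by (auto simp: crit_def)
  have y: "crit E s t y"
  proof (rule ccontr)
    assume "\<not> crit E s t y"
    then have p: "avo E {y} s t" using c(1) by (auto simp: crit_def)
    have "avo E {y} x t" using avo_through[OF p, of x] c(1) by (auto simp: crit_def)
    then have "avo E {y} x z" using avo_through[of E "{y}" x t z] nz by blast
    then show False using sep by simp
  qed
  moreover have "\<not> avo E {y} s (r y)"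
  proof
    assume p: "avo E {y} s (r y)"
    show False
    \<comment> \<open>If every path from \<open>s\<close> to the representative of \<open>y\<close>
      uses \<open>x\<close>, the given one contains a path from \<open>x\<close> to it without
      \<open>y\<close>, and \<open>s'\<close> gets one too. If some path avoids \<open>x\<close>,
      then \<open>x\<close> and \<open>y\<close> turn out to share their component, against
      \<open>x\<close> cutting off its representative.\<close>
    proof (cases "avo E {x} s (r y)")
      case False
      then have "avo E {y} x (r y)" using avo_through[OF p] by blast
      then show False using avo_trans[OF o(1), of "r y"] j(2) by (auto simp: cut_src_def)
    next
      case True
      have "\<not> avo E {x} s y"
      proof
        assume "avo E {x} s y"
        then have "avo E {y} x t" by (rule crit_after[OF c(1) y])
        then show False using avo_through[of E "{y}" x t z] nz sep by blast
      qed
      moreover have "avo E {} (r y) y" by (rule scc_repD(2)[OF r])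
      ultimately have "\<not> avo E {x} (r y) y" "avo E {} (r y) x \<and> avo E {} x y"
        using avo_trans[OF True, of y] avo_through[of E "{}" "r y" y x] by auto
      moreover from this have "avo E {} y x" using avo_trans[OF scc_repD(1)[OF r], of y x] by blast
      ultimately have "r x = r y" by (intro scc_repD(3)[OF r]) auto
      then show False using True i(1) by (simp add: cut_src_def)
    qed
  qed
  ultimately show ?thesis by (simp add: cut_src_def)
qed

definition cut :: "nat \<Rightarrow> ('v \<Rightarrow> 'v \<Rightarrow> bool) \<Rightarrow> ('v \<Rightarrow> 'v) \<Rightarrow> 'v \<Rightarrow> 'v \<Rightarrow> 'v \<Rightarrow> bool" where
  "cut b E r s t x \<longleftrightarrow> (if b = 0 then cut_src E r s t x else cut_snk E r s t x)"

lemma cut_crit: "cut b E r s t x \<Longrightarrow> crit E s t x"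
  by (auto simp: cut_def cut_src_def cut_snk_def split: if_splits)

lemma cut_agree:
  assumes r: "scc_rep E r" and i: "cut b E r s t x" "cut b E r s t z"
    and j: "cut b E r s' t' x" "cut b E r s' t' z" and o: "avo E {z} s' x"
  shows "avo E {z} s x"
proof (cases "b = 0")
  case True
  then show ?thesis using cut_src_agree[OF r, of s t x z s' t'] assms by (simp add: cut_def)
next
  case False
  let ?R = "conversep E"
  \<comment> \<open>In the reversed graph precedence is seen from the sink, so the hypothesis is
    first restated by \<open>crit_before_iff\<close>.\<close>
  have "avo E {x} z t' " using crit_before_iff[of E s' t' x z] cut_crit[OF j(1)] cut_crit[OF j(2)] o by simp
  then have "avo ?R {x} t z"
    using cut_src_agree[of ?R r t s z x t' s'] assms(1-5) False by (simp add: scc_rep_rev cut_def cut_snk_rev avo_rev)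
  then show ?thesis using crit_before_iff[OF cut_crit[OF i(1)] cut_crit[OF i(2)]] by (simp add: avo_rev)
qed

lemma cut_interval:
  assumes r: "scc_rep E r" and i: "cut b E r s t x" "cut b E r s t z"
    and j: "cut b E r s' t' x" "cut b E r s' t' y" "cut b E r s' t' z"
    and o: "avo E {y} s' x" "avo E {z} s' y" "avo E {z} s' x"
  shows "cut b E r s t y"
proof (cases "b = 0")
  case True
  then show ?thesis using cut_src_interval[OF r, of s t x z s' t' y] assms by (simp add: cut_def)
next
  case False
  let ?R = "conversep E"
  have "avo E {x} y t'" "avo E {y} z t'" "avo E {x} z t'"
    using crit_before_iff[of E s' t'] cut_crit[OF j(1)] cut_crit[OF j(2)] cut_crit[OF j(3)] o by simp_all
  then show ?thesis
    using cut_src_interval[of ?R r t s z x t' s' y] assms(1-6) False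
    by (simp add: scc_rep_rev cut_def cut_snk_rev avo_rev)
qed

section \<open>Critical edges\<close>

definition exits :: "('v \<Rightarrow> 'v \<Rightarrow> bool) \<Rightarrow> 'v \<Rightarrow> 'v \<Rightarrow> 'v \<Rightarrow> bool" where
  "exits E t u v \<longleftrightarrow> E u v \<and> avo E {u} v t"

text \<open>A path from an out-neighbour \<open>v\<close> of \<open>u\<close> to \<open>t\<close>
  must pass \<open>y\<close>, or else a path without \<open>y\<close> would run from
  \<open>s\<close> through \<open>u\<close> to \<open>t\<close>. The right-hand side is free of
  \<open>t\<close>, so pairs that share \<open>u\<close> and the later \<open>y\<close> agree on the
  exits of \<open>u\<close>.\<close>

lemma exits_before:
  assumes "crit E s t y" "crit E s t u" "avo E {y} s u"
  shows "exits E t u v \<longleftrightarrow> E u v \<and> avo E {u} v y"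
proof -
  have "avo E {u} y t" by (rule crit_after[OF assms])
  moreover have "\<not> avo E {y} v t" if "E u v" "v \<noteq> y"
  proof
    assume v: "avo E {y} v t"
    then have "avo E {y} u t" using that avo_notin(2)[OF assms(3)] by (auto intro: avo_step)
    then show False using avo_trans[OF assms(3), of t] assms(1) by (auto simp: crit_def)
  qed
  moreover have "avo E {u} y y" using avo_notin(2)[OF assms(3)] by (intro avo_refl) auto
  ultimately show ?thesis
    unfolding exits_def using avo_trans[of E "{u}" v y t] avo_through[of E "{u}" v t y] by blast
qed

lemma exits_exist:
  assumes "avo E {} u t" "u \<noteq> t" shows "\<exists>v. exits E t u v"
proof -
  have "avo E {} a t \<Longrightarrow> avo E {u} a t \<or> (\<exists>v. exits E t u v)" for a
  proof (induction rule: avo_induct)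
    case refl
    then show ?case using assms(2) by (auto intro: avo_refl)
  next
    case (step a c)
    then show ?case by (cases "a = u") (auto simp: exits_def intro: avo_step)
  qed
  from this[OF assms(1)] show ?thesis using avo_notin(1) by fastforce
qed

text \<open>A path through a critical \<open>u\<close> takes an exit after its last visit to
  \<open>u\<close>. A second exit is a detour, because the way to \<open>u\<close> up to the first
  visit uses no edge out of \<open>u\<close>.\<close>

lemma reach_del_edge:
  assumes "E u v" "avo E {} s t"
  shows "avo (\<lambda>a b. E a b \<and> (a, b) \<noteq> (u, v)) {} s t \<longleftrightarrow>
    \<not> (crit E s t u \<and> (\<forall>v'. exits E t u v' \<longleftrightarrow> v' = v))" (is "avo ?E _ _ _ \<longleftrightarrow> _")
proof
  assume *: "avo ?E {} s t"
  show "\<not> (crit E s t u \<and> (\<forall>v'. exits E t u v' \<longleftrightarrow> v' = v))"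
  proof
    assume c: "crit E s t u \<and> (\<forall>v'. exits E t u v' \<longleftrightarrow> v' = v)"
    then have "exits E t u v" by simp
    then have ut: "u \<noteq> t" using avo_notin(2) by (fastforce simp: exits_def)
    \<comment> \<open>Read from the end of the path: either \<open>u\<close> has not occurred, or
      its last occurrence was left through an exit other than \<open>v\<close>.\<close>
    from * have "avo E {u} s t \<or> (\<exists>v'. v' \<noteq> v \<and> exits E t u v')"
    proof (induction rule: avo_induct)
      case refl
      then show ?case using ut by (auto intro: avo_refl)
    next
      case (step a d)
      then show ?case by (cases "a = u") (auto simp: exits_def intro: avo_step)
    qed
    then show False using c by (auto simp: crit_def)
  qed
next
  assume n: "\<not> (crit E s t u \<and> (\<forall>v'. exits E t u v' \<longleftrightarrow> v' = v))"
  have A: "avo E {u} a t \<Longrightarrow> avo ?E {} a t" for a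
    by (induction rule: avo_induct) (auto intro: avo_refl avo_step)
  have B: "avo E {} a u \<Longrightarrow> avo ?E {} a u" for a
  proof (induction rule: avo_induct)
    case (step a c)
    then show ?case by (cases "a = u") (auto intro: avo_refl avo_step)
  qed (auto intro: avo_refl)
  show "avo ?E {} s t"
  proof (cases "crit E s t u")
    case False
    then show ?thesis using A assms(2) by (simp add: crit_def)
  next
    case True
    note r = B[OF crit_reach(1)[OF True]]
    show ?thesis
    proof (cases "u = t")
      case False
      obtain w where "exits E t u w" using exits_exist[OF crit_reach(2)[OF True] False] by blast
      then obtain v' where v': "exits E t u v'" "v' \<noteq> v" using n True by metis
      then have "avo ?E {} u t" using A[of v'] by (intro avo_step[of u _ _ v']) (auto simp: exits_def)
      then show ?thesis using r avo_trans[of ?E "{}" s u t] by blast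
    qed (use r in simp)
  qed
qed

section \<open>Greedy owners\<close>

text \<open>
  The recursion for \<open>isO\<close>, and below those for \<open>c\<close> and \<open>d\<close>, are assumptions: the tables computed by the
  machine supply functions that satisfy them.
\<close>

locale greedy_owners =
  fixes n p q :: nat and S :: "nat \<Rightarrow> nat \<Rightarrow> bool" and isO :: "nat \<Rightarrow> bool"
  assumes q: "0 < q" "n \<le> q * q"
    and isO: "j < p \<Longrightarrow> isO j \<longleftrightarrow> q \<le> card {x. x < n \<and> S j x \<and> \<not> (\<exists>j'<j. isO j' \<and> S j' x)}"
begin

definition own :: "nat \<Rightarrow> nat" where "own x = mu p (\<lambda>j. isO j \<and> S j x)"

text \<open>Each owner brings at least \<open>q\<close> vertices that no earlier owner has; these
  sets are disjoint, and there are only \<open>n \<le> q * q\<close> vertices.\<close>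

lemma card_owners: "card {j. j < p \<and> isO j} \<le> q"
proof -
  let ?O = "{j. j < p \<and> isO j}"
  let ?f = "\<lambda>j. {x. x < n \<and> S j x \<and> \<not> (\<exists>j'<j. isO j' \<and> S j' x)}"
  have "card ?O * q = (\<Sum>j\<in>?O. q)" by simp
  also have "\<dots> \<le> (\<Sum>j\<in>?O. card (?f j))" by (rule sum_mono) (use isO in auto)
  also have "\<dots> = card (\<Union>j\<in>?O. ?f j)"
  proof (rule card_UN_disjoint[symmetric])
    have "?f i \<inter> ?f j = {}" if "isO i" "i < j" for i j using that by auto
    then show "\<forall>i\<in>?O. \<forall>j\<in>?O. i \<noteq> j \<longrightarrow> ?f i \<inter> ?f j = {}"
      by (metis (no_types, lifting) Int_commute linorder_neqE_nat mem_Collect_eq)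
  qed auto
  also have "\<dots> \<le> card {..<n}" by (rule card_mono) auto
  finally have "card ?O * q \<le> n" by simp
  then have "card ?O * q \<le> q * q" using q(2) by (rule le_trans)
  then show ?thesis using q(1) by simp
qed

lemma owner_number_less:
  assumes "j < p" "isO j" shows "card {j'. j' < j \<and> isO j'} < q"
proof -
  have "card {j'. j' < j \<and> isO j'} < card {j. j < p \<and> isO j}"
    using assms by (intro psubset_card_mono) auto
  then show ?thesis using card_owners by simp
qed

lemma owner_number_inj:
  assumes "isO j" "isO j'" "card {i. i < j \<and> isO i} = card {i. i < j' \<and> isO i}"
  shows "j = j'"
proof -
  have "card {i. i < a \<and> isO i} < card {i. i < b \<and> isO i}" if "a < b" "isO a" for a b
    using that by (intro psubset_card_mono) auto
  from this[of j j'] this[of j' j] assms show ?thesis by (metis linorder_neqE_nat nat_neq_iff)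
qed

text \<open>An owner leaves none of its vertices unowned, and a pair that failed the test had fewer
  than \<open>q\<close> vertices without an earlier owner.\<close>

lemma unowned_few: "i < p \<Longrightarrow> card {x. x < n \<and> S i x \<and> own x = p} < q"
proof -
  assume i: "i < p"
  have no: "\<not> (isO j \<and> S j x)" if "own x = p" "j < p" for j x
    using that mu_less[of j p "\<lambda>j. isO j \<and> S j x"] unfolding own_def by auto
  show ?thesis
  proof (cases "isO i")
    case True
    then have "{x. x < n \<and> S i x \<and> own x = p} = {}" using no i by auto
    then show ?thesis using q by (simp only: card.empty)
  next
    case False
    have "card {x. x < n \<and> S i x \<and> own x = p} \<le> card {x. x < n \<and> S i x \<and> \<not> (\<exists>j'<i. isO j' \<and> S j' x)}"
      by (rule card_mono) (use no i in auto)
    then show ?thesis using isO[OF i] False by simp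
  qed
qed

end

section \<open>Hashing by displacement\<close>

lemma add_mod_inj:
  assumes "(e + a) mod m = (e + b) mod m" "a < m" "b < (m::nat)" shows "a = b"
proof -
  have key: "y = x" if "x \<le> y" "y < m" "(e + x) mod m = (e + y) mod m" for x y
    using that mod_eq_dvd_iff_nat[of "e + x" "e + y" m] by (auto dest: dvd_imp_le)
  show ?thesis
    using key[OF _ assms(3,1)] key[OF _ assms(2) assms(1)[symmetric]] linear[of a b] by blast
qed

text \<open>The counting principle behind both searches: each potential collision occurs for exactly
  one shift.\<close>

lemma shift_unique:
  assumes "v < (m::nat)" shows "(\<Sum>\<gamma><m. of_bool ((a + \<gamma>) mod m = v)) = (1::nat)"
proof -
  let ?f = "\<lambda>\<gamma>. (a + \<gamma>) mod m"
  have inj: "inj_on ?f {..<m}" by (auto intro: inj_onI add_mod_inj)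
  have "?f ` {..<m} = {..<m}"
    by (rule endo_inj_surj[OF _ _ inj]) (use assms in auto)
  then have "v \<in> ?f ` {..<m}" using assms by (simp only: lessThan_iff)
  then obtain g where g: "g < m" "v = ?f g" by blast
  have "(\<Sum>\<gamma><m. of_bool (?f \<gamma> = v)) = (\<Sum>\<gamma><m. if \<gamma> = g then 1 else (0::nat))"
  proof (rule sum.cong)
    fix \<gamma> assume "\<gamma> \<in> {..<m}"
    then have "?f \<gamma> = v \<longleftrightarrow> \<gamma> = g" using g add_mod_inj[of a \<gamma> m g] by blast
    then show "of_bool (?f \<gamma> = v) = (if \<gamma> = g then 1 else (0::nat))" by simp
  qed simp
  then show ?thesis using g by simp
qed

lemma averaging:
  fixes f :: "nat \<Rightarrow> nat"
  assumes "0 < m" "(\<Sum>\<gamma><m. f \<gamma>) = t" shows "\<exists>\<gamma><m. f \<gamma> * m \<le> t"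
proof (rule ccontr)
  assume "\<not> ?thesis"
  then have "(\<Sum>\<gamma><m. t) < (\<Sum>\<gamma><m. f \<gamma> * m)" using assms by (intro sum_strict_mono) auto
  moreover have "(\<Sum>\<gamma><m. f \<gamma> * m) = t * m" by (simp only: sum_distrib_right[symmetric] assms(2))
  ultimately show False by simp
qed

text \<open>
  Tarjan and Yao's method. Key \<open>x\<close> of column \<open>x mod q\<close> goes to a row shifted by \<open>c\<close>; each column shift
  is chosen, by averaging, to cause few collisions with the earlier columns. The rows, taken by
  decreasing size, are then shifted by \<open>d\<close> into free slots of a table of size \<open>4 * q\<close>.
\<close>

locale displacement =
  fixes n q :: nat and U :: "nat \<Rightarrow> bool" and c d :: "nat \<Rightarrow> nat" and row size :: "nat \<Rightarrow> nat"
  assumes q: "0 < q" "n \<le> q * q" and few: "(\<Sum>x<n. of_bool (U x)) < 2 * q"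
    and row: "x < n \<Longrightarrow> row x = (x div q + c (x mod q)) mod (2 * q)"
    and c: "g < q \<Longrightarrow> c g = mu (2 * q) (\<lambda>\<gamma>.
      (\<Sum>x<n. \<Sum>y<n. of_bool (U x \<and> U y \<and> x mod q = g \<and> y mod q < g \<and> (x div q + \<gamma>) mod (2 * q) = row y)) * (2 * q)
      \<le> (\<Sum>x<n. \<Sum>y<n. of_bool (U x \<and> U y \<and> x mod q = g \<and> y mod q < g)))"
    and size: "\<rho> < 2 * q \<Longrightarrow> size \<rho> = (\<Sum>x<n. of_bool (U x \<and> row x = \<rho>))"
    and d: "\<rho> < 2 * q \<Longrightarrow> d \<rho> = mu (4 * q) (\<lambda>\<delta>. \<forall>x<n. U x \<and> row x = \<rho> \<longrightarrow> (\<forall>y<n. U y \<and>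
      (size \<rho> < size (row y) \<or> size \<rho> = size (row y) \<and> row y < \<rho>) \<longrightarrow>
      (x mod q + \<delta>) mod (4 * q) \<noteq> (y mod q + d (row y)) mod (4 * q)))"
begin

definition slot :: "nat \<Rightarrow> nat" where "slot x = (x mod q + d (row x)) mod (4 * q)"

lemma row_less: "x < n \<Longrightarrow> row x < 2 * q"
  using q by (simp add: row)

lemma div_less: "x < n \<Longrightarrow> x div q < q"
  using q by (simp add: less_mult_imp_div_less)

text \<open>Within a column all keys are shifted alike, and \<open>x div q\<close> stays below the
  number of rows.\<close>

lemma row_inj:
  assumes "x < n" "y < n" "row x = row y" "x mod q = y mod q" shows "x = y"
proof -
  have "(c (x mod q) + x div q) mod (2 * q) = (c (x mod q) + y div q) mod (2 * q)"
    using row[OF assms(1)] row[OF assms(2)] assms(3,4) by (simp add: add.commute)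
  then have "x div q = y div q"
    by (rule add_mod_inj) (use div_less[OF assms(1)] div_less[OF assms(2)] in auto)
  then show ?thesis using assms(4) by (metis div_mult_mod_eq)
qed

abbreviation cnt :: "nat \<Rightarrow> nat \<Rightarrow> nat" where
  "cnt g \<gamma> \<equiv> (\<Sum>x<n. \<Sum>y<n. of_bool (U x \<and> U y \<and> x mod q = g \<and> y mod q < g \<and> (x div q + \<gamma>) mod (2 * q) = row y))"

abbreviation prs :: "nat \<Rightarrow> nat" where
  "prs g \<equiv> (\<Sum>x<n. \<Sum>y<n. of_bool (U x \<and> U y \<and> x mod q = g \<and> y mod q < g))"

text \<open>Summed over all \<open>2 * q\<close> shifts, each pair counted by \<open>prs g\<close>
  collides once, so some shift has at most the average number of collisions.\<close>

lemma cnt_c: assumes g: "g < q" shows "cnt g (c g) * (2 * q) \<le> prs g"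
proof -
  have "(\<Sum>\<gamma><2 * q. cnt g \<gamma>) = (\<Sum>x<n. \<Sum>\<gamma><2 * q. \<Sum>y<n. of_bool (U x \<and> U y \<and> x mod q = g \<and> y mod q < g \<and> (x div q + \<gamma>) mod (2 * q) = row y))"
    by (rule sum.swap)
  also have "\<dots> = (\<Sum>x<n. \<Sum>y<n. \<Sum>\<gamma><2 * q. of_bool (U x \<and> U y \<and> x mod q = g \<and> y mod q < g \<and> (x div q + \<gamma>) mod (2 * q) = row y))"
    by (rule sum.cong[OF refl], rule sum.swap)
  also have "\<dots> = (\<Sum>x<n. \<Sum>y<n. of_bool (U x \<and> U y \<and> x mod q = g \<and> y mod q < g) *
      (\<Sum>\<gamma><2 * q. of_bool ((x div q + \<gamma>) mod (2 * q) = row y)))"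
    unfolding sum_distrib_left by (intro sum.cong refl) auto
  also have "\<dots> = prs g"
    by (intro sum.cong refl, subst shift_unique) (use row_less in auto)
  finally have "\<exists>\<gamma><2 * q. cnt g \<gamma> * (2 * q) \<le> prs g" using q by (intro averaging) auto
  then have "mu (2 * q) (\<lambda>\<gamma>. cnt g \<gamma> * (2 * q) \<le> prs g) < 2 * q" by (simp only: mu_less_iff)
  then show ?thesis by (simp only: c[OF g]) (rule mu_holds)
qed

text \<open>With \<open>u\<close> keys there are at most \<open>u ^ 2 / 2\<close> unordered pairs
  from distinct columns, and by \<open>cnt_c\<close> at most a fraction \<open>1 / (2 * q)\<close>
  of them collides. Twice that, for ordered pairs, is below \<open>2 * q\<close> because
  \<open>u < 2 * q\<close>.\<close>

lemma collisions:
  "(\<Sum>x<n. \<Sum>y<n. of_bool (U x \<and> U y \<and> x \<noteq> y \<and> row x = row y)) < 2 * q" (is "?C < _")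
proof -
  let ?A = "\<Sum>x<n. \<Sum>y<n. of_bool (U x \<and> U y \<and> y mod q < x mod q \<and> row x = row y) :: nat"
  let ?P = "\<Sum>x<n. \<Sum>y<n. of_bool (U x \<and> U y \<and> y mod q < x mod q) :: nat"
  let ?u = "\<Sum>x<n. of_bool (U x) :: nat"
  have split: "(\<Sum>g<q. of_bool (x mod q = g \<and> R g)) = (of_bool (R (x mod q)) :: nat)" for x R
  proof -
    have "(\<Sum>g<q. of_bool (x mod q = g \<and> R g)) = (\<Sum>g<q. if g = x mod q then of_bool (R (x mod q)) else (0::nat))"
      by (rule sum.cong) auto
    then show ?thesis using q by simp
  qed
  have swp: "(\<Sum>g<q. \<Sum>x<n. \<Sum>y<n. of_bool (R x y g)) = (\<Sum>x<n. \<Sum>y<n. \<Sum>g<q. of_bool (R x y g) :: nat)"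
    for R :: "nat \<Rightarrow> nat \<Rightarrow> nat \<Rightarrow> bool"
    by (subst sum.swap, rule sum.cong[OF refl], rule sum.swap)
  have "?A = (\<Sum>g<q. cnt g (c g))"
    unfolding swp
  proof (intro sum.cong refl)
    fix x y assume x: "x \<in> {..<n}"
    have "of_bool (U x \<and> U y \<and> y mod q < x mod q \<and> row x = row y) = (\<Sum>g<q. of_bool (x mod q = g \<and>
        (U x \<and> U y \<and> y mod q < g \<and> (x div q + c g) mod (2 * q) = row y)) :: nat)"
      by (subst split) (use row[of x] x in simp)
    also have "\<dots> = (\<Sum>g<q. of_bool (U x \<and> U y \<and> x mod q = g \<and> y mod q < g \<and> (x div q + c g) mod (2 * q) = row y))"
      by (intro sum.cong refl arg_cong[where f = of_bool]) blast
    finally show "of_bool (U x \<and> U y \<and> y mod q < x mod q \<and> row x = row y) =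
      (\<Sum>g<q. of_bool (U x \<and> U y \<and> x mod q = g \<and> y mod q < g \<and> (x div q + c g) mod (2 * q) = row y) :: nat)" .
  qed
  then have "?A * (2 * q) = (\<Sum>g<q. cnt g (c g) * (2 * q))" by (simp only: sum_distrib_right)
  also have "\<dots> \<le> (\<Sum>g<q. prs g)" by (rule sum_mono) (use cnt_c in auto)
  also have "\<dots> = ?P"
    unfolding swp
  proof (intro sum.cong refl)
    fix x y
    have "(\<Sum>g<q. of_bool (U x \<and> U y \<and> x mod q = g \<and> y mod q < g) :: nat) =
        (\<Sum>g<q. of_bool (x mod q = g \<and> (U x \<and> U y \<and> y mod q < g)))"
      by (intro sum.cong refl arg_cong[where f = of_bool]) blast
    also have "\<dots> = of_bool (U x \<and> U y \<and> y mod q < x mod q)" by (rule split)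
    finally show "(\<Sum>g<q. of_bool (U x \<and> U y \<and> x mod q = g \<and> y mod q < g) :: nat) = of_bool (U x \<and> U y \<and> y mod q < x mod q)" .
  qed
  finally have 1: "?A * (2 * q) \<le> ?P" .
  have sym: "(\<Sum>x<n. \<Sum>y<n. of_bool (R x y)) = (\<Sum>x<n. \<Sum>y<n. of_bool (R y x) :: nat)" for R :: "nat \<Rightarrow> nat \<Rightarrow> bool"
    by (rule sum.swap)
  have "?P + ?P = ?P + (\<Sum>x<n. \<Sum>y<n. of_bool (U y \<and> U x \<and> x mod q < y mod q))"
    by (subst (2) sym) (rule refl)
  also have "\<dots> \<le> (\<Sum>x<n. \<Sum>y<n. of_bool (U x) * of_bool (U y))"
    unfolding sum.distrib[symmetric] by (intro sum_mono) auto
  also have "\<dots> = ?u * ?u" by (rule sum_product[symmetric])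
  finally have 2: "2 * ?P \<le> ?u * ?u" by simp
  \<comment> \<open>Keys of one column never collide by \<open>row_inj\<close>, so each ordered
    colliding pair is counted by exactly one of the two sums, according to which key has the larger
    column.\<close>
  have "?C = ?A + (\<Sum>x<n. \<Sum>y<n. of_bool (U y \<and> U x \<and> x mod q < y mod q \<and> row y = row x))"
    unfolding sum.distrib[symmetric]
  proof (intro sum.cong refl)
    fix x y assume "x \<in> {..<n}" "y \<in> {..<n}"
    then show "of_bool (U x \<and> U y \<and> x \<noteq> y \<and> row x = row y) =
      (of_bool (U x \<and> U y \<and> y mod q < x mod q \<and> row x = row y) +
      of_bool (U y \<and> U x \<and> x mod q < y mod q \<and> row y = row x) :: nat)"
      using row_inj[of x y] by (cases "x mod q" "y mod q" rule: linorder_cases) auto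
  qed
  also have "(\<Sum>x<n. \<Sum>y<n. of_bool (U y \<and> U x \<and> x mod q < y mod q \<and> row y = row x)) = ?A"
    by (rule sym)
  finally have "?C = 2 * ?A" by (simp only: mult_2)
  then have "?C * (2 * q) = 2 * (?A * (2 * q))" by (simp only: mult.assoc)
  then have "?C * (2 * q) \<le> ?u * ?u" using 1 2 by linarith
  also have "\<dots> < (2 * q) * (2 * q)" using few by (intro mult_strict_mono') auto
  finally show ?thesis by simp
qed

text \<open>A key in a row of size at least \<open>k\<close> collides with at least
  \<open>k - 1\<close> others, and \<open>k \<le> 2 * (k - 1)\<close> loses a factor of 2 against
  \<open>collisions\<close>. For \<open>k = 1\<close> this says nothing, and the number of keys
  takes over.\<close>

lemma big_rows:
  assumes "1 \<le> k" shows "k * (\<Sum>x<n. of_bool (U x \<and> k \<le> size (row x))) < 4 * q" (is "_ * ?A < _")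
proof (cases "k = 1")
  case True
  have "?A \<le> (\<Sum>x<n. of_bool (U x))" by (rule sum_mono) auto
  then show ?thesis using few True by simp
next
  case False
  have "(k - 1) * ?A \<le> (\<Sum>x<n. \<Sum>y<n. of_bool (U x \<and> U y \<and> x \<noteq> y \<and> row x = row y))"
    unfolding sum_distrib_left
  proof (rule sum_mono)
    fix x assume x: "x \<in> {..<n}"
    have r: "row x < 2 * q" using x row_less by simp
    have "size (row x) = (\<Sum>y<n. of_bool (U y \<and> x \<noteq> y \<and> row x = row y) + (if y = x then of_bool (U x) else 0))"
      unfolding size[OF r] by (rule sum.cong) auto
    also have "\<dots> = (\<Sum>y<n. of_bool (U y \<and> x \<noteq> y \<and> row x = row y)) + of_bool (U x)"
      using x by (simp add: sum.distrib)
    finally show "(k - 1) * of_bool (U x \<and> k \<le> size (row x)) \<le> (\<Sum>y<n. of_bool (U x \<and> U y \<and> x \<noteq> y \<and> row x = row y))"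
      by (cases "U x") auto
  qed
  then have "(k - 1) * ?A < 2 * q" using collisions by simp
  moreover have "k * ?A \<le> 2 * ((k - 1) * ?A)" 
  proof -
    have "k \<le> 2 * (k - 1)" using False assms by linarith
    from mult_le_mono1[OF this, of ?A] show ?thesis by (simp only: mult.assoc)
  qed
  ultimately show ?thesis by linarith
qed

abbreviation prec :: "nat \<Rightarrow> nat \<Rightarrow> bool" where
  "prec \<rho>' \<rho> \<equiv> size \<rho> < size \<rho>' \<or> size \<rho> = size \<rho>' \<and> \<rho>' < \<rho>"

text \<open>A key of the row and a key of an earlier row rule out exactly one of the
  \<open>4 * q\<close> shifts. Earlier rows have at least the size of this one, so
  \<open>big_rows\<close>, with this size as \<open>k\<close>, leaves a shift free.\<close>

lemma d_works:
  assumes "x < n" "U x" "y < n" "U y" "prec (row y) (row x)"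
  shows "slot x \<noteq> slot y"
proof -
  let ?\<rho> = "row x"
  let ?Q = "\<lambda>\<delta>. \<forall>x'<n. U x' \<and> row x' = ?\<rho> \<longrightarrow> (\<forall>y<n. U y \<and> prec (row y) ?\<rho> \<longrightarrow>
      (x' mod q + \<delta>) mod (4 * q) \<noteq> (y mod q + d (row y)) mod (4 * q))"
  let ?B = "\<lambda>x' y. U x' \<and> row x' = ?\<rho> \<and> U y \<and> prec (row y) ?\<rho>"
  let ?v = "\<lambda>y. (y mod q + d (row y)) mod (4 * q)"
  have "\<exists>\<delta><4 * q. ?Q \<delta>"
  proof (rule ccontr)
    assume n: "\<not> ?thesis"
    have "4 * q = (\<Sum>\<delta><4 * q. 1)" by simp
    also have "\<dots> \<le> (\<Sum>\<delta><4 * q. \<Sum>x'<n. \<Sum>y<n. of_bool (?B x' y \<and> (x' mod q + \<delta>) mod (4 * q) = ?v y))"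
    proof (rule sum_mono)
      fix \<delta> assume "\<delta> \<in> {..<4 * q}"
      then obtain x' y' where *: "x' < n" "y' < n" "?B x' y'" "(x' mod q + \<delta>) mod (4 * q) = ?v y'"
        using n by blast
      have "(1::nat) \<le> of_bool (?B x' y' \<and> (x' mod q + \<delta>) mod (4 * q) = ?v y')" using * by simp
      also have "\<dots> \<le> (\<Sum>y<n. of_bool (?B x' y \<and> (x' mod q + \<delta>) mod (4 * q) = ?v y))"
        using *(2) by (intro member_le_sum) auto
      also have "\<dots> \<le> (\<Sum>x'<n. \<Sum>y<n. of_bool (?B x' y \<and> (x' mod q + \<delta>) mod (4 * q) = ?v y))"
        using *(1) by (intro member_le_sum) auto
      finally show "(1::nat) \<le> (\<Sum>x'<n. \<Sum>y<n. of_bool (?B x' y \<and> (x' mod q + \<delta>) mod (4 * q) = ?v y))" .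
    qed
    also have "\<dots> = (\<Sum>x'<n. \<Sum>y<n. \<Sum>\<delta><4 * q. of_bool (?B x' y \<and> (x' mod q + \<delta>) mod (4 * q) = ?v y))"
      by (subst sum.swap, rule sum.cong[OF refl], rule sum.swap)
    also have "\<dots> = (\<Sum>x'<n. \<Sum>y<n. of_bool (?B x' y) * (\<Sum>\<delta><4 * q. of_bool ((x' mod q + \<delta>) mod (4 * q) = ?v y)))"
      unfolding sum_distrib_left by (intro sum.cong refl) auto
    also have "\<dots> = (\<Sum>x'<n. \<Sum>y<n. of_bool (U x' \<and> row x' = ?\<rho>) * of_bool (U y \<and> prec (row y) ?\<rho>))"
      by (intro sum.cong refl, subst shift_unique) (use q in auto)
    also have "\<dots> = size ?\<rho> * (\<Sum>y<n. of_bool (U y \<and> prec (row y) ?\<rho>))"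
      by (simp only: size[OF row_less[OF assms(1)]] sum_product)
    also have "\<dots> \<le> size ?\<rho> * (\<Sum>y<n. of_bool (U y \<and> size ?\<rho> \<le> size (row y)))"
      by (intro mult_le_mono2 sum_mono) auto
    also have "\<dots> < 4 * q"
    proof (rule big_rows)
      have "(1::nat) \<le> of_bool (U x \<and> row x = ?\<rho>)" using assms by simp
      also have "\<dots> \<le> size ?\<rho>" unfolding size[OF row_less[OF assms(1)]] using assms(1) by (intro member_le_sum) auto
      finally show "1 \<le> size ?\<rho>" .
    qed
    finally show False by simp
  qed
  then have "mu (4 * q) ?Q < 4 * q" by (simp only: mu_less_iff)
  then have "?Q (mu (4 * q) ?Q)" by (rule mu_holds)
  then show ?thesis
    unfolding slot_def using assms d[OF row_less[OF assms(1)]] by auto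
qed

lemma slot_inj:
  assumes "x < n" "U x" "y < n" "U y" "slot x = slot y" shows "x = y"
proof -
  have "row x = row y"
    using d_works[of x y] d_works[of y x] assms by (metis linorder_neqE_nat)
  moreover have "x mod q = y mod q"
  proof -
    have e: "(d (row x) + x mod q) mod (4 * q) = (d (row x) + y mod q) mod (4 * q)"
      using assms(5) \<open>row x = row y\<close> by (simp add: slot_def add.commute)
    have "x mod q < q" "y mod q < q" using q by simp_all
    then show ?thesis by (intro add_mod_inj[OF e]) linarith+
  qed
  ultimately show ?thesis using row_inj assms by blast
qed

lemma slot_less: "slot x < 4 * q"
  using q by (simp add: slot_def)

end

section \<open>The tables of the preprocessing\<close>

definition tr :: "(nat \<Rightarrow> nat) \<Rightarrow> nat list \<Rightarrow> tm \<Rightarrow> bool" where "tr M e t \<longleftrightarrow> ev M e t \<noteq> 0"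

definition andT :: "tm \<Rightarrow> tm \<Rightarrow> tm" where "andT s t = Ite s t (Cn 0)"
definition orT :: "tm \<Rightarrow> tm \<Rightarrow> tm" where "orT s t = Ite s (Cn 1) t"
definition notT :: "tm \<Rightarrow> tm" where "notT t = Op Equal t (Cn 0)"
definition boolT :: "tm \<Rightarrow> tm" where "boolT t = Ite t (Cn 1) (Cn 0)"
definition allT :: "tm \<Rightarrow> tm \<Rightarrow> tm" where "allT b t = notT (Sm b (notT t))"
definition iffT :: "tm \<Rightarrow> tm \<Rightarrow> tm" where "iffT s t = Op Equal (boolT s) (boolT t)"

abbreviation eqT :: "tm \<Rightarrow> tm \<Rightarrow> tm" where "eqT \<equiv> Op Equal"
abbreviation lsT :: "tm \<Rightarrow> tm \<Rightarrow> tm" where "lsT \<equiv> Op Less"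
abbreviation plT :: "tm \<Rightarrow> tm \<Rightarrow> tm" where "plT \<equiv> Op Plus"
abbreviation miT :: "tm \<Rightarrow> tm \<Rightarrow> tm" where "miT \<equiv> Op Minus"
abbreviation tiT :: "tm \<Rightarrow> tm \<Rightarrow> tm" where "tiT \<equiv> Op Times"
abbreviation dvT :: "tm \<Rightarrow> tm \<Rightarrow> tm" where "dvT \<equiv> Op Div"
abbreviation mdT :: "tm \<Rightarrow> tm \<Rightarrow> tm" where "mdT \<equiv> Op Mod"

text \<open>A sum is nonzero iff one of its summands is, so \<open>Sm\<close> doubles as the bounded
  existential quantifier.\<close>

lemma tr_simps [simp]:
  "tr M e (Cn k) = (k \<noteq> 0)"
  "tr M e (Vr i) = (e ! i \<noteq> 0)"
  "tr M e (Ld t) = (M (ev M e t) \<noteq> 0)"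
  "tr M e (eqT s t) = (ev M e s = ev M e t)"
  "tr M e (lsT s t) = (ev M e s < ev M e t)"
  "tr M e (Ite c s t) = (if tr M e c then tr M e s else tr M e t)"
  "tr M e (andT s t) = (tr M e s \<and> tr M e t)"
  "tr M e (orT s t) = (tr M e s \<or> tr M e t)"
  "tr M e (notT t) = (\<not> tr M e t)"
  "tr M e (boolT t) = tr M e t"
  "tr M e (Lt s t) = tr M (e @ [ev M e s]) t"
  "tr M e (Sm b t) = (\<exists>i<ev M e b. tr M (e @ [i]) t)"
  "tr M e (allT b t) = (\<forall>i<ev M e b. tr M (e @ [i]) t)"
  "tr M e (iffT s t) = (tr M e s \<longleftrightarrow> tr M e t)"
  by (auto simp: tr_def andT_def orT_def notT_def boolT_def allT_def iffT_def)

lemma ev_Ite_Mu [simp]: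
  "ev M e (Ite c s t) = (if tr M e c then ev M e s else ev M e t)"
  "ev M e (Mu b t) = mu (ev M e b) (\<lambda>i. tr M (e @ [i]) t)"
  "ev M e (boolT t) = of_bool (tr M e t)"
  by (auto simp: tr_def boolT_def)

declare ev.simps(5,8) [simp del]

lemma wf_simps [simp]:
  "wf_tm L (andT s t) = (wf_tm L s \<and> wf_tm L t)"
  "wf_tm L (orT s t) = (wf_tm L s \<and> wf_tm L t)"
  "wf_tm L (notT t) = wf_tm L t"
  "wf_tm L (boolT t) = wf_tm L t"
  "wf_tm L (allT b t) = (wf_tm L b \<and> wf_tm (Suc L) t)"
  "wf_tm L (iffT s t) = (wf_tm L s \<and> wf_tm L t)"
  by (auto simp: andT_def orT_def notT_def boolT_def allT_def iffT_def)

text \<open>In the terms below, \<open>aI\<close>, \<open>bI\<close>, \<open>cI\<close>, \<open>dI\<close> are the four indices of the cell that is computed, and \<open>Vr 7\<close>, \<open>Vr 8\<close>, \dots are bound.\<close>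

abbreviation aI :: tm where "aI \<equiv> Vr 3"
abbreviation bI :: tm where "bI \<equiv> Vr 4"
abbreviation cI :: tm where "cI \<equiv> Vr 5"
abbreviation dI :: tm where "dI \<equiv> Vr 6"
abbreviation nT :: tm where "nT \<equiv> Ld (Cn 0)"
abbreviation mT :: tm where "mT \<equiv> Ld (Cn 1)"
abbreviation lT :: tm where "lT \<equiv> Ld (Cn 2)"
abbreviation srcT :: "tm \<Rightarrow> tm" where "srcT i \<equiv> Ld (plT (Cn 3) (plT (tiT (Cn 2) mT) (tiT (Cn 2) i)))"
abbreviation snkT :: "tm \<Rightarrow> tm" where "snkT i \<equiv> Ld (plT (Cn 4) (plT (tiT (Cn 2) mT) (tiT (Cn 2) i)))"

definition tab :: "nat \<Rightarrow> tm \<Rightarrow> tm \<Rightarrow> tm \<Rightarrow> tm \<Rightarrow> tm" where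
  "tab k a b c d = Ld (plT (Vr 1) (plT (tiT (plT (tiT (plT (tiT (plT (tiT (Cn k) (Vr 1)) a) (Vr 1)) b) (Vr 1)) c) (Vr 1)) d))"

lemma ev_tab [simp]:
  "ev M e (tab k a b c d) = M (e ! 1 + idx (e ! 1) k (ev M e a) (ev M e b) (ev M e c) (ev M e d))"
  "tr M e (tab k a b c d) = (M (e ! 1 + idx (e ! 1) k (ev M e a) (ev M e b) (ev M e c) (ev M e d)) \<noteq> 0)"
  by (simp_all add: tab_def idx_def)

lemma wf_tab [simp]:
  "wf_tm L (tab k a b c d) \<longleftrightarrow> 1 < L \<and> wf_tm L a \<and> wf_tm L b \<and> wf_tm L c \<and> wf_tm L d"
  by (auto simp: tab_def)

abbreviation tab0 :: "nat \<Rightarrow> tm" where "tab0 k \<equiv> tab k (Cn 0) (Cn 0) (Cn 0) (Cn 0)"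
abbreviation tab1 :: "nat \<Rightarrow> tm \<Rightarrow> tm" where "tab1 k a \<equiv> tab k a (Cn 0) (Cn 0) (Cn 0)"
abbreviation tab2 :: "nat \<Rightarrow> tm \<Rightarrow> tm \<Rightarrow> tm" where "tab2 k a b \<equiv> tab k a b (Cn 0) (Cn 0)"
abbreviation tab3 :: "nat \<Rightarrow> tm \<Rightarrow> tm \<Rightarrow> tm \<Rightarrow> tm" where "tab3 k a b c \<equiv> tab k a b c (Cn 0)"
text \<open>Walks of length \<open>n * n\<close> suffice for reachability; with \<open>n\<close>,
  which numbers no vertex, in place of \<open>x\<close> nothing is avoided.\<close>

abbreviation avT :: "tm \<Rightarrow> tm \<Rightarrow> tm \<Rightarrow> tm" where "avT x u v \<equiv> tab 1 (tiT nT nT) x u v"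
abbreviation qT :: tm where "qT \<equiv> tab0 3"
abbreviation q2T :: tm where "q2T \<equiv> tiT (Cn 2) qT"
abbreviation q4T :: tm where "q4T \<equiv> tiT (Cn 4) qT"
abbreviation sqrtT :: tm where "sqrtT \<equiv> Mu (plT nT (Cn 1)) (notT (lsT (tiT (Vr 7) (Vr 7)) nT))"

definition tabs :: "tm list" where "tabs = [
  \<comment> \<open>0: edge \<open>(a, b)\<close>\<close>
  boolT (Sm mT (andT (eqT (Ld (plT (Cn 3) (tiT (Cn 2) (Vr 7)))) aI) (eqT (Ld (plT (Cn 4) (tiT (Cn 2) (Vr 7)))) bI))),
  \<comment> \<open>1: walk of length at most \<open>a\<close> from \<open>c\<close> to \<open>d\<close> avoiding \<open>b\<close>\<close>
  boolT (Ite (eqT aI (Cn 0)) (andT (eqT cI dI) (notT (eqT cI bI)))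
    (orT (tab 1 (miT aI (Cn 1)) bI cI dI)
      (Sm nT (andT (andT (tab 1 (miT aI (Cn 1)) bI cI (Vr 7)) (tab2 0 (Vr 7) dI)) (notT (eqT dI bI)))))),
  \<comment> \<open>2: representative of the component of \<open>a\<close>\<close>
  Mu nT (andT (avT nT aI (Vr 7)) (avT nT (Vr 7) aI)),
  \<comment> \<open>3: rounded-up square root of \<open>n\<close>\<close>
  sqrtT,
  \<comment> \<open>4: \<open>cut a\<close> for pair \<open>b\<close> and vertex \<open>c\<close>\<close>
  boolT (andT (andT (avT nT (srcT bI) (snkT bI)) (notT (avT cI (srcT bI) (snkT bI))))
    (Ite (eqT aI (Cn 0)) (notT (avT cI (srcT bI) (tab1 2 cI))) (notT (avT cI (tab1 2 cI) (snkT bI))))),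
  \<comment> \<open>5: pair \<open>b\<close> is an owner\<close>
  boolT (notT (lsT (Sm nT (boolT (andT (tab3 4 aI bI (Vr 7))
    (notT (Sm bI (andT (tab2 5 aI (Vr 8)) (tab3 4 aI (Vr 8) (Vr 7)))))))) qT)),
  \<comment> \<open>6: owner of \<open>b\<close>\<close>
  Mu lT (andT (tab2 5 aI (Vr 7)) (tab3 4 aI (Vr 7) bI)),
  \<comment> \<open>7: rank of \<open>b\<close> in its owner\<close>
  Ite (lsT (tab2 6 aI bI) lT) (plT (Cn 1) (Sm nT (boolT (avT bI (srcT (tab2 6 aI bI)) (Vr 7))))) (Cn 0),
  \<comment> \<open>8: number of the owner of \<open>b\<close>\<close>
  Ite (lsT (tab2 6 aI bI) lT) (Sm (tab2 6 aI bI) (boolT (tab2 5 aI (Vr 7)))) (Cn 0),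
  \<comment> \<open>9, 10: least and largest rank in owner \<open>c\<close> of a vertex that \<open>b\<close> shares with it\<close>
  Mu (plT nT (Cn 2)) (Sm nT (andT (andT (tab3 4 aI bI (Vr 8)) (lsT (tab2 6 aI (Vr 8)) lT))
    (andT (eqT (tab2 8 aI (Vr 8)) cI) (eqT (tab2 7 aI (Vr 8)) (Vr 7))))),
  miT (plT nT (Cn 1)) (Mu (plT nT (Cn 2)) (Sm nT (andT (andT (tab3 4 aI bI (Vr 8)) (lsT (tab2 6 aI (Vr 8)) lT))
    (andT (eqT (tab2 8 aI (Vr 8)) cI) (eqT (tab2 7 aI (Vr 8)) (miT (plT nT (Cn 1)) (Vr 7))))))),
  \<comment> \<open>11: the only exit of \<open>b\<close> for pair \<open>a\<close>, or \<open>n\<close>\<close>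
  Mu nT (allT nT (iffT (andT (tab2 0 bI (Vr 8)) (avT bI (Vr 8) (snkT aI))) (eqT (Vr 8) (Vr 7)))),
  \<comment> \<open>12: exit of the last vertex that \<open>b\<close> shares with owner \<open>c\<close>\<close>
  tab2 11 bI (Mu nT (andT (andT (tab3 4 aI bI (Vr 7)) (lsT (tab2 6 aI (Vr 7)) lT))
    (andT (eqT (tab2 8 aI (Vr 7)) cI) (eqT (tab2 7 aI (Vr 7)) (tab3 10 aI bI cI))))),
  \<comment> \<open>13: \<open>b\<close> is unowned for pair \<open>a\<close>\<close>
  boolT (orT (andT (tab3 4 (Cn 0) aI bI) (eqT (tab2 6 (Cn 0) bI) lT))
             (andT (tab3 4 (Cn 1) aI bI) (eqT (tab2 6 (Cn 1) bI) lT))),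
  \<comment> \<open>14 -- 18: column displacements, rows, row sizes, row displacements\<close>
  Mu q2T (notT (lsT (Sm nT (Sm nT (boolT (andT (tab2 13 aI (Vr 8)) (andT (tab2 13 aI (Vr 9)) (andT (eqT (mdT (Vr 8) qT) bI)
      (lsT (mdT (Vr 9) qT) bI)))))))
    (tiT (Sm nT (Sm nT (boolT (andT (tab2 13 aI (Vr 8)) (andT (tab2 13 aI (Vr 9)) (andT (eqT (mdT (Vr 8) qT) bI)
      (andT (lsT (mdT (Vr 9) qT) bI) (eqT (mdT (plT (dvT (Vr 8) qT) (Vr 7)) q2T)
        (mdT (plT (dvT (Vr 9) qT) (tab2 14 aI (mdT (Vr 9) qT))) q2T))))))))) q2T))),
  mdT (plT (dvT bI qT) (tab2 14 aI (mdT bI qT))) q2T,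
  Sm nT (boolT (andT (tab2 13 aI (Vr 7)) (eqT (tab2 15 aI (Vr 7)) bI))),
  Ite (eqT bI (miT q2T (tab2 16 aI cI)))
    (Mu q4T (allT nT (orT (notT (andT (tab2 13 aI (Vr 8)) (eqT (tab2 15 aI (Vr 8)) cI)))
      (allT nT (orT (notT (andT (tab2 13 aI (Vr 9))
          (orT (lsT (tab2 16 aI cI) (tab2 16 aI (tab2 15 aI (Vr 9))))
            (andT (eqT (tab2 16 aI cI) (tab2 16 aI (tab2 15 aI (Vr 9)))) (lsT (tab2 15 aI (Vr 9)) cI)))))
        (notT (eqT (mdT (plT (mdT (Vr 8) qT) (Vr 7)) q4T)
          (mdT (plT (mdT (Vr 9) qT) (tab3 17 aI (miT q2T (tab2 16 aI (tab2 15 aI (Vr 9)))) (tab2 15 aI (Vr 9)))) q4T))))))))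
    (Cn 0),
  tab3 17 aI (miT q2T (tab2 16 aI bI)) bI,
  \<comment> \<open>19, 20: the unowned vertex in slot \<open>b\<close> (plus one), and its exit\<close>
  Lt (Mu nT (andT (tab2 13 aI (Vr 7)) (eqT (mdT (plT (mdT (Vr 7) qT) (tab2 18 aI (tab2 15 aI (Vr 7)))) q4T) bI)))
    (Ite (lsT (Vr 7) nT) (plT (Vr 7) (Cn 1)) (Cn 0)),
  Ite (tab2 19 aI bI) (tab2 11 aI (miT (tab2 19 aI bI) (Cn 1))) (Cn 0),
  \<comment> \<open>21 -- 23: search tree for the pairs\<close>
  Mu lT (eqT (srcT (Vr 7)) aI),
  Mu lT (andT (eqT (srcT (Vr 7)) (srcT aI)) (eqT (dvT (snkT (Vr 7)) qT) bI)),
  Mu lT (andT (eqT (srcT (Vr 7)) (srcT aI)) (andT (eqT (dvT (snkT (Vr 7)) qT) (dvT (snkT aI) qT))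
    (eqT (mdT (snkT (Vr 7)) qT) bI))),
  \<comment> \<open>24: words of vertex \<open>a\<close>\<close>
  Ite (eqT bI (Cn 0)) (tab1 21 aI) (Ite (eqT bI (Cn 1)) (tab2 8 (Cn 0) aI) (Ite (eqT bI (Cn 2)) (tab2 7 (Cn 0) aI)
    (Ite (eqT bI (Cn 3)) (tab2 11 (tab2 6 (Cn 0) aI) aI) (Ite (eqT bI (Cn 4)) (tab2 8 (Cn 1) aI)
    (Ite (eqT bI (Cn 5)) (tab2 7 (Cn 1) aI) (tab2 11 (tab2 6 (Cn 1) aI) aI)))))),
  \<comment> \<open>25: words of pair \<open>a\<close>, in 20 sections of \<open>q\<close> words\<close>
  Ite (eqT bI (Cn 0)) (avT nT (srcT aI) (snkT aI)) (Ite (eqT bI (Cn 1)) (tab2 22 aI cI) (Ite (eqT bI (Cn 2)) (tab2 23 aI cI)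
    (Ite (eqT bI (Cn 3)) (tab2 14 aI cI) (Ite (lsT bI (Cn 6)) (tab2 18 aI (plT (tiT (miT bI (Cn 4)) qT) cI))
    (Ite (lsT bI (Cn 10)) (tab2 19 aI (plT (tiT (miT bI (Cn 6)) qT) cI))
    (Ite (lsT bI (Cn 14)) (tab2 20 aI (plT (tiT (miT bI (Cn 10)) qT) cI))
    (Ite (eqT bI (Cn 14)) (tab3 9 (Cn 0) aI cI) (Ite (eqT bI (Cn 15)) (tab3 10 (Cn 0) aI cI) (Ite (eqT bI (Cn 16)) (tab3 12 (Cn 0) aI cI)
    (Ite (eqT bI (Cn 17)) (tab3 9 (Cn 1) aI cI) (Ite (eqT bI (Cn 18)) (tab3 10 (Cn 1) aI cI) (tab3 12 (Cn 1) aI cI)))))))))))),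
  \<comment> \<open>26: the oracle\<close>
  Ite (eqT dI (Cn 0)) nT (Ite (eqT dI (Cn 1)) qT (Ite (lsT dI (plT (Cn 2) (tiT (Cn 7) nT)))
    (tab2 24 (dvT (miT dI (Cn 2)) (Cn 7)) (mdT (miT dI (Cn 2)) (Cn 7)))
    (Lt (miT dI (plT (Cn 2) (tiT (Cn 7) nT)))
      (tab3 25 (dvT (dvT (Vr 7) qT) (Cn 20)) (mdT (dvT (Vr 7) qT) (Cn 20)) (mdT (Vr 7) qT)))))]"

primrec dispatch :: "nat \<Rightarrow> tm list \<Rightarrow> tm" where
  "dispatch k [] = Cn 0"
| "dispatch k (t # ts) = Ite (eqT (Vr 2) (Cn k)) t (dispatch (Suc k) ts)"

lemma ev_dispatch: "e ! 2 = k + j \<Longrightarrow> j < length ts \<Longrightarrow> ev M e (dispatch k ts) = ev M e (ts ! j)"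
  by (induction ts arbitrary: k j) (auto simp: nth_Cons split: nat.splits)

lemma wf_dispatch: "2 < L \<Longrightarrow> \<forall>t\<in>set ts. wf_tm L t \<Longrightarrow> wf_tm L (dispatch k ts)"
  by (induction ts arbitrary: k) auto

definition tableT :: tm where "tableT = dispatch 0 tabs"
definition startT :: tm where "startT = plT WT (tiT (Cn 26) (powT 4 WT))"
text \<open>For \<open>n = 0\<close> the size bound is zero, so the oracle must be empty. The root
  is computed anew, because \<open>qT\<close> takes \<open>W\<close> from the environment, which is
  empty here.\<close>

definition lengthT :: tm where
  "lengthT = Ite nT (plT (plT (Cn 2) (tiT (Cn 7) nT))
     (tiT (tiT (Cn 20) (Mu (plT nT (Cn 1)) (notT (lsT (tiT (Vr 0) (Vr 0)) nT)))) lT)) (Cn 0)"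

lemma wf_tables: "wf_tm 7 tableT" "wf_tm 0 startT" "wf_tm 0 lengthT"
  unfolding tableT_def
  by (rule wf_dispatch) (simp_all add: tabs_def startT_def lengthT_def)

lemma length_tabs: "length tabs = 27"
  by (simp add: tabs_def)

declare mu.simps(2) [simp del]

lemma mu_cong': "b = b' \<Longrightarrow> (\<And>i. i < b' \<Longrightarrow> P i = Q i) \<Longrightarrow> mu b P = mu b' Q"
  using mu_cong by blast

section \<open>The tables of reachability and of owners\<close>

locale tables =
  fixes n m l W :: nat and M :: "nat \<Rightarrow> nat"
  assumes W: "W = (n + 2) ^ 6" and n0: "0 < n"
    and M0: "M 0 = n" "M 1 = m" "M 2 = l"
    and ml: "m \<le> n * n" "l \<le> n * n"
    and edges_less: "e < m \<Longrightarrow> M (3 + 2 * e) < n \<and> M (4 + 2 * e) < n"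
    and pairs_less: "i < l \<Longrightarrow> M (3 + (2 * m + 2 * i)) < n \<and> M (4 + (2 * m + 2 * i)) < n"
    and rec: "k < 27 \<Longrightarrow> a < W \<Longrightarrow> b < W \<Longrightarrow> c < W \<Longrightarrow> d < W \<Longrightarrow>
      M (W + idx W k a b c d) =
        ev (\<lambda>x. if x < W + idx W k a b c d then M x else 0) [idx W k a b c d, W, k, a, b, c, d] tableT mod W"
begin

definition F :: "nat \<Rightarrow> nat \<Rightarrow> nat \<Rightarrow> nat \<Rightarrow> nat \<Rightarrow> nat" where "F k a b c d = M (W + idx W k a b c d)"

definition R :: "nat \<Rightarrow> nat \<Rightarrow> nat \<Rightarrow> nat \<Rightarrow> nat \<Rightarrow> nat \<Rightarrow> nat" where
  "R k a b c d = (\<lambda>x. if x < W + idx W k a b c d then M x else 0)"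

lemma W_big: "4 * (n * n) + 8 * n + 100 < W" "30 * (n * n * n) < W"
proof -
  define z where "z = n + 2"
  have z: "3 \<le> z" using n0 by (simp add: z_def)
  have "3 ^ 4 \<le> z ^ 4" "3\<^sup>2 \<le> z\<^sup>2" using z by (intro power_mono; simp)+
  then have "81 \<le> z ^ 4" "9 \<le> z\<^sup>2" by simp_all
  moreover from this have "81 * z\<^sup>2 \<le> z ^ 4 * z\<^sup>2" by (intro mult_le_mono1)
  moreover have "z ^ 4 * z\<^sup>2 = z ^ 6" unfolding power_add[symmetric] by simp
  ultimately have "4 * z\<^sup>2 + 100 < z ^ 6" by linarith
  moreover have "4 * (n * n) + 8 * n \<le> 4 * z\<^sup>2" by (simp add: z_def power2_eq_square)
  ultimately show "4 * (n * n) + 8 * n + 100 < W" by (simp add: W z_def)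
  show "30 * (n * n * n) < W"
  \<comment> \<open>For \<open>n = 1\<close> the factor \<open>z ^ 3\<close> is 27 and falls short
    of 30.\<close>
  proof (cases "n = 1")
    case False
    then have "4 ^ 3 \<le> z ^ 3" using n0 by (intro power_mono) (auto simp: z_def)
    then have "30 * (n * n * n) \<le> z ^ 3 * (n * n * n)" by (intro mult_le_mono1) simp
    also have "\<dots> < z ^ 3 * z ^ 3"
    proof (rule mult_strict_left_mono)
      show "n * n * n < z ^ 3" using power_strict_mono[of n z 3] by (simp add: z_def power3_eq_cube)
    qed (use z in simp)
    also have "\<dots> = W" unfolding W z_def power_add[symmetric] by simp
    finally show ?thesis .
  qed (simp add: W numeral_3_eq_3[symmetric])
qed

lemma n_le_nn: "n \<le> n * n"
  by simp

lemma lessW [simp]: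
  "n < W" "n + k \<le> 2 * n + 2 \<Longrightarrow> n + k < W" "n * n < W" "l < W" "m < W" "0 < W" "Suc 0 < W"
  "x < n \<Longrightarrow> x < W" "i < l \<Longrightarrow> i < W" "x \<le> n * n \<Longrightarrow> x < W" "x \<le> 4 * n \<Longrightarrow> x < W" "b < 2 \<Longrightarrow> b < W" "x < 20 \<Longrightarrow> x < W"
  using W_big n_le_nn ml by linarith+

lemma in_less [simp]:
  "e < m \<Longrightarrow> 3 + 2 * e < W" "e < m \<Longrightarrow> 4 + 2 * e < W"
  "i < l \<Longrightarrow> 3 + (2 * m + 2 * i) < W" "i < l \<Longrightarrow> 4 + (2 * m + 2 * i) < W"
  using W_big ml by linarith+

text \<open>Each table reduces to evaluating one term on the memory below its own address, plus a
  range check that makes the reduction modulo \<open>W\<close> vacuous.\<close>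

lemma F_eqI:
  assumes "k < 27" "a < W" "b < W" "c < W" "d < W"
    and "ev (R k a b c d) [idx W k a b c d, W, k, a, b, c, d] (tabs ! k) = v" "v < W"
  shows "F k a b c d = v"
  using rec[OF assms(1-5)] assms(1,6,7) ev_dispatch[of "[idx W k a b c d, W, k, a, b, c, d]" 0 k tabs "R k a b c d"]
  by (simp add: F_def R_def tableT_def length_tabs)

lemma R_in [simp]: "x < W \<Longrightarrow> R k a b c d x = M x"
  by (simp add: R_def)

lemma R_0 [simp]: "R k a b c d 0 = n" "R k a b c d 1 = m" "R k a b c d (Suc 0) = m" "R k a b c d 2 = l"
  using M0 W_big by (simp_all add: R_def)

lemma R_prev [simp]:
  "k' < k \<Longrightarrow> a' < W \<Longrightarrow> b' < W \<Longrightarrow> c' < W \<Longrightarrow> d' < W \<Longrightarrow> R k a b c d (W + idx W k' a' b' c' d') = F k' a' b' c' d'"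
  by (simp add: R_def F_def idx_less)

lemma R_same:
  "a' < W \<Longrightarrow> b' < W \<Longrightarrow> c' < W \<Longrightarrow> d' < W \<Longrightarrow> a' < a \<or> a' = a \<and> (b' < b \<or> b' = b \<and> c' < c) \<Longrightarrow>
    R k a b c d (W + idx W k a' b' c' d') = F k a' b' c' d'"
  using idx_less[of a' W b' c' d' k k a b c d] by (auto simp: R_def F_def)

definition src :: "nat \<Rightarrow> nat" where "src i = M (3 + (2 * m + 2 * i))"
definition snk :: "nat \<Rightarrow> nat" where "snk i = M (4 + (2 * m + 2 * i))"
definition edge :: "nat \<Rightarrow> nat \<Rightarrow> bool" where "edge u v \<longleftrightarrow> (\<exists>e<m. M (3 + 2 * e) = u \<and> M (4 + 2 * e) = v)"
definition q :: nat where "q = F 3 0 0 0 0"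

lemmas src_fold [simp] = src_def[symmetric] snk_def[symmetric]

lemma src_less [simp]: "i < l \<Longrightarrow> src i < n" "i < l \<Longrightarrow> snk i < n"
  using pairs_less by auto

lemma edge_less: "edge u v \<Longrightarrow> u < n \<and> v < n"
  using edges_less by (auto simp: edge_def)

lemma F0: "u < W \<Longrightarrow> v < W \<Longrightarrow> F 0 u v 0 0 = of_bool (edge u v)"
  by (rule F_eqI) (simp_all add: tabs_def edge_def cong: conj_cong)

definition walks :: "nat \<Rightarrow> nat \<Rightarrow> nat \<Rightarrow> nat \<Rightarrow> bool" where
  "walks k x u v \<longleftrightarrow> u \<noteq> x \<and> (\<exists>j\<le>k. ((\<lambda>a b. edge a b \<and> b \<noteq> x) ^^ j) u v)"

lemma walks_0: "walks 0 x u v \<longleftrightarrow> u = v \<and> u \<noteq> x"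
  by (auto simp: walks_def)

lemma walks_Suc: "walks (Suc k) x u v \<longleftrightarrow> walks k x u v \<or> (\<exists>z<n. walks k x u z \<and> edge z v \<and> v \<noteq> x)"
proof
  assume "walks (Suc k) x u v"
  then obtain j where j: "u \<noteq> x" "j \<le> Suc k" "((\<lambda>a b. edge a b \<and> b \<noteq> x) ^^ j) u v" by (auto simp: walks_def)
  show "walks k x u v \<or> (\<exists>z<n. walks k x u z \<and> edge z v \<and> v \<noteq> x)"
  proof (cases "j = Suc k")
    case True
    then obtain z where "((\<lambda>a b. edge a b \<and> b \<noteq> x) ^^ k) u z" "edge z v" "v \<noteq> x" using j(3) by auto
    then show ?thesis using j(1) edge_less[of z v] by (auto simp: walks_def)
  qed (use j in \<open>auto simp: walks_def le_Suc_eq\<close>)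
next
  assume "walks k x u v \<or> (\<exists>z<n. walks k x u z \<and> edge z v \<and> v \<noteq> x)"
  then show "walks (Suc k) x u v"
  proof
    assume "\<exists>z<n. walks k x u z \<and> edge z v \<and> v \<noteq> x"
    then obtain z j where "u \<noteq> x" "j \<le> k" "((\<lambda>a b. edge a b \<and> b \<noteq> x) ^^ j) u z" "edge z v" "v \<noteq> x"
      by (auto simp: walks_def)
    then show ?thesis unfolding walks_def by (intro conjI exI[of _ "Suc j"]) auto
  qed (auto simp: walks_def intro: le_SucI)
qed

lemma F1_walks:
  assumes "x \<le> n" "u < n"
  shows "k \<le> n * n \<Longrightarrow> v < n \<Longrightarrow> F 1 k x u v = of_bool (walks k x u v)"
proof (induction k arbitrary: v)
  case 0
  show ?case
    by (rule F_eqI) (use assms 0 in \<open>auto simp: tabs_def walks_0\<close>)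
next
  case (Suc k)
  have x: "x < W" using assms(1) lessW(1) by linarith
  have IH: "R 1 (Suc k) x u v (W + idx W 1 k x u z) = of_bool (walks k x u z)" if "z < n" for z
    using Suc.IH[of z] Suc.prems assms x that by (subst R_same) auto
  show ?case
  proof (rule F_eqI)
    show "ev (R 1 (Suc k) x u v) [idx W 1 (Suc k) x u v, W, 1, Suc k, x, u, v] (tabs ! 1) = of_bool (walks (Suc k) x u v)"
      using assms Suc.prems x by (auto simp: tabs_def IH[unfolded One_nat_def] F0 walks_Suc cong: conj_cong)
  qed (use assms Suc.prems x in auto)
qed

text \<open>Reachability in a finite relation needs no more steps than the relation has elements,
  here at most \<open>n * n\<close>.\<close>

lemma walks_avo: "walks (n * n) x u v \<longleftrightarrow> avo edge {x} u v"
proof -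
  let ?R = "{(a, b). edge a b \<and> b \<noteq> x}"
  have sub: "?R \<subseteq> {..<n} \<times> {..<n}" using edge_less by auto
  then have fin: "finite ?R" by (rule finite_subset) auto
  have "card ?R \<le> card ({..<n} \<times> {..<n})" by (rule card_mono[OF _ sub]) auto
  then have card: "card ?R \<le> n * n" by simp
  have pw: "((\<lambda>a b. edge a b \<and> b \<noteq> x) ^^ j) u v \<longleftrightarrow> (u, v) \<in> ?R ^^ j" for j
    using relpowp_relpow_eq[of j ?R] by (simp add: fun_eq_iff)
  have "(\<lambda>a b. edge a b \<and> b \<noteq> x)\<^sup>*\<^sup>* u v \<longleftrightarrow> (u, v) \<in> ?R\<^sup>*"
    unfolding rtrancl_def by simp
  also have "\<dots> \<longleftrightarrow> (\<exists>j\<le>card ?R. (u, v) \<in> ?R ^^ j)"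
    using rtrancl_finite_eq_relpow[OF fin] by auto
  also have "\<dots> \<longleftrightarrow> (\<exists>j\<le>n * n. (u, v) \<in> ?R ^^ j)"
    using card rtrancl_finite_eq_relpow[OF fin] rtrancl_power[of "(u, v)" ?R] le_trans by (auto; blast)
  finally show ?thesis by (auto simp: walks_def avo_def pw)
qed

lemma F1 [simp]: "x \<le> n \<Longrightarrow> u < n \<Longrightarrow> v < n \<Longrightarrow> F 1 (n * n) x u v = of_bool (avo edge {x} u v)"
  "x \<le> n \<Longrightarrow> u < n \<Longrightarrow> v < n \<Longrightarrow> F (Suc 0) (n * n) x u v = of_bool (avo edge {x} u v)"
  using F1_walks[of x u "n * n" v] by (simp_all add: walks_avo)

lemma avo_n: "u < n \<Longrightarrow> avo edge {n} u v \<longleftrightarrow> avo edge {} u v"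
proof
  assume "u < n" "avo edge {} u v"
  from this(2,1) show "avo edge {n} u v"
  proof (induction rule: avo_induct)
    case (step a c)
    then show ?case using edge_less[of a c] by (auto intro: avo_step)
  qed (auto intro: avo_refl)
qed (auto intro: avo_mono)

text \<open>The identity beyond the vertices makes \<open>scc_rep\<close> hold on all numbers, since
  those without edges are components of their own.\<close>

definition rp :: "nat \<Rightarrow> nat" where "rp x = (if x < n then F 2 x 0 0 0 else x)"

lemma F2: "x < n \<Longrightarrow> F 2 x 0 0 0 = mu n (\<lambda>r. avo edge {} x r \<and> avo edge {} r x)"
  by (rule F_eqI)
     (use le_less_trans[OF mu_le lessW(1)] in \<open>auto simp: tabs_def avo_n cong: mu_cong'\<close>)

lemma rp_less [simp]: "x < n \<Longrightarrow> rp x < n" "x < n \<Longrightarrow> F 2 x 0 0 0 < n"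
  and rp_scc: "x < n \<Longrightarrow> avo edge {} x (rp x) \<and> avo edge {} (rp x) x"
proof -
  assume x: "x < n"
  have "mu n (\<lambda>r. avo edge {} x r \<and> avo edge {} r x) < n"
    using mu_less[OF x, of "\<lambda>r. avo edge {} x r \<and> avo edge {} r x"] by (auto intro: avo_refl)
  from mu_holds[OF this] this x show "rp x < n" "F 2 x 0 0 0 < n" "avo edge {} x (rp x) \<and> avo edge {} (rp x) x"
    by (auto simp: rp_def F2)
qed

lemma scc_rep_rp: "scc_rep edge rp"
  unfolding scc_rep_def
proof (intro conjI allI impI)
  fix x y
  show "avo edge {} x (rp x)" "avo edge {} (rp x) x"
    using rp_scc[of x] by (cases "x < n"; auto simp: rp_def intro: avo_refl)+
  assume xy: "avo edge {} x y \<and> avo edge {} y x"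
  have out: "a = b" if "avo edge {} a b" "\<not> a < n" for a b
    using that by (induction rule: avo_induct) (auto dest: edge_less)
  show "rp x = rp y"
  proof (cases "x < n \<and> y < n")
    case True
    have "(\<lambda>r. avo edge {} x r \<and> avo edge {} r x) = (\<lambda>r. avo edge {} y r \<and> avo edge {} r y)"
      using xy by (auto intro: avo_trans)
    then show ?thesis using True by (simp add: rp_def F2)
  qed (use xy out in metis)
qed

lemma F3: "q = mu (n + 1) (\<lambda>z. n \<le> z * z)"
  unfolding q_def
  by (rule F_eqI) (use le_less_trans[OF mu_le lessW(2)[of 1]] in \<open>auto simp: tabs_def not_less\<close>)

lemma q_props: "0 < q" "n \<le> q * q" "q \<le> n" "(q - 1) * (q - 1) < n"
proof -
  have lt: "mu (n + 1) (\<lambda>z. n \<le> z * z) < n + 1" by (rule mu_less[of n]) auto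
  then show *: "n \<le> q * q" "q \<le> n" using mu_holds[OF lt] by (simp_all add: F3)
  then show q: "0 < q" using n0 by (cases q) auto
  then have "q - 1 < mu (n + 1) (\<lambda>z. n \<le> z * z)" by (simp add: F3)
  from mu_least[OF this] show "(q - 1) * (q - 1) < n" by simp
qed

lemma F3' [simp]: "F 3 0 0 0 0 = q"
  by (simp add: q_def)

definition Cut :: "nat \<Rightarrow> nat \<Rightarrow> nat \<Rightarrow> bool" where "Cut b i x \<longleftrightarrow> cut b edge rp (src i) (snk i) x"

lemma F4 [simp]: "b < 2 \<Longrightarrow> i < l \<Longrightarrow> x < n \<Longrightarrow> F 4 b i x 0 = of_bool (Cut b i x)"
proof (rule F_eqI)
  assume *: "b < 2" "i < l" "x < n"
  show "ev (R 4 b i x 0) [idx W 4 b i x 0, W, 4, b, i, x, 0] (tabs ! 4) = of_bool (Cut b i x)"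
    using * rp_less(2)[of x] by (simp add: tabs_def avo_n Cut_def cut_def cut_src_def cut_snk_def crit_def rp_def)
qed auto

definition isO :: "nat \<Rightarrow> nat \<Rightarrow> bool" where "isO b j \<longleftrightarrow> F 5 b j 0 0 \<noteq> 0"

lemma set_lessThan: "{..<n} \<inter> {x. P x} = {x. x < n \<and> P x}"
  by auto

lemma card_less_n: "card {x. x < n \<and> P x} \<le> n"
  using card_mono[of "{..<n}" "{x. x < n \<and> P x}"] by auto

lemma F5:
  assumes "b < 2" "j < l"
  shows "F 5 b j 0 0 = of_bool (q \<le> card {x. x < n \<and> Cut b j x \<and> \<not> (\<exists>j'<j. isO b j' \<and> Cut b j' x)})"
proof (rule F_eqI)
  have *: "R 5 b j 0 0 (W + idx W 5 b j' 0 0) = F 5 b j' 0 0" "j' < l" if "j' < j" for j'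
    using assms that by (auto simp: R_same)
  show "ev (R 5 b j 0 0) [idx W 5 b j 0 0, W, 5, b, j, 0, 0] (tabs ! 5) =
      of_bool (q \<le> card {x. x < n \<and> Cut b j x \<and> \<not> (\<exists>j'<j. isO b j' \<and> Cut b j' x)})"
    using assms * by (simp add: tabs_def isO_def not_less set_lessThan cong: conj_cong disj_cong sum.cong)
qed (use assms in auto)

lemma isO_iff:
  "b < 2 \<Longrightarrow> j < l \<Longrightarrow> isO b j \<longleftrightarrow> q \<le> card {x. x < n \<and> Cut b j x \<and> \<not> (\<exists>j'<j. isO b j' \<and> Cut b j' x)}"
  unfolding isO_def[of b j] by (subst F5) simp_all

lemma F5' [simp]: "b < 2 \<Longrightarrow> j < l \<Longrightarrow> F 5 b j 0 0 = of_bool (isO b j)"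
  by (simp only: F5 isO_iff)

lemma greedy: "b < 2 \<Longrightarrow> greedy_owners n l q (Cut b) (isO b)"
  by unfold_locales (use q_props in \<open>simp_all only: isO_iff\<close>)

end

lemma sum_cong_less:
  "a = b \<Longrightarrow> (\<And>x. x < b \<Longrightarrow> f x = g x) \<Longrightarrow> sum f {..<a::nat} = sum g {..<b}"
  by simp

context tables
begin

lemma F_less: "k < 27 \<Longrightarrow> a < W \<Longrightarrow> b < W \<Longrightarrow> c < W \<Longrightarrow> d < W \<Longrightarrow> F k a b c d < W"
  using rec[of k a b c d] by (simp add: F_def)

lemma mu_lessW [simp]: "b < W \<Longrightarrow> mu b P < W"
  using mu_le[of b P] by simp

lemma nW [simp]: "Suc n < W" "Suc (Suc n) < W"
  using W_big by simp_all

section \<open>Ranks, intervals and exits\<close>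

definition own :: "nat \<Rightarrow> nat \<Rightarrow> nat" where "own b x = mu l (\<lambda>j. isO b j \<and> Cut b j x)"

lemma own_less [simp]: "own b x < W"
  by (simp add: own_def)

lemma F6 [simp]: "b < 2 \<Longrightarrow> x < n \<Longrightarrow> F 6 b x 0 0 = own b x"
  by (rule F_eqI) (simp_all add: tabs_def own_def cong: mu_cong' conj_cong)

text \<open>Not the position in the order but a quantity that increases along it and takes a single
  count. Starting at 1 leaves rank 0 to vertices without an owner.\<close>

definition rk :: "nat \<Rightarrow> nat \<Rightarrow> nat" where "rk j x = Suc (card {u. u < n \<and> avo edge {x} (src j) u})"

lemma rk_le: "rk j x \<le> Suc n"
  using card_less_n[of "\<lambda>u. avo edge {x} (src j) u"] by (simp add: rk_def)

definition rank :: "nat \<Rightarrow> nat \<Rightarrow> nat" where "rank b x = (if own b x < l then rk (own b x) x else 0)"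

lemma rank_less: "rank b x < W"
  using rk_le[of "own b x" x] le_less_trans[OF _ nW(1)] by (auto simp: rank_def)

lemma F7 [simp]: "b < 2 \<Longrightarrow> x < n \<Longrightarrow> F 7 b x 0 0 = rank b x"
  by (rule F_eqI) (use rank_less in \<open>simp_all add: tabs_def rank_def rk_def set_lessThan cong: conj_cong sum_cong_less\<close>)

definition ono :: "nat \<Rightarrow> nat \<Rightarrow> nat" where
  "ono b x = (if own b x < l then card {j. j < own b x \<and> isO b j} else 0)"

lemma ono_less: "ono b x < W"
proof -
  have "card {j. j < own b x \<and> isO b j} \<le> own b x"
    using card_mono[of "{..<own b x}" "{j. j < own b x \<and> isO b j}"] by auto
  then show ?thesis by (simp add: ono_def le_less_trans)
qed

lemma F8 [simp]: "b < 2 \<Longrightarrow> x < n \<Longrightarrow> F 8 b x 0 0 = ono b x"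
proof (rule F_eqI)
  assume *: "b < 2" "x < n"
  have "{..<own b x} \<inter> {y. isO b y} = {j. j < own b x \<and> isO b j}" by auto
  then show "ev (R 8 b x 0 0) [idx W 8 b x 0 0, W, 8, b, x, 0, 0] (tabs ! 8) = ono b x"
    using * by (simp add: tabs_def ono_def cong: conj_cong sum_cong_less)
qed (use ono_less in auto)

definition shared :: "nat \<Rightarrow> nat \<Rightarrow> nat \<Rightarrow> nat \<Rightarrow> bool" where
  "shared b i j x \<longleftrightarrow> Cut b i x \<and> own b x < l \<and> ono b x = j"

text \<open>If nothing is shared, the value \<open>n + 2\<close> exceeds every rank, so the interval
  test fails.\<close>

lemma F9: "b < 2 \<Longrightarrow> i < l \<Longrightarrow> j < W \<Longrightarrow>
    F 9 b i j 0 = mu (n + 2) (\<lambda>r. \<exists>x<n. shared b i j x \<and> rank b x = r)"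
  by (rule F_eqI) (simp_all add: tabs_def shared_def conj_assoc cong: mu_cong' conj_cong)

text \<open>A maximum, found as a least index counted from the top. If nothing is shared,
  \<open>n + 1 - (n + 2)\<close> is 0, below the rank of every owned vertex.\<close>

lemma F10: "b < 2 \<Longrightarrow> i < l \<Longrightarrow> j < W \<Longrightarrow>
    F 10 b i j 0 = n + 1 - mu (n + 2) (\<lambda>r. \<exists>x<n. shared b i j x \<and> rank b x = n + 1 - r)"
  by (rule F_eqI) (simp_all add: tabs_def shared_def conj_assoc less_imp_diff_less cong: mu_cong' conj_cong)

lemma F11: "i < l \<Longrightarrow> u < n \<Longrightarrow> F 11 i u 0 0 = mu n (\<lambda>v. \<forall>v'<n. exits edge (snk i) u v' \<longleftrightarrow> v' = v)"
  by (rule F_eqI) (simp_all add: tabs_def exits_def F0 cong: mu_cong' conj_cong)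

lemma F12: "b < 2 \<Longrightarrow> i < l \<Longrightarrow> j < W \<Longrightarrow>
    F 12 b i j 0 = F 11 i (mu n (\<lambda>x. shared b i j x \<and> rank b x = F 10 b i j 0)) 0 0"
  by (rule F_eqI) (simp_all add: tabs_def shared_def conj_assoc F_less cong: mu_cong' conj_cong)

section \<open>Hash tables of the vertices without an owner\<close>

definition unowned :: "nat \<Rightarrow> nat \<Rightarrow> bool" where
  "unowned i x \<longleftrightarrow> Cut 0 i x \<and> own 0 x = l \<or> Cut 1 i x \<and> own 1 x = l"

lemma F13 [simp]: "i < l \<Longrightarrow> x < n \<Longrightarrow> F 13 i x 0 0 = of_bool (unowned i x)"
  by (rule F_eqI) (simp_all add: tabs_def unowned_def cong: conj_cong)

lemma few_unowned: "i < l \<Longrightarrow> (\<Sum>x<n. of_bool (unowned i x)) < 2 * q"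
proof -
  assume i: "i < l"
  have few: "card {x. x < n \<and> Cut b i x \<and> own b x = l} < q" if "b < 2" for b
    using greedy_owners.unowned_few[OF greedy[OF that] i]
    unfolding greedy_owners.own_def[OF greedy[OF that]] own_def by simp
  have "{..<n} \<inter> {x. unowned i x} \<subseteq> {x. x < n \<and> Cut 0 i x \<and> own 0 x = l} \<union> {x. x < n \<and> Cut 1 i x \<and> own 1 x = l}"
    by (auto simp: unowned_def)
  then have "card ({..<n} \<inter> {x. unowned i x}) \<le> card ({x. x < n \<and> Cut 0 i x \<and> own 0 x = l} \<union> {x. x < n \<and> Cut 1 i x \<and> own 1 x = l})"
    by (intro card_mono) auto
  also have "\<dots> \<le> card {x. x < n \<and> Cut 0 i x \<and> own 0 x = l} + card {x. x < n \<and> Cut 1 i x \<and> own 1 x = l}"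
    by (rule card_Un_le)
  finally show ?thesis using few[of 0] few[of 1] by simp
qed

lemma qW [simp]: "q < W" "x < q \<Longrightarrow> x < W" "x \<le> 2 * q \<Longrightarrow> x < W" "x \<le> 4 * q \<Longrightarrow> x < W" "x < 4 * q \<Longrightarrow> x < W" "x < 2 * q \<Longrightarrow> x < W"
  using q_props(3) W_big by linarith+

lemma modq [simp]: "x mod q < q" "x mod (2 * q) < 2 * q" "x mod (4 * q) < 4 * q"
  using q_props(1) by simp_all

lemma modW [simp]: "x mod q < W" "x mod (2 * q) < W" "x mod (4 * q) < W"
  by (rule qW modq)+

lemma F15: "i < l \<Longrightarrow> x < n \<Longrightarrow> F 15 i x 0 0 = (x div q + F 14 i (x mod q) 0 0) mod (2 * q)"
  by (rule F_eqI) (simp_all add: tabs_def)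

lemma F15_less: "i < l \<Longrightarrow> x < n \<Longrightarrow> F 15 i x 0 0 < 2 * q"
  by (simp add: F15)

lemma F15_lessW [simp]: "i < l \<Longrightarrow> x < n \<Longrightarrow> F 15 i x 0 0 < W"
  by (simp add: F15_less)

lemma F14:
  assumes "i < l" "g < q"
  shows "F 14 i g 0 0 = mu (2 * q) (\<lambda>\<gamma>.
    (\<Sum>x<n. \<Sum>y<n. of_bool (unowned i x \<and> unowned i y \<and> x mod q = g \<and> y mod q < g \<and> (x div q + \<gamma>) mod (2 * q) = F 15 i y 0 0)) * (2 * q)
      \<le> (\<Sum>x<n. \<Sum>y<n. of_bool (unowned i x \<and> unowned i y \<and> x mod q = g \<and> y mod q < g)))"
proof (rule F_eqI)
  \<comment> \<open>The table reads itself, but only the displacements of earlier columns.\<close>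
  have "R 14 i g 0 0 (W + idx W 14 i y 0 0) = F 14 i y 0 0" if "y < g" for y
    using assms that by (intro R_same) auto
  then show "ev (R 14 i g 0 0) [idx W 14 i g 0 0, W, 14, i, g, 0, 0] (tabs ! 14) = mu (2 * q) (\<lambda>\<gamma>.
    (\<Sum>x<n. \<Sum>y<n. of_bool (unowned i x \<and> unowned i y \<and> x mod q = g \<and> y mod q < g \<and> (x div q + \<gamma>) mod (2 * q) = F 15 i y 0 0)) * (2 * q)
      \<le> (\<Sum>x<n. \<Sum>y<n. of_bool (unowned i x \<and> unowned i y \<and> x mod q = g \<and> y mod q < g)))"
    using assms by (simp add: tabs_def F15 not_less del: sum_of_bool_eq cong: mu_cong' conj_cong sum_cong_less)
qed (use assms in auto)

lemma F16: "i < l \<Longrightarrow> \<rho> < 2 * q \<Longrightarrow> F 16 i \<rho> 0 0 = (\<Sum>x<n. of_bool (unowned i x \<and> F 15 i x 0 0 = \<rho>))"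
proof (rule F_eqI)
  assume *: "i < l" "\<rho> < 2 * q"
  show "ev (R 16 i \<rho> 0 0) [idx W 16 i \<rho> 0 0, W, 16, i, \<rho>, 0, 0] (tabs ! 16) = (\<Sum>x<n. of_bool (unowned i x \<and> F 15 i x 0 0 = \<rho>))"
    using * by (simp add: tabs_def del: sum_of_bool_eq cong: conj_cong sum_cong_less)
  have "(\<Sum>x<n. of_bool (unowned i x \<and> F 15 i x 0 0 = \<rho>)) \<le> n"
    by (simp add: set_lessThan card_less_n)
  then show "(\<Sum>x<n. of_bool (unowned i x \<and> F 15 i x 0 0 = \<rho>)) < W" by (rule le_less_trans) simp
qed auto

text \<open>Sizes below \<open>2 * q\<close> keep the truncated difference in the index of table 17
  strictly decreasing in the size.\<close>

lemma F16_less: "i < l \<Longrightarrow> \<rho> < 2 * q \<Longrightarrow> F 16 i \<rho> 0 0 < 2 * q"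
proof -
  assume *: "i < l" "\<rho> < 2 * q"
  have "F 16 i \<rho> 0 0 \<le> (\<Sum>x<n. of_bool (unowned i x))"
    unfolding F16[OF *] by (rule sum_mono) auto
  then show ?thesis using few_unowned[OF *(1)] by linarith
qed

lemma diffW [simp]: "2 * q - x < W"
  by simp

lemma F18: "i < l \<Longrightarrow> \<rho> < 2 * q \<Longrightarrow> F 18 i \<rho> 0 0 = F 17 i (2 * q - F 16 i \<rho> 0 0) \<rho> 0"
  by (rule F_eqI) (simp_all add: tabs_def F_less)

text \<open>The index \<open>2 * q - F 16 i \<rho> 0 0\<close> puts larger rows at smaller
  addresses, ties being broken by the row number. Address order is then the order in which rows are
  displaced, and every reference back to the table hits a cell already filled.\<close>

lemma F17:
  assumes "i < l" "\<rho> < 2 * q"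
  shows "F 17 i (2 * q - F 16 i \<rho> 0 0) \<rho> 0 = mu (4 * q) (\<lambda>\<delta>. \<forall>x<n. unowned i x \<and> F 15 i x 0 0 = \<rho> \<longrightarrow> (\<forall>y<n. unowned i y \<and>
      (F 16 i \<rho> 0 0 < F 16 i (F 15 i y 0 0) 0 0 \<or> F 16 i \<rho> 0 0 = F 16 i (F 15 i y 0 0) 0 0 \<and> F 15 i y 0 0 < \<rho>) \<longrightarrow>
      (x mod q + \<delta>) mod (4 * q) \<noteq> (y mod q + F 18 i (F 15 i y 0 0) 0 0) mod (4 * q)))" (is "F 17 i ?z _ _ = mu _ ?P")
proof (rule F_eqI)
  have *: "R 17 i ?z \<rho> 0 (W + idx W 17 i (2 * q - F 16 i (F 15 i y 0 0) 0 0) (F 15 i y 0 0) 0) = F 18 i (F 15 i y 0 0) 0 0"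
    if "y < n" "F 16 i \<rho> 0 0 < F 16 i (F 15 i y 0 0) 0 0 \<or> F 16 i \<rho> 0 0 = F 16 i (F 15 i y 0 0) 0 0 \<and> F 15 i y 0 0 < \<rho>" for y
    unfolding F18[OF assms(1) F15_less[OF assms(1) that(1)]]
    by (rule R_same) (use assms that F16_less[OF assms(1) F15_less[OF assms(1) that(1)]] in auto)
  let ?r = "\<lambda>y. R 17 i ?z \<rho> 0 (W + idx W 17 i (2 * q - F 16 i (F 15 i y 0 0) 0 0) (F 15 i y 0 0) 0)"
  have "ev (R 17 i ?z \<rho> 0) [idx W 17 i ?z \<rho> 0, W, 17, i, ?z, \<rho>, 0] (tabs ! 17) =
    mu (4 * q) (\<lambda>\<delta>. \<forall>x<n. unowned i x \<and> F 15 i x 0 0 = \<rho> \<longrightarrow> (\<forall>y<n. unowned i y \<and>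
      (F 16 i \<rho> 0 0 < F 16 i (F 15 i y 0 0) 0 0 \<or> F 16 i \<rho> 0 0 = F 16 i (F 15 i y 0 0) 0 0 \<and> F 15 i y 0 0 < \<rho>) \<longrightarrow>
      (x mod q + \<delta>) mod (4 * q) \<noteq> (y mod q + ?r y) mod (4 * q)))" (is "_ = ?m")
    using assms by (simp add: tabs_def F15_less cong: mu_cong' conj_cong disj_cong, intro mu_cong, blast)
  also have "?m = mu (4 * q) ?P"
    by (intro mu_cong all_cong1 imp_cong refl) (simp only: *)
  finally show "ev (R 17 i ?z \<rho> 0) [idx W 17 i ?z \<rho> 0, W, 17, i, ?z, \<rho>, 0] (tabs ! 17) = mu (4 * q) ?P" .
qed (use assms in auto)

lemma displ:
  assumes "i < l"
  shows "displacement n q (unowned i) (\<lambda>g. F 14 i g 0 0) (\<lambda>\<rho>. F 18 i \<rho> 0 0) (\<lambda>x. F 15 i x 0 0) (\<lambda>\<rho>. F 16 i \<rho> 0 0)"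
  by unfold_locales
     (rule q_props(1,2) few_unowned[OF assms] F14[OF assms] F15[OF assms] F16[OF assms]
        trans[OF F18[OF assms] F17[OF assms]]; assumption)+

definition slot :: "nat \<Rightarrow> nat \<Rightarrow> nat" where "slot i x = (x mod q + F 18 i (F 15 i x 0 0) 0 0) mod (4 * q)"

lemma slot_less: "slot i x < 4 * q"
  by (simp add: slot_def)

lemma slot_inj:
  assumes "i < l" "x < n" "unowned i x" "y < n" "unowned i y" "slot i x = slot i y" shows "x = y"
  using displacement.slot_inj[OF displ[OF assms(1)] assms(2-5)] assms(6)
  by (simp add: displacement.slot_def[OF displ[OF assms(1)]] slot_def)

lemma F19:
  assumes "i < l" "h < 4 * q"
  shows "F 19 i h 0 0 = (if mu n (\<lambda>x. unowned i x \<and> slot i x = h) < n then Suc (mu n (\<lambda>x. unowned i x \<and> slot i x = h)) else 0)"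
proof (rule F_eqI)
  have "Suc x < W" if "x < n" for x using that lessW(1) by linarith
  then show "(if mu n (\<lambda>x. unowned i x \<and> slot i x = h) < n then Suc (mu n (\<lambda>x. unowned i x \<and> slot i x = h)) else 0) < W"
    by simp
  show "ev (R 19 i h 0 0) [idx W 19 i h 0 0, W, 19, i, h, 0, 0] (tabs ! 19) =
    (if mu n (\<lambda>x. unowned i x \<and> slot i x = h) < n then Suc (mu n (\<lambda>x. unowned i x \<and> slot i x = h)) else 0)"
    using assms by (simp add: tabs_def slot_def F15_less cong: mu_cong' conj_cong)
qed (use assms in auto)

lemma F20: "i < l \<Longrightarrow> h < 4 * q \<Longrightarrow> F 20 i h 0 0 = (if F 19 i h 0 0 \<noteq> 0 then F 11 i (F 19 i h 0 0 - 1) 0 0 else 0)"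
  by (rule F_eqI) (simp_all add: tabs_def F_less less_imp_diff_less)

section \<open>Pointers to the pairs and the layout of the oracle\<close>

lemma F21: "s < n \<Longrightarrow> F 21 s 0 0 0 = mu l (\<lambda>i. src i = s)"
  by (rule F_eqI) (simp_all add: tabs_def cong: mu_cong')

lemma F22: "i < l \<Longrightarrow> y < q \<Longrightarrow> F 22 i y 0 0 = mu l (\<lambda>j. src j = src i \<and> snk j div q = y)"
  by (rule F_eqI) (simp_all add: tabs_def cong: mu_cong' conj_cong)

lemma F23: "i < l \<Longrightarrow> y < q \<Longrightarrow> F 23 i y 0 0 = mu l (\<lambda>j. src j = src i \<and> snk j div q = snk i div q \<and> snk j mod q = y)"
  by (rule F_eqI) (simp_all add: tabs_def cong: mu_cong' conj_cong)

lemma F24: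
  assumes "x < n"
  shows "F 24 x 0 0 0 = F 21 x 0 0 0" "F 24 x 1 0 0 = ono 0 x" "F 24 x 2 0 0 = rank 0 x" "F 24 x 3 0 0 = F 11 (own 0 x) x 0 0"
    "F 24 x 4 0 0 = ono 1 x" "F 24 x 5 0 0 = rank 1 x" "F 24 x 6 0 0 = F 11 (own 1 x) x 0 0"
  by (rule F_eqI; use assms in \<open>simp add: tabs_def F_less rank_less ono_less\<close>)+

lemma jqW: "j < 4 \<Longrightarrow> y < q \<Longrightarrow> j * q + y < 4 * q"
proof -
  assume "j < 4" "y < q"
  then have "j * q + y < Suc j * q" by simp
  also have "\<dots> \<le> 4 * q" using \<open>j < 4\<close> by (intro mult_le_mono1) simp
  finally show ?thesis .
qed

lemma jqW' [simp]: "j < 4 \<Longrightarrow> y < q \<Longrightarrow> j * q + y < W"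
  using jqW qW(5) by blast

text \<open>The count of twenty: the reachability flag, two pointer arrays, column displacements,
  row displacements (2), slots (4), exits of the slots (4), and three arrays for each class.\<close>

lemma F25:
  assumes "i < l" "y < q"
  shows "F 25 i 0 y 0 = of_bool (avo edge {} (src i) (snk i))" "F 25 i 1 y 0 = F 22 i y 0 0" "F 25 i 2 y 0 = F 23 i y 0 0"
    "F 25 i 3 y 0 = F 14 i y 0 0" 
    "F 25 i 14 y 0 = F 9 0 i y 0" "F 25 i 15 y 0 = F 10 0 i y 0" "F 25 i 16 y 0 = F 12 0 i y 0"
    "F 25 i 17 y 0 = F 9 1 i y 0" "F 25 i 18 y 0 = F 10 1 i y 0" "F 25 i 19 y 0 = F 12 1 i y 0"
  by (rule F_eqI; use assms in \<open>simp add: tabs_def F_less avo_n\<close>)+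

lemma F25_sections:
  assumes "i < l" "y < q"
  shows "j < 2 \<Longrightarrow> F 25 i (4 + j) y 0 = F 18 i (j * q + y) 0 0"
    "j < 4 \<Longrightarrow> F 25 i (6 + j) y 0 = F 19 i (j * q + y) 0 0"
    "j < 4 \<Longrightarrow> F 25 i (10 + j) y 0 = F 20 i (j * q + y) 0 0"
  by (rule F_eqI; use assms in \<open>simp add: tabs_def F_less\<close>)+

lemma oracle_head: "F 26 0 0 0 0 = n" "F 26 0 0 0 1 = q"
  by (rule F_eqI; simp add: tabs_def)+

lemma oracle_vertex:
  assumes "x < n" "z < 7" shows "F 26 0 0 0 (2 + (7 * x + z)) = F 24 x z 0 0"
proof (rule F_eqI)
  have lt: "7 * x + z < 7 * n" using assms by linarith
  then show W: "2 + (7 * x + z) < W" using W_big by linarith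
  have "z < W" using assms W_big by linarith
  with assms lt show "ev (R 26 0 0 0 (2 + (7 * x + z))) [idx W 26 0 0 0 (2 + (7 * x + z)), W, 26, 0, 0, 0, 2 + (7 * x + z)] (tabs ! 26) = F 24 x z 0 0"
    by (simp add: tabs_def)
  show "F 24 x z 0 0 < W" using assms \<open>z < W\<close> by (simp add: F_less)
qed auto

lemma pair_word_bound:
  assumes "i < l" "g < 20" "y < q"
  shows "(20 * i + g) * q + y < 20 * (l * q)" "2 + 7 * n + 20 * (l * q) < W"
proof -
  have "(20 * i + g) * q + y < Suc (20 * i + g) * q" using assms by simp
  also have "\<dots> \<le> (20 * l) * q" using assms by (intro mult_le_mono1) linarith
  finally show "(20 * i + g) * q + y < 20 * (l * q)" by (simp add: mult.assoc)
  have "l * q \<le> n * n * n" using ml q_props by (intro mult_le_mono) auto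
  moreover have "n \<le> n * n * n" using n0 by (cases n) auto
  ultimately show "2 + 7 * n + 20 * (l * q) < W" using W_big n0 by linarith
qed

lemma oracle_pair:
  assumes "i < l" "g < 20" "y < q"
  shows "F 26 0 0 0 (2 + 7 * n + ((20 * i + g) * q + y)) = F 25 i g y 0"
proof (rule F_eqI)
  let ?r = "(20 * i + g) * q + y"
  show W: "2 + 7 * n + ?r < W" using pair_word_bound[OF assms] by linarith
  have r: "?r div q = 20 * i + g" "?r mod q = y" "(20 * i + g) div 20 = i" "(20 * i + g) mod 20 = g"
    using assms by simp_all
  have dif: "2 + 7 * n + ?r - (2 + 7 * n) = ?r" by simp
  show "ev (R 26 0 0 0 (2 + 7 * n + ?r)) [idx W 26 0 0 0 (2 + 7 * n + ?r), W, 26, 0, 0, 0, 2 + 7 * n + ?r] (tabs ! 26) = F 25 i g y 0"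
    using assms by (simp add: tabs_def r dif del: add_2_eq_Suc add_2_eq_Suc')
  show "F 25 i g y 0 < W" using assms by (simp add: F_less)
qed auto

end

section \<open>Correctness of the answers\<close>

context tables
begin

lemma Cut_crit: "Cut b i x \<Longrightarrow> crit edge (src i) (snk i) x"
  by (simp add: Cut_def cut_crit)

lemma crit_Cut: "crit edge (src i) (snk i) x \<longleftrightarrow> Cut 0 i x \<or> Cut 1 i x"
  by (simp add: Cut_def cut_def crit_cut[of _ _ _ x rp])

text \<open>A vertex that can be reached without \<open>x\<close> can be reached without the later
  \<open>y\<close>, since otherwise \<open>y\<close> could be reached without \<open>x\<close>. In
  addition \<open>x\<close> itself is gained.\<close>

lemma rk_less:
  assumes "Cut b j x" "Cut b j y" "x < n" "avo edge {y} (src j) x"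
  shows "rk j x < rk j y"
proof -
  let ?A = "\<lambda>z. {u. u < n \<and> avo edge {z} (src j) u}"
  note c = Cut_crit[OF assms(1)] Cut_crit[OF assms(2)]
  have "?A x \<subseteq> ?A y"
    using avo_through[of edge "{x}" "src j" _ y] crit_antisym[OF c assms(4)] by blast
  moreover have "x \<in> ?A y" "x \<notin> ?A x" using assms(3,4) avo_notin(2)[of edge "{x}" "src j" x] by auto
  ultimately have "?A x \<subset> ?A y" by blast
  then show ?thesis unfolding rk_def using psubset_card_mono[of "?A y" "?A x"] by simp
qed

lemma rk_before:
  assumes "Cut b j x" "Cut b j y" "x < n" "y < n"
  shows "rk j x < rk j y \<Longrightarrow> avo edge {y} (src j) x" "rk j x = rk j y \<Longrightarrow> x = y"
proof -
  have "x = y \<or> avo edge {y} (src j) x \<or> avo edge {x} (src j) y"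
    using crit_order[OF Cut_crit[OF assms(1)] Cut_crit[OF assms(2)]] by blast
  then show "rk j x < rk j y \<Longrightarrow> avo edge {y} (src j) x" "rk j x = rk j y \<Longrightarrow> x = y"
    using rk_less[OF assms(1,2,3)] rk_less[OF assms(2,1,4)] by auto
qed

abbreviation lo :: "nat \<Rightarrow> nat \<Rightarrow> nat \<Rightarrow> nat" where "lo b i x \<equiv> F 9 b i (ono b x) 0"
abbreviation hi :: "nat \<Rightarrow> nat \<Rightarrow> nat \<Rightarrow> nat" where "hi b i x \<equiv> F 10 b i (ono b x) 0"

definition listed :: "nat \<Rightarrow> nat \<Rightarrow> nat \<Rightarrow> bool" where
  "listed b i x \<longleftrightarrow> lo b i x \<le> rank b x \<and> rank b x \<le> hi b i x"

definition listed_exit :: "nat \<Rightarrow> nat \<Rightarrow> nat \<Rightarrow> nat" where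
  "listed_exit b i x = (if rank b x = hi b i x then F 12 b i (ono b x) 0 else F 11 (own b x) x 0 0)"

lemma own_holds: "own b x < l \<Longrightarrow> isO b (own b x) \<and> Cut b (own b x) x"
  unfolding own_def by (rule mu_holds)

lemma rank_bounds: "own b x < l \<Longrightarrow> 0 < rank b x" "rank b x \<le> n + 1"
  using rk_le[of "own b x" x] by (auto simp: rank_def rk_def)

lemma shared_own:
  assumes "b < 2" "shared b i (ono b x) y" "own b x < l" shows "own b y = own b x"
  using assms own_holds greedy_owners.owner_number_inj[OF greedy[OF assms(1)], of "own b y" "own b x"]
  by (auto simp: shared_def ono_def)

lemma listed_complete:
  assumes "b < 2" "i < l" "x < n" "Cut b i x" "own b x < l"
  shows "listed b i x"
proof -
  have s: "shared b i (ono b x) x" using assms by (simp add: shared_def)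
  have "lo b i x \<le> rank b x"
    unfolding F9[OF assms(1,2) ono_less]
    by (rule mu_le_wit) (use s assms(3) rank_bounds(2)[of b x] in auto)
  moreover have "mu (n + 2) (\<lambda>r. \<exists>y<n. shared b i (ono b x) y \<and> rank b y = n + 1 - r) \<le> n + 1 - rank b x"
    by (rule mu_le_wit) (use s assms(3) rank_bounds(2)[of b x] in auto)
  then have "rank b x \<le> hi b i x"
    unfolding F10[OF assms(1,2) ono_less] using rank_bounds(2)[of b x] by linarith
  ultimately show ?thesis by (simp add: listed_def)
qed

text \<open>In the order of the owner, \<open>x\<close> lies between the shared vertices
  \<open>x1\<close> and \<open>x2\<close> of extreme rank, so \<open>cut_interval\<close> transfers
  it to the pair.\<close>

lemma listed_sound:
  assumes "b < 2" "i < l" "x < n" "listed b i x"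
  shows "Cut b i x" "own b x < l" "listed_exit b i x = F 11 i x 0 0"
proof -
  have lohi: "lo b i x \<le> rank b x" "rank b x \<le> hi b i x" using assms(4) by (simp_all add: listed_def)
  let ?P = "\<lambda>r. \<exists>y<n. shared b i (ono b x) y \<and> rank b y = r"
  let ?Q = "\<lambda>r. \<exists>y<n. shared b i (ono b x) y \<and> rank b y = n + 1 - r"
  \<comment> \<open>Below the default value, so some shared vertex attains
    \<open>lo\<close>.\<close>
  have "lo b i x < n + 2" using lohi rank_bounds(2)[of b x] by linarith
  then have lo: "?P (lo b i x)"
    unfolding F9[OF assms(1,2) ono_less] by (rule mu_holds)
  then have "0 < lo b i x" using rank_bounds(1) by (metis shared_def)
  then have r0: "0 < rank b x" using lohi by linarith
  then show own: "own b x < l" by (auto simp: rank_def split: if_splits)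
  have "0 < hi b i x" using r0 lohi by linarith
  then have "mu (n + 2) ?Q < n + 2" unfolding F10[OF assms(1,2) ono_less] by linarith
  then have "?Q (mu (n + 2) ?Q)" by (rule mu_holds)
  then have hi: "?P (hi b i x)" by (simp only: F10[OF assms(1,2) ono_less])
  obtain x1 where x1: "x1 < n" "shared b i (ono b x) x1" "rank b x1 = lo b i x" using lo by blast
  obtain x2 where x2: "x2 < n" "shared b i (ono b x) x2" "rank b x2 = hi b i x" using hi by blast
  let ?j = "own b x"
  have o: "own b x1 = ?j" "own b x2 = ?j" using shared_own[OF assms(1) _ own] x1 x2 by blast+
  have Cj: "Cut b ?j x" "Cut b ?j x1" "Cut b ?j x2"
    using own_holds[of b x] own_holds[of b x1] own_holds[of b x2] own o by auto
  have Ci: "Cut b i x1" "Cut b i x2" using x1 x2 by (auto simp: shared_def)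
  have rks: "rk ?j x1 \<le> rk ?j x" "rk ?j x \<le> rk ?j x2"
    using lohi x1(3) x2(3) o own by (simp_all add: rank_def)
  show C: "Cut b i x"
  proof (cases "rk ?j x1 = rk ?j x \<or> rk ?j x = rk ?j x2")
    case True
    then show ?thesis
      using rk_before(2)[OF Cj(2,1) x1(1) assms(3)] rk_before(2)[OF Cj(1,3) assms(3) x2(1)] Ci by auto
  next
    case False
    then have "rk ?j x1 < rk ?j x" "rk ?j x < rk ?j x2" using rks by auto
    then have "avo edge {x} (src ?j) x1" "avo edge {x2} (src ?j) x" "avo edge {x2} (src ?j) x1"
      using rk_before(1) Cj x1(1) x2(1) assms(3) by (meson less_trans)+
    then show ?thesis
      using cut_interval[OF scc_rep_rp] Ci Cj unfolding Cut_def by blast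
  qed
  show "listed_exit b i x = F 11 i x 0 0"
  proof (cases "rank b x = hi b i x")
    case True
    let ?S = "\<lambda>y. shared b i (ono b x) y \<and> rank b y = hi b i x"
    have "?S x" using C own True by (simp add: shared_def)
    then have lt: "mu n ?S < n" by (rule mu_less[where P = ?S, OF assms(3)])
    have "mu n ?S = x"
    proof -
      have h: "?S (mu n ?S)" using lt by (rule mu_holds)
      then have o': "own b (mu n ?S) = ?j" using shared_own[OF assms(1) _ own] by blast
      then have "rk ?j (mu n ?S) = rk ?j x" using h True own by (simp add: rank_def)
      moreover have "Cut b ?j (mu n ?S)" using own_holds[of b "mu n ?S"] o' own by simp
      ultimately show ?thesis using rk_before(2)[OF _ Cj(1) lt assms(3)] by blast
    qed
    then show ?thesis using True by (simp add: listed_exit_def F12[OF assms(1,2) ono_less])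
  next
    case False
    \<comment> \<open>\<open>x2\<close> comes later for both pairs, so both sets of exits consist of
      the edges from \<open>x\<close> after which \<open>x2\<close> is reachable without
      \<open>x\<close>.\<close>
    then have "rk ?j x \<noteq> rk ?j x2" using x2(3) o own by (simp add: rank_def)
    then have bj: "avo edge {x2} (src ?j) x" using rk_before(1)[OF Cj(1,3) assms(3) x2(1)] rks by simp
    then have bi: "avo edge {x2} (src i) x"
      using cut_agree[OF scc_rep_rp] C Ci Cj unfolding Cut_def by blast
    have "exits edge (snk ?j) x v \<longleftrightarrow> exits edge (snk i) x v" for v
      using exits_before[OF Cut_crit[OF Cj(3)] Cut_crit[OF Cj(1)] bj]
        exits_before[OF Cut_crit[OF Ci(2)] Cut_crit[OF C] bi] by simp
    then show ?thesis using False own assms by (simp add: listed_exit_def F11)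
  qed
qed

text \<open>Unowned vertices have distinct slots, and any other vertex is recognised by comparison
  with the stored key.\<close>

lemma slot_table:
  assumes "i < l" "x < n"
  shows "F 19 i (slot i x) 0 0 = Suc x \<longleftrightarrow> unowned i x"
    and "unowned i x \<Longrightarrow> F 20 i (slot i x) 0 0 = F 11 i x 0 0"
proof -
  let ?P = "\<lambda>y. unowned i y \<and> slot i y = slot i x"
  note F = F19[OF assms(1) slot_less[of i x]]
  have 1: "F 19 i (slot i x) 0 0 = Suc x" if u: "unowned i x"
  proof -
    have "?P x" using u by simp
    then have lt: "mu n ?P < n" by (rule mu_less[where P = ?P, OF assms(2)])
    have "?P (mu n ?P)" using lt by (rule mu_holds)
    then have "mu n ?P = x" using slot_inj[OF assms(1) lt _ assms(2) u] by blast
    then show ?thesis using F lt by simp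
  qed
  moreover have "unowned i x" if "F 19 i (slot i x) 0 0 = Suc x"
  proof -
    have "mu n ?P < n \<and> mu n ?P = x" using that F by (auto split: if_splits)
    then show ?thesis using mu_holds[of n ?P] by auto
  qed
  ultimately show "F 19 i (slot i x) 0 0 = Suc x \<longleftrightarrow> unowned i x" by blast
  show "F 20 i (slot i x) 0 0 = F 11 i x 0 0" if "unowned i x"
    using 1[OF that] by (simp add: F20[OF assms(1) slot_less])
qed

lemma crit_detected:
  assumes "i < l" "x < n"
  shows "crit edge (src i) (snk i) x \<longleftrightarrow> listed 0 i x \<or> listed 1 i x \<or> unowned i x"
proof -
  have "own b x \<le> l" for b unfolding own_def by (rule mu_le)
  then have "Cut b i x \<longleftrightarrow> listed b i x \<or> Cut b i x \<and> own b x = l" if "b < 2" for b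
    using listed_sound[OF that assms] listed_complete[OF that assms] by (metis le_neq_implies_less)
  from this[of 0] this[of 1] show ?thesis by (auto simp: crit_Cut unowned_def)
qed

text \<open>Without a unique exit the search returns \<open>n\<close>, which equals no
  \<open>v < n\<close>.\<close>

lemma exit_eq:
  assumes "i < l" "u < n" "v < n"
  shows "F 11 i u 0 0 = v \<longleftrightarrow> (\<forall>v'. exits edge (snk i) u v' \<longleftrightarrow> v' = v)"
proof -
  let ?P = "\<lambda>v. \<forall>v'<n. exits edge (snk i) u v' \<longleftrightarrow> v' = v"
  have ex: "exits edge (snk i) u v' \<Longrightarrow> v' < n" for v' using edge_less by (auto simp: exits_def)
  then have P: "?P v \<longleftrightarrow> (\<forall>v'. exits edge (snk i) u v' \<longleftrightarrow> v' = v)" using assms(3) by blast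
  have "mu n ?P = v \<longleftrightarrow> ?P v"
  proof
    assume "mu n ?P = v"
    then show "?P v" using mu_holds[of n ?P] assms(3) by simp
  next
    assume v: "?P v"
    then have "mu n ?P < n" by (rule mu_less[where P = ?P, OF assms(3)])
    moreover from this have "?P (mu n ?P)" by (rule mu_holds)
    ultimately show "mu n ?P = v" using v assms(3) by blast
  qed
  then show ?thesis unfolding F11[OF assms(1,2)] P .
qed

lemma vertex_answer:
  assumes "i < l" "x < n"
  shows "avo edge {x} (src i) (snk i) \<longleftrightarrow>
    avo edge {} (src i) (snk i) \<and> \<not> listed 0 i x \<and> \<not> listed 1 i x \<and> F 19 i (slot i x) 0 0 \<noteq> Suc x"
  using crit_detected[OF assms] slot_table(1)[OF assms] avo_mono[of edge "{x}" "src i" "snk i" "{}"]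
  by (auto simp: crit_def)

lemma edge_answer:
  assumes "i < l" "edge u v"
  shows "avo (\<lambda>a b. edge a b \<and> (a, b) \<noteq> (u, v)) {} (src i) (snk i) \<longleftrightarrow>
    avo edge {} (src i) (snk i) \<and> \<not> (listed 0 i u \<and> listed_exit 0 i u = v) \<and>
    \<not> (listed 1 i u \<and> listed_exit 1 i u = v) \<and> \<not> (F 19 i (slot i u) 0 0 = Suc u \<and> F 20 i (slot i u) 0 0 = v)"
proof (cases "avo edge {} (src i) (snk i)")
  case False
  have "avo (\<lambda>a b. edge a b \<and> (a, b) \<noteq> (u, v)) {} a b \<Longrightarrow> avo edge {} a b" for a b
    by (induction rule: avo_induct) (auto intro: avo_refl avo_step)
  then show ?thesis using False by blast
next
  case True
  have u: "u < n" "v < n" using edge_less[OF assms(2)] by auto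
  have "listed b i u \<Longrightarrow> listed_exit b i u = F 11 i u 0 0" if "b < 2" for b
    using listed_sound(3)[OF that assms(1) u(1)] .
  from this[of 0] this[of 1] show ?thesis
    using reach_del_edge[OF assms(2) True] crit_detected[OF assms(1) u(1)] slot_table[OF assms(1) u(1)]
      exit_eq[OF assms(1) u] True by auto
qed

lemma div_q_less: "t < n \<Longrightarrow> t div q < q"
  using q_props(2) by (simp add: less_mult_imp_div_less)

text \<open>Each pointer leads to some pair that agrees in one more part of the key: the source,
  then the high digit, then the low digit of the sink. Two digits determine the sink.\<close>

lemma pair_lookup:
  assumes "i < l" and i0: "i0 = F 21 (src i) 0 0 0" and i1: "i1 = F 22 i0 (snk i div q) 0 0"
    and i': "i' = F 23 i1 (snk i mod q) 0 0"
  shows "i0 < l" "i1 < l" "i' < l" "src i' = src i" "snk i' = snk i"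
proof -
  have h: "mu l P < l \<and> P (mu l P)" if "P i" for P
    using mu_less[OF assms(1), of P] mu_holds[of l P] that by blast
  have 0: "i0 < l \<and> src i0 = src i" using h[of "\<lambda>k. src k = src i"] i0 assms(1) by (simp add: F21)
  then show "i0 < l" by simp
  have 1: "i1 < l \<and> src i1 = src i \<and> snk i1 div q = snk i div q"
    using h[of "\<lambda>k. src k = src i0 \<and> snk k div q = snk i div q"] i1 0 assms(1) by (simp add: F22 div_q_less)
  then show "i1 < l" by simp
  have 2: "i' < l \<and> src i' = src i \<and> snk i' div q = snk i div q \<and> snk i' mod q = snk i mod q"
    using h[of "\<lambda>k. src k = src i1 \<and> snk k div q = snk i1 div q \<and> snk k mod q = snk i mod q"] i' 1 assms(1)
    by (simp add: F23)
  then show "i' < l" "src i' = src i" "snk i' = snk i" by (simp_all, metis div_mult_mod_eq)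
qed

end

section \<open>The query programs\<close>

definition vwT :: "tm \<Rightarrow> nat \<Rightarrow> tm" where
  "vwT x z = Ld (plT (Cn 2) (plT (tiT (Cn 7) x) (Cn z)))"

definition pwT :: "tm \<Rightarrow> nat \<Rightarrow> tm \<Rightarrow> tm" where
  "pwT i g y = Ld (plT (plT (Cn 2) (tiT (Cn 7) (Ld (Cn 0)))) (plT (tiT (plT (tiT (Cn 20) i) (Cn g)) (Ld (Cn 1))) y))"

text \<open>The offset \<open>3 * b\<close> selects the class, in the vertex record as well as among
  the sections of the pair.\<close>

definition listedT :: "nat \<Rightarrow> (tm \<Rightarrow> tm) \<Rightarrow> tm \<Rightarrow> tm \<Rightarrow> tm" where
  "listedT b chk i x = (let r = vwT x (2 + 3 * b); k = vwT x (1 + 3 * b) in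
     andT (andT (notT (lsT r (pwT i (14 + 3 * b) k))) (notT (lsT (pwT i (15 + 3 * b) k) r)))
       (chk (Ite (eqT r (pwT i (15 + 3 * b) k)) (pwT i (16 + 3 * b) k) (vwT x (3 + 3 * b)))))"

text \<open>
  The environment starts with \<open>s\<close>, \<open>t\<close> and the failing vertex, or \<open>s\<close>, \<open>t\<close> and the two ends of the
  failing edge; \<open>chk\<close> compares an exit of the third entry with the fourth, or accepts any exit.
\<close>

definition queryT :: "nat \<Rightarrow> (tm \<Rightarrow> tm) \<Rightarrow> tm" where
  "queryT L chk = Lt (vwT (Vr 0) 0) (Lt (pwT (Vr L) 1 (dvT (Vr 1) (Ld (Cn 1)))) (Lt (pwT (Vr (L + 1)) 2 (mdT (Vr 1) (Ld (Cn 1))))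
     (Lt (mdT (plT (dvT (Vr 2) (Ld (Cn 1))) (pwT (Vr (L + 2)) 3 (mdT (Vr 2) (Ld (Cn 1))))) (tiT (Cn 2) (Ld (Cn 1))))
     (Lt (mdT (plT (mdT (Vr 2) (Ld (Cn 1))) (pwT (Vr (L + 2)) 4 (Vr (L + 3)))) (tiT (Cn 4) (Ld (Cn 1))))
     (boolT (andT (pwT (Vr (L + 2)) 0 (Cn 0)) (andT (notT (listedT 0 chk (Vr (L + 2)) (Vr 2)))
       (andT (notT (listedT 1 chk (Vr (L + 2)) (Vr 2)))
         (notT (andT (eqT (pwT (Vr (L + 2)) 6 (Vr (L + 4))) (plT (Vr 2) (Cn 1))) (chk (pwT (Vr (L + 2)) 10 (Vr (L + 4)))))))))))))) "

definition vertex_queryT :: tm where "vertex_queryT = queryT 3 (\<lambda>_. Cn 1)"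
definition edge_queryT :: tm where "edge_queryT = queryT 4 (\<lambda>t. eqT t (Vr 3))"

lemma query_wf:
  "wf_tm 3 vertex_queryT" "wf_tm 4 edge_queryT" "loop_free vertex_queryT" "loop_free edge_queryT"
  by (simp_all add: vertex_queryT_def edge_queryT_def queryT_def listedT_def Let_def vwT_def pwT_def
      andT_def notT_def boolT_def)

lemma layout_map_upt: "d < N \<Longrightarrow> layout (map f [0..<N]) d = f d"
  by (simp add: layout_def)

context tables
begin

section \<open>Words of the oracle and values of the queries\<close>

definition block :: "nat list" where "block = map (F 26 0 0 0) [0..<2 + 7 * n + 20 * q * l]"

lemma block_nth: "d < 2 + 7 * n + 20 * q * l \<Longrightarrow> layout block d = F 26 0 0 0 d"
  unfolding block_def by (rule layout_map_upt)

lemma ld_nq: "layout block 0 = n" "layout block 1 = q" "layout block (Suc 0) = q"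
  using oracle_head by (simp_all add: block_nth)

lemma ev_vw:
  assumes "ev (layout block) e x < n" "z < 7"
  shows "ev (layout block) e (vwT x z) = F 24 (ev (layout block) e x) z 0 0"
proof -
  have "2 + (7 * ev (layout block) e x + z) < 2 + 7 * n + 20 * q * l" using assms by linarith
  then show ?thesis using oracle_vertex[OF assms] by (simp only: vwT_def ev.simps opv.simps block_nth)
qed

lemma ev_pw:
  assumes "ev (layout block) e i < l" "g < 20" "ev (layout block) e y < q"
  shows "ev (layout block) e (pwT i g y) = F 25 (ev (layout block) e i) g (ev (layout block) e y) 0"
proof -
  have "2 + 7 * n + ((20 * ev (layout block) e i + g) * q + ev (layout block) e y) < 2 + 7 * n + 20 * q * l"
    using pair_word_bound(1)[OF assms] by (simp add: mult.commute)
  then show ?thesis using oracle_pair[OF assms] by (simp only: pwT_def ev.simps opv.simps ld_nq block_nth)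
qed

text \<open>Arrays longer than \<open>q\<close> occupy consecutive sections, so an offset beyond
  \<open>q\<close> runs on into a later section of the same pair.\<close>

lemma ev_pw_section:
  assumes "ev (layout block) e i < l" "g + j < 20" "ev (layout block) e r div q = j"
  shows "ev (layout block) e (pwT i g r) = F 25 (ev (layout block) e i) (g + j) (ev (layout block) e r mod q) 0"
proof -
  have "ev (layout block) e r = j * q + ev (layout block) e r mod q" using assms(3) by (metis div_mult_mod_eq)
  then have "(20 * ev (layout block) e i + g) * q + ev (layout block) e r =
      (20 * ev (layout block) e i + (g + j)) * q + ev (layout block) e r mod q"
    by (simp add: algebra_simps)
  then have "ev (layout block) e (pwT i g r) = ev (layout block) e (pwT i (g + j) (mdT r (Ld (Cn 1))))"
    by (simp only: pwT_def ev.simps opv.simps ld_nq)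
  then show ?thesis using ev_pw[OF assms(1,2), of "mdT r (Ld (Cn 1))"] by (simp add: ld_nq)
qed

lemma ev_pw_sections:
  assumes i: "ev (layout block) e i < l"
  shows "ev (layout block) e r < 2 * q \<Longrightarrow> ev (layout block) e (pwT i 4 r) = F 18 (ev (layout block) e i) (ev (layout block) e r) 0 0"
    "ev (layout block) e r < 4 * q \<Longrightarrow> ev (layout block) e (pwT i 6 r) = F 19 (ev (layout block) e i) (ev (layout block) e r) 0 0"
    "ev (layout block) e r < 4 * q \<Longrightarrow> ev (layout block) e (pwT i 10 r) = F 20 (ev (layout block) e i) (ev (layout block) e r) 0 0"
  using ev_pw_section[OF i _ refl] F25_sections[OF i modq(1)] by (simp_all add: less_mult_imp_div_less div_mult_mod_eq)

lemma ono_less_q: "b < 2 \<Longrightarrow> ono b x < q"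
  using own_holds[of b x] greedy_owners.owner_number_less[OF greedy, of b "own b x"] q_props(1)
  by (simp add: ono_def)

lemma tr_listedT:
  assumes "b < 2" "ev (layout block) e i < l" "ev (layout block) e x < n"
    and chk: "\<And>t. tr (layout block) e (chk t) \<longleftrightarrow> P (ev (layout block) e t)"
  shows "tr (layout block) e (listedT b chk i x) \<longleftrightarrow>
    listed b (ev (layout block) e i) (ev (layout block) e x) \<and> P (listed_exit b (ev (layout block) e i) (ev (layout block) e x))"
proof -
  have b: "b = 0 \<or> b = 1" using assms(1) by auto
  have v: "ev (layout block) e (vwT x (1 + 3 * b)) = ono b (ev (layout block) e x)"
    "ev (layout block) e (vwT x (2 + 3 * b)) = rank b (ev (layout block) e x)"
    "ev (layout block) e (vwT x (3 + 3 * b)) = F 11 (own b (ev (layout block) e x)) (ev (layout block) e x) 0 0"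
    using b F24[OF assms(3)] by (auto simp: ev_vw assms(3) simp del: add_2_eq_Suc add_2_eq_Suc')
  have "ev (layout block) e (pwT i (14 + 3 * b) y) = lo b (ev (layout block) e i) (ev (layout block) e x) \<and>
    ev (layout block) e (pwT i (15 + 3 * b) y) = hi b (ev (layout block) e i) (ev (layout block) e x) \<and>
    ev (layout block) e (pwT i (16 + 3 * b) y) = F 12 b (ev (layout block) e i) (ono b (ev (layout block) e x)) 0"
    if "ev (layout block) e y = ono b (ev (layout block) e x)" for y
    using b F25[OF assms(2) ono_less_q[OF assms(1), of "ev (layout block) e x"]] ono_less_q[OF assms(1), of "ev (layout block) e x"]
    by (auto simp: ev_pw assms(2) that)
  note p = this[OF v(1)]
  show ?thesis
    unfolding listedT_def Let_def by (simp add: chk v p listed_def listed_exit_def not_less del: One_nat_def add_2_eq_Suc add_2_eq_Suc')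
qed

text \<open>\<open>P\<close> abstracts the check of the exit: always true for a vertex, equality
  with the head \<open>v\<close> for an edge. The answer refers to the index \<open>i'\<close> that
  the search returns.\<close>

lemma ev_queryT:
  assumes "i < l" "x < n" "length args = L" "3 \<le> L" "args ! 0 = src i" "args ! 1 = snk i" "args ! 2 = x"
    and chk: "\<And>t e. tr (layout block) (args @ e) (chk t) \<longleftrightarrow> P (ev (layout block) (args @ e) t)"
  obtains i' where "i' < l" "src i' = src i" "snk i' = snk i"
    "ev (layout block) args (queryT L chk) = of_bool (avo edge {} (src i') (snk i') \<and>
      \<not> (listed 0 i' x \<and> P (listed_exit 0 i' x)) \<and> \<not> (listed 1 i' x \<and> P (listed_exit 1 i' x)) \<and>
      \<not> (F 19 i' (slot i' x) 0 0 = Suc x \<and> P (F 20 i' (slot i' x) 0 0)))"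
proof -
  define i0 where "i0 = F 21 (src i) 0 0 0"
  define i1 where "i1 = F 22 i0 (snk i div q) 0 0"
  define i' where "i' = F 23 i1 (snk i mod q) 0 0"
  note lk = pair_lookup[OF assms(1) i0_def i1_def i'_def]
  let ?row = "F 15 i' x 0 0"
  let ?e0 = "args @ [i0]" and ?e1 = "args @ [i0, i1]" and ?e2 = "args @ [i0, i1, i']"
  let ?e3 = "args @ [i0, i1, i', ?row]" and ?e4 = "args @ [i0, i1, i', ?row, slot i' x]"
  have at: "(args @ es) ! 0 = src i" "(args @ es) ! 1 = snk i" "(args @ es) ! (Suc 0) = snk i" "(args @ es) ! 2 = x"
    "(args @ es) ! (L + k) = es ! k" "(args @ es) ! L = es ! 0" for es k
    using assms(3-7) by (auto simp: nth_append)
  have 0: "ev (layout block) args (vwT (Vr 0) 0) = i0"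
    using at(1)[of "[]"] F24(1)[of "src i"] assms(1) by (simp add: ev_vw i0_def)
  have 1: "ev (layout block) ?e0 (pwT (Vr L) 1 (dvT (Vr 1) (Ld (Cn 1)))) = i1"
    using lk F25(2)[of i0 "snk i div q"] assms(1) by (simp add: ev_pw at ld_nq div_q_less i1_def)
  have 2: "ev (layout block) ?e1 (pwT (Vr (L + 1)) 2 (mdT (Vr 1) (Ld (Cn 1)))) = i'"
    using lk F25(3)[of i1 "snk i mod q"] assms(1) by (simp add: ev_pw at ld_nq i'_def del: add_Suc_right One_nat_def)
  have 3: "ev (layout block) ?e2 (mdT (plT (dvT (Vr 2) (Ld (Cn 1))) (pwT (Vr (L + 2)) 3 (mdT (Vr 2) (Ld (Cn 1))))) (tiT (Cn 2) (Ld (Cn 1)))) = ?row"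
    using lk F25(4)[of i' "x mod q"] F15[of i' x] assms(2) by (simp add: ev_pw at ld_nq del: add_2_eq_Suc' One_nat_def)
  have 4: "ev (layout block) ?e3 (mdT (plT (mdT (Vr 2) (Ld (Cn 1))) (pwT (Vr (L + 2)) 4 (Vr (L + 3)))) (tiT (Cn 4) (Ld (Cn 1)))) = slot i' x"
    using lk F15_less[of i' x] assms(2) by (simp add: ev_pw_sections at ld_nq slot_def del: add_2_eq_Suc' One_nat_def)
  have r: "ev (layout block) ?e4 (pwT (Vr (L + 2)) 0 (Cn 0)) = of_bool (avo edge {} (src i') (snk i'))"
    using F25(1)[OF lk(3) q_props(1)] lk q_props(1) by (simp add: ev_pw at del: add_2_eq_Suc')
  have s: "ev (layout block) ?e4 (pwT (Vr (L + 2)) 6 (Vr (L + 4))) = F 19 i' (slot i' x) 0 0"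
    "ev (layout block) ?e4 (pwT (Vr (L + 2)) 10 (Vr (L + 4))) = F 20 i' (slot i' x) 0 0"
    using lk(3) slot_less by (simp_all add: ev_pw_sections at del: add_2_eq_Suc')
  have ls: "tr (layout block) ?e4 (listedT b chk (Vr (L + 2)) (Vr 2)) \<longleftrightarrow> listed b i' x \<and> P (listed_exit b i' x)" if "b < 2" for b
    using tr_listedT[OF that, of ?e4 "Vr (L + 2)" "Vr 2" chk P] chk[of "[i0, i1, i', ?row, slot i' x]"] lk(3) assms(2)
    by (simp add: at del: add_2_eq_Suc')
  have x1: "ev (layout block) ?e4 (plT (Vr 2) (Cn 1)) = Suc x" by (simp add: at)
  have tr0: "tr (layout block) ?e4 (pwT (Vr (L + 2)) 0 (Cn 0)) \<longleftrightarrow> avo edge {} (src i') (snk i')"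
    unfolding tr_def r by simp
  have "ev (layout block) args (queryT L chk) = ev (layout block) ?e4 
     (boolT (andT (pwT (Vr (L + 2)) 0 (Cn 0)) (andT (notT (listedT 0 chk (Vr (L + 2)) (Vr 2)))
       (andT (notT (listedT 1 chk (Vr (L + 2)) (Vr 2)))
         (notT (andT (eqT (pwT (Vr (L + 2)) 6 (Vr (L + 4))) (plT (Vr 2) (Cn 1))) (chk (pwT (Vr (L + 2)) 10 (Vr (L + 4))))))))))"
    by (simp only: queryT_def ev.simps(6) 0 1 2 3 4 append_assoc append.simps)
  also have "\<dots> = of_bool (avo edge {} (src i') (snk i') \<and>
      \<not> (listed 0 i' x \<and> P (listed_exit 0 i' x)) \<and> \<not> (listed 1 i' x \<and> P (listed_exit 1 i' x)) \<and>
      \<not> (F 19 i' (slot i' x) 0 0 = Suc x \<and> P (F 20 i' (slot i' x) 0 0)))"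
    using ls[of 0] ls[of 1] by (simp only: ev_Ite_Mu tr_simps tr0 s x1 chk)
  finally have "ev (layout block) args (queryT L chk) = of_bool (avo edge {} (src i') (snk i') \<and>
      \<not> (listed 0 i' x \<and> P (listed_exit 0 i' x)) \<and> \<not> (listed 1 i' x \<and> P (listed_exit 1 i' x)) \<and>
      \<not> (F 19 i' (slot i' x) 0 0 = Suc x \<and> P (F 20 i' (slot i' x) 0 0)))" .
  then show thesis using that[of i'] lk by blast
qed

lemma vertex_query:
  assumes "i < l" "x < n"
  shows "ev (layout block) [src i, snk i, x] vertex_queryT = of_bool (avo edge {x} (src i) (snk i))"
proof -
  obtain i' where *: "i' < l" "src i' = src i" "snk i' = snk i"
    "ev (layout block) [src i, snk i, x] vertex_queryT = of_bool (avo edge {} (src i') (snk i') \<and>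
      \<not> listed 0 i' x \<and> \<not> listed 1 i' x \<and> \<not> F 19 i' (slot i' x) 0 0 = Suc x)"
    using ev_queryT[OF assms, of "[src i, snk i, x]" 3 "\<lambda>_. Cn 1" "\<lambda>_. True"] by (auto simp: vertex_queryT_def)
  show ?thesis using vertex_answer[OF *(1) assms(2)] *(2-4) by simp
qed

lemma edge_query:
  assumes "i < l" "edge u v"
  shows "ev (layout block) [src i, snk i, u, v] edge_queryT =
    of_bool (avo (\<lambda>a b. edge a b \<and> (a, b) \<noteq> (u, v)) {} (src i) (snk i))"
proof -
  have u: "u < n" using edge_less[OF assms(2)] by simp
  obtain i' where *: "i' < l" "src i' = src i" "snk i' = snk i"
    "ev (layout block) [src i, snk i, u, v] edge_queryT = of_bool (avo edge {} (src i') (snk i') \<and>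
      \<not> (listed 0 i' u \<and> listed_exit 0 i' u = v) \<and> \<not> (listed 1 i' u \<and> listed_exit 1 i' u = v) \<and>
      \<not> (F 19 i' (slot i' u) 0 0 = Suc u \<and> F 20 i' (slot i' u) 0 0 = v))"
    using ev_queryT[OF assms(1) u, of "[src i, snk i, u, v]" 4 "\<lambda>t. eqT t (Vr 3)" "\<lambda>z. z = v"]
    by (auto simp: edge_queryT_def)
  show ?thesis using edge_answer[OF *(1) assms(2)] *(2-4) by simp
qed

end

section \<open>Graphs as machine input\<close>

context tables
begin

lemma block_eq: "map M [ev M [] startT ..< ev M [] startT + ev M [] lengthT] = block"
proof -
  have st: "ev M [] startT = W + idx W 26 0 0 0 0"
    by (simp add: startT_def M0 W idx_def power4_eq_xxxx)
  have "q = mu (Suc n) (\<lambda>z. n \<le> z * z)" using F3 by simp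
  then have ln: "ev M [] lengthT = 2 + 7 * n + 20 * q * l"
    using n0 by (simp add: lengthT_def M0[unfolded One_nat_def] M0 not_less)
  have "M (W + idx W 26 0 0 0 0 + d) = F 26 0 0 0 d" for d by (simp add: F_def idx_def add.assoc)
  then show ?thesis
    unfolding st ln block_def by (intro nth_equalityI) (simp_all del: upt_Suc)
qed

text \<open>From \<open>q \<le> 2 * sqrt n\<close> there are at most
  \<open>9 * n + 40 * l * sqrt n\<close> words, and 49 = 9 + 40.\<close>

lemma block_length: "real (length block) \<le> 49 * (real n + real l * sqrt (real n))"
proof -
  have "q - 1 \<le> sqrt (real ((q - 1) * (q - 1)))" by (simp add: real_sqrt_mult)
  also have "\<dots> \<le> sqrt (real n)" using q_props(4) by (intro real_sqrt_le_mono) linarith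
  finally have "real q \<le> 1 + sqrt (real n)" using q_props(1) by (simp add: of_nat_diff)
  moreover have "1 \<le> sqrt (real n)" using n0 by simp
  ultimately have "real q \<le> 2 * sqrt (real n)" by linarith
  then have "real l * real q \<le> real l * (2 * sqrt (real n))" by (rule mult_left_mono) simp
  moreover have "1 \<le> real n" using n0 by simp
  moreover have "real (length block) = 2 + 7 * real n + 20 * (real l * real q)"
    by (simp add: block_def)
  moreover have "0 \<le> real l * sqrt (real n)" by simp
  ultimately show ?thesis by (simp add: algebra_simps)
qed

lemma block_less: "v \<in> set block \<Longrightarrow> v < W"
proof -
  assume "v \<in> set block"
  then obtain d where d: "v = F 26 0 0 0 d" "d < 2 + 7 * n + 20 * q * l" by (auto simp: block_def)
  show "v < W"
  proof (cases "l = 0")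
    case True
    then show ?thesis using d W_big by (auto intro!: F_less)
  next
    case False
    then have "2 + 7 * n + 20 * (l * q) < W" using pair_word_bound(2)[of 0 0 0] q_props(1) by simp
    then show ?thesis using d by (auto intro!: F_less simp: mult.commute mult.left_commute)
  qed
qed

end

section \<open>Flattened lists and paths in digraphs\<close>

lemma length_flatten: "length (flatten_pairs \<nu> xs) = 2 * length xs"
  by (induction xs) (auto simp: flatten_pairs_def)

lemma nth_flatten:
  "i < length xs \<Longrightarrow> flatten_pairs \<nu> xs ! (2 * i) = \<nu> (fst (xs ! i))"
  "i < length xs \<Longrightarrow> flatten_pairs \<nu> xs ! Suc (2 * i) = \<nu> (snd (xs ! i))"
proof (induction xs arbitrary: i)
  case (Cons x xs)
  have c: "flatten_pairs \<nu> (x # xs) = \<nu> (fst x) # \<nu> (snd x) # flatten_pairs \<nu> xs"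
    by (simp add: flatten_pairs_def split_beta)
  { case 1 then show ?case using Cons by (cases i) (auto simp: c) }
  { case 2 then show ?case using Cons by (cases i) (auto simp: c) }
qed auto

lemma set_flatten: "set (flatten_pairs \<nu> xs) = (\<nu> \<circ> fst) ` set xs \<union> (\<nu> \<circ> snd) ` set xs"
  by (induction xs) (auto simp: flatten_pairs_def)

text \<open>One statement for both deletions: that of an edge changes \<open>E\<close> and leaves
  \<open>X\<close> empty, that of a vertex keeps \<open>E\<close> and puts the vertex into
  \<open>X\<close>. If an end is itself deleted, both sides are false.\<close>

lemma has_path_avo:
  assumes wf: "wf_digraph H" and inj: "inj_on \<nu> (verts H)"
    and E: "\<And>a y. a \<in> verts H \<Longrightarrow> y \<notin> X \<Longrightarrow> E (\<nu> a) y \<longleftrightarrow> (\<exists>b. (a, b) \<in> arcs_ends H \<and> y = \<nu> b)"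
    and X: "\<And>a. a \<in> verts H \<Longrightarrow> \<nu> a \<notin> X" and s: "s \<in> verts H \<or> \<nu> s \<in> X" and t: "t \<in> verts H \<or> \<nu> t \<in> X"
  shows "has_path H s t \<longleftrightarrow> avo E X (\<nu> s) (\<nu> t)"
proof -
  interpret wf_digraph H by (rule wf)
  have ends: "(a, b) \<in> arcs_ends H \<Longrightarrow> a \<in> verts H \<and> b \<in> verts H" for a b
    by (auto simp: arcs_ends_def arc_to_ends_def)
  have "has_path H s t \<longleftrightarrow> (s, t) \<in> rtrancl_on (verts H) (arcs_ends H)"
    unfolding has_path_def reachable_apath[symmetric] reachable_def ..
  also have "\<dots> \<longleftrightarrow> avo E X (\<nu> s) (\<nu> t)"
  proof
    assume "(s, t) \<in> rtrancl_on (verts H) (arcs_ends H)"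
    then show "avo E X (\<nu> s) (\<nu> t)"
    proof (induction rule: rtrancl_on_induct)
      case base
      then show ?case using X by (auto intro: avo_refl)
    next
      case (step y z)
      then have "E (\<nu> y) (\<nu> z)" using E[of y "\<nu> z"] X by blast
      then show ?case using avo_snoc[OF step(5)] X step by blast
    qed
  next
    assume a: "avo E X (\<nu> s) (\<nu> t)"
    then have st: "s \<in> verts H" "t \<in> verts H" using s t avo_notin by metis+
    have "avo E X x (\<nu> t) \<Longrightarrow> x = \<nu> a \<Longrightarrow> a \<in> verts H \<Longrightarrow> (a, t) \<in> rtrancl_on (verts H) (arcs_ends H)" for x a
    proof (induction arbitrary: a rule: avo_induct)
      case refl
      then show ?case using st(2) inj by (auto dest: inj_onD)
    next
      case (step x y)
      then obtain b where b: "(a, b) \<in> arcs_ends H" "y = \<nu> b"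
        using E[of a y] avo_notin(1)[OF step(3)] by blast
      then show ?case
        using step.IH[of b] ends[OF b(1)] step.prems by (blast intro: converse_rtrancl_on_into_rtrancl_on)
    qed
    then show "(s, t) \<in> rtrancl_on (verts H) (arcs_ends H)" using a st(1) by blast
  qed
  finally show ?thesis .
qed

lemma input_tables:
  fixes G :: "'a pair_pre_digraph"
  assumes G: "pair_fin_digraph G" and n: "n = card (pverts G)" "0 < n" and P: "P \<subseteq> pverts G \<times> pverts G"
    and nu: "numbering \<nu> G"
    and es: "distinct es" "set es = parcs G" and ps: "distinct ps" "set ps = P"
    and inp: "inp = [card (pverts G), length es, length ps] @ flatten_pairs \<nu> es @ flatten_pairs \<nu> ps"
    and W: "W = (n + 2) ^ 6" and M: "\<forall>x<W. M x = layout inp x"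
    and rec: "\<forall>k a b c d. k < 27 \<longrightarrow> a < W \<longrightarrow> b < W \<longrightarrow> c < W \<longrightarrow> d < W \<longrightarrow>
          M (W + idx W k a b c d) = ev (\<lambda>x. if x < W + idx W k a b c d then M x else 0) [idx W k a b c d, W, k, a, b, c, d] tableT mod W"
    and len: "length inp \<le> W" and sz: "length es \<le> n * n" "length ps \<le> n * n"
  shows "tables n (length es) (length ps) W M"
    and "\<And>a b. a \<in> pverts G \<Longrightarrow> tables.edge (length es) M (\<nu> a) y \<longleftrightarrow> (\<exists>b. (a, b) \<in> parcs G \<and> y = \<nu> b)"
    and "\<And>i. i < length ps \<Longrightarrow> tables.src (length es) M i = \<nu> (fst (ps ! i)) \<and> tables.snk (length es) M i = \<nu> (snd (ps ! i))"
proof -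
  interpret pair_fin_digraph G by (rule G)
  let ?m = "length es" and ?l = "length ps"
  have nuV: "\<nu> a < n" if "a \<in> pverts G" for a using nu that n(1) by (auto simp: numbering_def bij_betw_def)
  have inj: "inj_on \<nu> (pverts G)" using nu by (simp add: numbering_def bij_betw_def)
  have lenW: "3 + 2 * ?m + 2 * ?l \<le> W" using len by (simp add: inp length_flatten)
  have at: "M x = inp ! x" if "x < 3 + 2 * ?m + 2 * ?l" for x
    using M that lenW by (simp add: layout_def inp length_flatten)
  have Me: "M (3 + 2 * e) = \<nu> (fst (es ! e))" "M (4 + 2 * e) = \<nu> (snd (es ! e))" if "e < ?m" for e
    using that at[of "3 + 2 * e"] at[of "4 + 2 * e"]
    by (simp_all add: inp nth_append length_flatten nth_flatten[unfolded mult_2] nth_flatten numeral_eq_Suc)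
  have Mp: "M (3 + (2 * ?m + 2 * i)) = \<nu> (fst (ps ! i))" "M (4 + (2 * ?m + 2 * i)) = \<nu> (snd (ps ! i))" if "i < ?l" for i
    using that at[of "3 + (2 * ?m + 2 * i)"] at[of "4 + (2 * ?m + 2 * i)"]
    by (simp_all add: inp nth_append length_flatten nth_flatten[unfolded mult_2] nth_flatten numeral_eq_Suc)
  have esV: "es ! e \<in> parcs G" if "e < ?m" for e using nth_mem[OF that] es(2) by simp
  have psV: "ps ! i \<in> pverts G \<times> pverts G" if "i < ?l" for i using nth_mem[OF that] ps(2) P by blast
  show "tables n ?m ?l W M"
  proof
    show "M 0 = n" "M 1 = ?m" "M 2 = ?l" using at[of 0] at[of 1] at[of 2] n(1) by (simp_all add: inp)
    show "M (3 + 2 * e) < n \<and> M (4 + 2 * e) < n" if "e < ?m" for e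
      using Me[OF that] nuV arc_fst_in_verts[OF esV[OF that]] arc_snd_in_verts[OF esV[OF that]] by simp
    show "M (3 + (2 * ?m + 2 * i)) < n \<and> M (4 + (2 * ?m + 2 * i)) < n" if "i < ?l" for i
      using Mp[OF that] nuV psV[OF that] by (cases "ps ! i") auto
  qed (use W n(2) sz rec in auto)
  then interpret T: tables n ?m ?l W M .
  show "T.edge (\<nu> a) y \<longleftrightarrow> (\<exists>b. (a, b) \<in> parcs G \<and> y = \<nu> b)" if a: "a \<in> pverts G" for a
  proof
    assume "T.edge (\<nu> a) y"
    then obtain e where e: "e < ?m" "\<nu> (fst (es ! e)) = \<nu> a" "\<nu> (snd (es ! e)) = y"
      unfolding T.edge_def using Me by auto
    then have "fst (es ! e) = a" using inj a arc_fst_in_verts[OF esV[OF e(1)]] by (auto dest: inj_onD)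
    then show "\<exists>b. (a, b) \<in> parcs G \<and> y = \<nu> b" using esV[OF e(1)] e(3) by (metis prod.collapse)
  next
    assume "\<exists>b. (a, b) \<in> parcs G \<and> y = \<nu> b"
    then obtain b e where "y = \<nu> b" "e < ?m" "es ! e = (a, b)" using es(2) by (metis in_set_conv_nth)
    then show "T.edge (\<nu> a) y" unfolding T.edge_def using Me[of e] by auto
  qed
  show "T.src i = \<nu> (fst (ps ! i)) \<and> T.snk i = \<nu> (snd (ps ! i))" if "i < ?l" for i
    using Mp[OF that] by (simp add: T.src_def T.snk_def del: T.src_fold)
qed

lemma arcs_ends_del:
  fixes G :: "'a pair_pre_digraph"
  shows "arcs_ends (pre_digraph.del_arc (with_proj G) e) = parcs G - {e}"
    and "arcs_ends (pre_digraph.del_vert (with_proj G) x) = {(a, b) \<in> parcs G. a \<noteq> x \<and> b \<noteq> x}"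
  by (auto simp: arcs_ends_def arc_to_ends_def pre_digraph.del_arc_def pre_digraph.del_vert_def)

lemma pow_mono_exp:
  assumes "(n + 2) ^ c \<le> (2::nat) ^ w" "6 * d \<le> c" shows "((n + 2) ^ 6) ^ d \<le> (2::nat) ^ w"
proof -
  have "((n + 2) ^ 6) ^ d = (n + 2) ^ (6 * d)" by (rule power_mult[symmetric])
  also have "\<dots> \<le> (n + 2) ^ c" using assms(2) by (intro power_increasing) auto
  finally show ?thesis using assms(1) by linarith
qed

theorem theorem5p1:
  shows "\<exists>(prep :: com) (edge_query :: com) (vertex_query :: com) (c :: nat) (k :: nat) (C :: nat).
    \<forall>(G :: 'a pair_pre_digraph) (P :: ('a \<times> 'a) set) (\<nu> :: 'a \<Rightarrow> nat) (inp :: nat list)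
      (n :: nat) (w :: nat).
      pair_fin_digraph G \<longrightarrow> n = card (pverts G) \<longrightarrow> P \<subseteq> pverts G \<times> pverts G \<longrightarrow>
      numbering \<nu> G \<longrightarrow> encodes \<nu> G P inp \<longrightarrow>
      real c * log 2 (real n + 2) \<le> real w \<longrightarrow>
      (\<exists>(T :: nat) (D :: nat list).
         constructs w prep inp T D \<and>
         T \<le> C * (n + 1) ^ k \<and>
         real (length D) \<le> real C * (real n + real (card P) * sqrt (real n)) \<and>
         (\<forall>(s, t) \<in> P.
            (\<forall>(u, v) \<in> parcs G. \<exists>T' \<le> C.
               reports w edge_query D [\<nu> s, \<nu> t, \<nu> u, \<nu> v] T'
                 (has_path (pre_digraph.del_arc (with_proj G) (u, v)) s t)) \<and>
            (\<forall>x \<in> pverts G. \<exists>T' \<le> C.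
               reports w vertex_query D [\<nu> s, \<nu> t, \<nu> x] T'
                 (has_path (pre_digraph.del_vert (with_proj G) x) s t))))"
proof (rule tables_constructible[OF wf_tables, where K = 27])
  fix c0 k C0
  assume prep: "\<And>inp n w W. inp \<noteq> [] \<Longrightarrow> hd inp = n \<Longrightarrow> W = (n + 2) ^ 6 \<Longrightarrow> length inp \<le> W \<Longrightarrow> \<forall>v\<in>set inp. v < W \<Longrightarrow>
      real c0 * log 2 (real n + 2) \<le> real w \<Longrightarrow>
      \<exists>T M. constructs w (prep_com 27 tableT startT lengthT) inp T (map M [ev M [] startT ..< ev M [] startT + ev M [] lengthT]) \<and>
        T \<le> C0 * (n + 1) ^ k \<and> (\<forall>x. M x < W) \<and> (\<forall>x<W. M x = layout inp x) \<and>
        (\<forall>k a b c d. k < 27 \<longrightarrow> a < W \<longrightarrow> b < W \<longrightarrow> c < W \<longrightarrow> d < W \<longrightarrow>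
          M (W + idx W k a b c d) = ev (\<lambda>x. if x < W + idx W k a b c d then M x else 0) [idx W k a b c d, W, k, a, b, c, d] tableT mod W)"
  \<comment> \<open>\<open>W\<close> is the sixth power of \<open>n + 2\<close>, which multiplies
    the degrees of the queries by 6.\<close>
  define c where "c = c0 + 6 * dg 1 edge_queryT + 6 * dg 1 vertex_queryT"
  define C where "C = C0 + 49 + (cst edge_queryT + 2) + (cst vertex_queryT + 2)"
  show ?thesis
  proof (rule exI[of _ "prep_com 27 tableT startT lengthT"], rule exI[of _ "query_com 4 edge_queryT"],
      rule exI[of _ "query_com 3 vertex_queryT"], rule exI[of _ c], rule exI[of _ k], rule exI[of _ C],
      intro allI impI)
    fix G :: "'a pair_pre_digraph" and P \<nu> inp n w
    assume G: "pair_fin_digraph G" and n: "n = card (pverts G)" and P: "P \<subseteq> pverts G \<times> pverts G"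
      and nu: "numbering \<nu> G" and enc: "encodes \<nu> G P inp" and w: "real c * log 2 (real n + 2) \<le> real w"
    interpret pair_fin_digraph G by (rule G)
    obtain es ps where es: "distinct es" "set es = parcs G" and ps: "distinct ps" "set ps = P"
      and inp: "inp = [card (pverts G), length es, length ps] @ flatten_pairs \<nu> es @ flatten_pairs \<nu> ps"
      using enc unfolding encodes_def by blast
    define W where "W = (n + 2) ^ 6"
    have sub: "parcs G \<subseteq> pverts G \<times> pverts G" using arc_fst_in_verts arc_snd_in_verts by force
    have szl: "length xs \<le> n * n" if "distinct xs" "set xs \<subseteq> pverts G \<times> pverts G" for xs :: "('a \<times> 'a) list"
      using card_mono[OF _ that(2)] pair_finite_verts distinct_card[OF that(1)] n by (simp add: card_cartesian_product)
    have sz: "length es \<le> n * n" "length ps \<le> n * n" using szl es ps sub P by auto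
    have big: "4 * (n * n) + 3 \<le> W" "n < W"
    proof -
      have "2 ^ 4 \<le> (n + 2) ^ 4" by (rule power_mono) auto
      then have "16 * (n + 2)\<^sup>2 \<le> (n + 2) ^ 4 * (n + 2)\<^sup>2" by (intro mult_le_mono1) simp
      moreover have "(n + 2) ^ 4 * (n + 2)\<^sup>2 = W" unfolding W_def power_add[symmetric] by simp
      moreover have "(n + 2)\<^sup>2 = n * n + 4 * n + 4" by (simp add: power2_eq_square)
      ultimately show "4 * (n * n) + 3 \<le> W" "n < W" by linarith+
    qed
    have len: "length inp \<le> W" using sz big by (simp add: inp length_flatten)
    have nuV: "\<nu> a < n" if "a \<in> pverts G" for a using nu that n by (auto simp: numbering_def bij_betw_def)
    have inj: "inj_on \<nu> (pverts G)" using nu by (simp add: numbering_def bij_betw_def)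
    have vals: "\<forall>v\<in>set inp. v < W"
    proof
      fix v assume "v \<in> set inp"
      then have "v \<in> {n, length es, length ps} \<or> v \<in> \<nu> ` pverts G"
        using es ps P sub n by (auto simp: inp set_flatten)
      then show "v < W" using big sz nuV by (auto intro: less_trans le_less_trans)
    qed
    have lg: "0 \<le> log 2 (real n + 2)" by simp
    have "real c0 * log 2 (real n + 2) \<le> real c * log 2 (real n + 2)"
      using lg by (intro mult_right_mono) (auto simp: c_def)
    then have w0: "real c0 * log 2 (real n + 2) \<le> real w" using w by linarith
    have pw: "W ^ dg 1 edge_queryT \<le> 2 ^ w" "W ^ dg 1 vertex_queryT \<le> 2 ^ w"
      unfolding W_def by (rule pow_mono_exp[OF log_pow_le[OF w]]; simp add: c_def)+
    obtain T M where T: "constructs w (prep_com 27 tableT startT lengthT) inp T (map M [ev M [] startT ..< ev M [] startT + ev M [] lengthT])"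
        "T \<le> C0 * (n + 1) ^ k" "\<forall>x<W. M x = layout inp x"
      and rec: "\<forall>k a b c d. k < 27 \<longrightarrow> a < W \<longrightarrow> b < W \<longrightarrow> c < W \<longrightarrow> d < W \<longrightarrow>
          M (W + idx W k a b c d) = ev (\<lambda>x. if x < W + idx W k a b c d then M x else 0) [idx W k a b c d, W, k, a, b, c, d] tableT mod W"
      using prep[of inp n W w] inp n W_def len vals w0 by auto
    let ?D = "map M [ev M [] startT ..< ev M [] startT + ev M [] lengthT]"
    have "C0 * (n + 1) ^ k \<le> C * (n + 1) ^ k" by (simp add: C_def)
    with T(2) have T2: "T \<le> C * (n + 1) ^ k" by linarith
    have "real (length ?D) \<le> real C * (real n + real (card P) * sqrt (real n)) \<and>
         (\<forall>(s, t) \<in> P.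
            (\<forall>(u, v) \<in> parcs G. \<exists>T' \<le> C.
               reports w (query_com 4 edge_queryT) ?D [\<nu> s, \<nu> t, \<nu> u, \<nu> v] T'
                 (has_path (pre_digraph.del_arc (with_proj G) (u, v)) s t)) \<and>
            (\<forall>x \<in> pverts G. \<exists>T' \<le> C.
               reports w (query_com 3 vertex_queryT) ?D [\<nu> s, \<nu> t, \<nu> x] T'
                 (has_path (pre_digraph.del_vert (with_proj G) x) s t)))"
    \<comment> \<open>Without vertices the size bound vanishes, so the block has to be empty, and
      there is nothing to ask.\<close>
    proof (cases "n = 0")
      case True
      then have V: "pverts G = {}" using n pair_finite_verts by simp
      have "M 0 = 0" using T(3) big(2) True n by (simp add: layout_def inp)
      then have "ev M [] lengthT = 0" by (simp add: lengthT_def)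
      then show ?thesis using P V by auto
    next
      case False
      then have n0: "0 < n" by simp
      note IT = input_tables[OF G n n0 P nu es ps inp W_def T(3) rec len sz]
      interpret T: tables n "length es" "length ps" W M by (rule IT(1))
      have D: "?D = T.block" by (rule T.block_eq)
      have cardP: "card P = length ps" using ps distinct_card by metis
      have "49 * (real n + real (card P) * sqrt (real n)) \<le> real C * (real n + real (card P) * sqrt (real n))"
        by (intro mult_right_mono) (auto simp: C_def)
      then have size: "real (length ?D) \<le> real C * (real n + real (card P) * sqrt (real n))"
        unfolding D using order_trans[OF T.block_length] by (simp only: cardP)
      have W2: "2 \<le> W" using big by linarith
      have answers: "(\<forall>(u, v) \<in> parcs G. \<exists>T' \<le> C. reports w (query_com 4 edge_queryT) ?D [\<nu> s, \<nu> t, \<nu> u, \<nu> v] T'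
                 (has_path (pre_digraph.del_arc (with_proj G) (u, v)) s t)) \<and>
            (\<forall>x \<in> pverts G. \<exists>T' \<le> C. reports w (query_com 3 vertex_queryT) ?D [\<nu> s, \<nu> t, \<nu> x] T'
                 (has_path (pre_digraph.del_vert (with_proj G) x) s t))" if st: "(s, t) \<in> P" for s t
      proof -
        have stV: "s \<in> pverts G" "t \<in> pverts G" using st P by auto
        obtain i where i: "i < length ps" "ps ! i = (s, t)" using st ps(2) by (metis in_set_conv_nth)
        then have si: "T.src i = \<nu> s" "T.snk i = \<nu> t" using IT(3)[OF i(1)] by auto
        have "\<exists>T' \<le> C. reports w (query_com 4 edge_queryT) ?D [\<nu> s, \<nu> t, \<nu> u, \<nu> v] T'
                 (has_path (pre_digraph.del_arc (with_proj G) (u, v)) s t)" if uv: "(u, v) \<in> parcs G" for u v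
        proof -
          let ?H = "pre_digraph.del_arc (with_proj G) (u, v)"
          have uvV: "u \<in> pverts G" "v \<in> pverts G" using uv in_arcsD1 in_arcsD2 by auto
          have e: "T.edge (\<nu> u) (\<nu> v)" using IT(2)[OF uvV(1)] uv by blast
          have vH: "verts ?H = pverts G" by (simp add: pre_digraph.del_arc_def)
          have "has_path ?H s t \<longleftrightarrow> avo (\<lambda>a b. T.edge a b \<and> (a, b) \<noteq> (\<nu> u, \<nu> v)) {} (\<nu> s) (\<nu> t)"
          proof (rule has_path_avo)
            show "wf_digraph ?H" by (rule wf_digraph_del_arc)
            fix a y assume a: "a \<in> verts ?H"
            have e': "T.edge (\<nu> a) y \<longleftrightarrow> (\<exists>b. (a, b) \<in> parcs G \<and> y = \<nu> b)"
              by (rule IT(2)) (use a vH in simp)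
            \<comment> \<open>The numbering is injective, so the deleted pair of numbers comes from
              no arc but \<open>(u, v)\<close>.\<close>
            have key: "(\<nu> a, \<nu> b) = (\<nu> u, \<nu> v) \<longleftrightarrow> (a, b) = (u, v)" if "(a, b) \<in> parcs G" for b
              using inj_on_eq_iff[OF inj] uvV in_arcsD1[OF that] in_arcsD2[OF that] by simp
            show "T.edge (\<nu> a) y \<and> (\<nu> a, y) \<noteq> (\<nu> u, \<nu> v) \<longleftrightarrow> (\<exists>b. (a, b) \<in> arcs_ends ?H \<and> y = \<nu> b)"
            proof
              assume l: "T.edge (\<nu> a) y \<and> (\<nu> a, y) \<noteq> (\<nu> u, \<nu> v)"
              then obtain b where b: "(a, b) \<in> parcs G" "y = \<nu> b" using e' by blast
              then have "(a, b) \<in> arcs_ends ?H" unfolding arcs_ends_del using l by blast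
              then show "\<exists>b. (a, b) \<in> arcs_ends ?H \<and> y = \<nu> b" using b(2) by blast
            next
              assume "\<exists>b. (a, b) \<in> arcs_ends ?H \<and> y = \<nu> b"
              then obtain b where b: "(a, b) \<in> parcs G" "(a, b) \<noteq> (u, v)" "y = \<nu> b"
                unfolding arcs_ends_del by blast
              have "T.edge (\<nu> a) y" by (rule iffD2[OF e']) (use b in blast)
              moreover have "(\<nu> a, y) \<noteq> (\<nu> u, \<nu> v)" unfolding b(3) key[OF b(1)] by (rule b(2))
              ultimately show "T.edge (\<nu> a) y \<and> (\<nu> a, y) \<noteq> (\<nu> u, \<nu> v)" ..
            qed
          qed (use inj stV in \<open>auto simp: vH\<close>)
          then have ans: "ev (layout ?D) [\<nu> s, \<nu> t, \<nu> u, \<nu> v] edge_queryT = (if has_path ?H s t then 1 else 0)"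
            using T.edge_query[OF i(1) e] si by (simp add: D)
          have "\<exists>T'\<le>cst edge_queryT + 2. reports w (query_com (length [\<nu> s, \<nu> t, \<nu> u, \<nu> v]) edge_queryT) ?D [\<nu> s, \<nu> t, \<nu> u, \<nu> v] T' (has_path ?H s t)"
            by (rule query_reports[OF W2 _ _ _ _ _ pw(1) ans])
               (use T.block_less D query_wf nuV uvV stV big(2) in \<open>auto intro: less_trans simp: eval_nat_numeral\<close>)
          moreover have "cst edge_queryT + 2 \<le> C" by (simp add: C_def)
          ultimately show ?thesis by (auto simp: eval_nat_numeral intro: le_trans)
        qed
        moreover have "\<exists>T' \<le> C. reports w (query_com 3 vertex_queryT) ?D [\<nu> s, \<nu> t, \<nu> x] T'
                 (has_path (pre_digraph.del_vert (with_proj G) x) s t)" if x: "x \<in> pverts G" for x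
        proof -
          let ?H = "pre_digraph.del_vert (with_proj G) x"
          have vH: "verts ?H = pverts G - {x}" by (simp add: pre_digraph.del_vert_def)
          have "has_path ?H s t \<longleftrightarrow> avo T.edge {\<nu> x} (\<nu> s) (\<nu> t)"
          proof (rule has_path_avo)
            show "wf_digraph ?H" by (rule wf_digraph_del_vert)
            fix a y assume a: "a \<in> verts ?H" "y \<notin> {\<nu> x}"
            have "T.edge (\<nu> a) y \<longleftrightarrow> (\<exists>b. (a, b) \<in> parcs G \<and> y = \<nu> b)"
              by (rule IT(2)) (use a vH in simp)
            then show "T.edge (\<nu> a) y \<longleftrightarrow> (\<exists>b. (a, b) \<in> arcs_ends ?H \<and> y = \<nu> b)"
              using a unfolding arcs_ends_del vH by blast
          next
            show "\<nu> a \<notin> {\<nu> x}" if "a \<in> verts ?H" for a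
              using inj that x by (auto simp: vH dest: inj_onD)
          qed (use inj stV in \<open>auto simp: vH intro: inj_on_subset\<close>)
          then have ans: "ev (layout ?D) [\<nu> s, \<nu> t, \<nu> x] vertex_queryT = (if has_path ?H s t then 1 else 0)"
            using T.vertex_query[OF i(1) nuV[OF x]] si by (simp add: D)
          have "\<exists>T'\<le>cst vertex_queryT + 2. reports w (query_com (length [\<nu> s, \<nu> t, \<nu> x]) vertex_queryT) ?D [\<nu> s, \<nu> t, \<nu> x] T' (has_path ?H s t)"
            by (rule query_reports[OF W2 _ _ _ _ _ pw(2) ans])
               (use T.block_less D query_wf nuV x stV big(2) in \<open>auto intro: less_trans simp: eval_nat_numeral\<close>)
          moreover have "cst vertex_queryT + 2 \<le> C" by (simp add: C_def)
          ultimately show ?thesis by (auto simp: eval_nat_numeral intro: le_trans)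
        qed
        ultimately show ?thesis by blast
      qed
      then show ?thesis using size by blast
    qed
    then show "\<exists>T D. constructs w (prep_com 27 tableT startT lengthT) inp T D \<and>
         T \<le> C * (n + 1) ^ k \<and>
         real (length D) \<le> real C * (real n + real (card P) * sqrt (real n)) \<and>
         (\<forall>(s, t) \<in> P.
            (\<forall>(u, v) \<in> parcs G. \<exists>T' \<le> C.
               reports w (query_com 4 edge_queryT) D [\<nu> s, \<nu> t, \<nu> u, \<nu> v] T'
                 (has_path (pre_digraph.del_arc (with_proj G) (u, v)) s t)) \<and>
            (\<forall>x \<in> pverts G. \<exists>T' \<le> C.
               reports w (query_com 3 vertex_queryT) D [\<nu> s, \<nu> t, \<nu> x] T'
                 (has_path (pre_digraph.del_vert (with_proj G) x) s t)))"
      using T(1) T2 by blast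
  qed
qed

end
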